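(* Let $\xi=(\xi_t),\eta=(\eta_t)\in M_G^2(0,T;\mathbb{R})$ satisfy, for some constant $C\ge0$, $$\hat{\mathbb{E}}\big[|\xi_t-\xi_s|^2+|\eta_t-\eta_s|^2\big]\le C|t-s|,\qquad t,s\in[0,T].$$ Then the mapping $$[0,T]\ni t\mapsto\mathcal{P}_{\{\xi_t|\eta_t\}}:=\big\{R\in\mathcal{P}_{\{\xi_t\}}:E_R[\eta_t]=\hat{\mathbb{E}}_{\{\xi_t\}}[\eta_t]\big\}\subset\mathcal{P}$$ is a weakly measurable set-valued function with nonempty values which are compact subsets of $(\mathcal{P},d)$.
   Context: Fix $T>0$ and $0<\underline\sigma^2\le\overline\sigma^2<\infty$; $G(a)=\frac12(\overline\sigma^2a^+-\underline\sigma^2a^-)$. $\Omega=C([0,T];\mathbb{R})$ with the uniform distance and Borel $\sigma$-field $\mathcal{B}(\Omega)$; $B$ is the coordinate process; $L_{ip}(\Omega)$ is the set of random variables $\varphi(B_{t_1},B_{t_2}-B_{t_1},\dots,B_{t_n}-B_{t_{n-1}})$ with $n\ge1$, $0\le t_1<\dots<t_n\le T$, $\varphi$ bounded Lipschitz. $\hat{\mathbb{E}}$ is the $G$-expectation, i.e. the sublinear expectation on $L_{ip}(\Omega)$ under which $B$ is a one-dimensional $G$-Brownian motion: $\hat{\mathbb{E}}[\varphi(B_{t_1},\dots,B_{t_n}-B_{t_{n-1}})]=\widetilde{\mathbb{E}}[\varphi(\sqrt{t_1}\xi_1,\dots,\sqrt{t_n-t_{n-1}}\xi_n)]$, where on some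 sublinear expectation space the $\xi_i$ are identically distributed and $G$-normal (with $\widetilde{\mathbb{E}}[\xi_i^2]=\overline\sigma^2$, $-\widetilde{\mathbb{E}}[-\xi_i^2]=\underline\sigma^2$), each $\xi_i$ independent of $(\xi_1,\dots,\xi_{i-1})$ in Peng's sense. $L_G^p(\Omega)$ is the completion of $L_{ip}(\Omega)$ under $(\hat{\mathbb{E}}[|\cdot|^p])^{1/p}$ (similarly $L_G^p(\Omega_t)$, using only times $t_i\le t$). $M_G^2(0,T;\mathbb{R})$ is the completion of the step processes $\sum_i\zeta_iI_{(s_i,s_{i+1}]}$, $\zeta_i\in L_G^2(\Omega_{s_i})$, under $(\hat{\mathbb{E}}[\int_0^T|\cdot|^2ds])^{1/2}$; implicitly the processes considered satisfy $\xi_t,\eta_t\in L_G^2(\Omega)$ for every $t\in[0,T]$. $\mathcal{P}=\{P\text{ probability on }(\Omega,\mathcal{B}(\Omega)):E_P[X]\le\hat{\mathbb{E}}[X]\ \forall X\in L_G^1(\Omega)\}$; it is known to be nonempty, convex, weakly compact, with $\hat{\mathbb{E}}[\zeta]=\max_{P\in\mathcal{P}}E_P[\zeta]$ for $\zeta\in L_G^1(\Omega)$. For $\zeta,\zeta'\in L_G^1(\Omega)$: $\mathcal{P}_{\{\zeta\}}:=\{P\in\mathcal{P}:E_P[\zeta]=\hat{\mathbb{E}}[\zeta]\}$ and $\hat{\mathbb{E}}_{\{\zeta\}}[\zeta']:=\sup_{P\in\mathcal{P}_{\{\zeta\}}}E_P[\zeta']$. $d$ is a metric on $\mathcal{P}$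 compatible with weak convergence: $d(P,Q)=\sup\{\int_\Omega f\,d(P-Q):|f|_{BL}\le1\}$, $|f|_{BL}=\sup_\omega|f(\omega)|+\sup_{\omega\ne\omega'}\frac{|f(\omega)-f(\omega')|}{|\omega-\omega'|_{C([0,T])}}$. Weak measurability: for a measurable space $(X,\mathcal{G})$ and a topological space $Y$, a set-valued function $G:X\ni x\mapsto G(x)\subset Y$ with nonempty closed values is weakly measurable if $\{x\in X:G(x)\cap\mathcal{O}\neq\emptyset\}\in\mathcal{G}$ for every open $\mathcal{O}\subset Y$. Here $X=[0,T]$ with its Borel $\sigma$-field and $Y=(\mathcal{P},d)$. *)

theory Defs
  imports "HOL-Probability.Probability"
begin

subsection \<open>Sublinear expectation spaces\<close>

text \<open>
  A point of \<open>\<real>\<^sup>n\<close> is a function \<open>nat \<Rightarrow> real\<close> of which only the coordinates \<open>0, \<dots>, n - 1\<close>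
  matter. The Lipschitz estimates below are in terms of the Euclidean norm of these
  coordinates, so they force a test function to depend on its first \<open>n\<close> arguments only.
\<close>

definition eucl_norm :: "nat \<Rightarrow> (nat \<Rightarrow> real) \<Rightarrow> real" where
  "eucl_norm n x = L2_set x {..<n}"

text \<open>\<open>C\<^sub>b\<^sub>.\<^sub>L\<^sub>i\<^sub>p(\<real>\<^sup>n)\<close>: bounded Lipschitz functions.\<close>

definition C_bLip :: "nat \<Rightarrow> ((nat \<Rightarrow> real) \<Rightarrow> real) set" where
  "C_bLip n = {\<phi>. (\<exists>K. \<forall>x. \<bar>\<phi> x\<bar> \<le> K) \<and>
     (\<exists>L. \<forall>x y. \<bar>\<phi> x - \<phi> y\<bar> \<le> L * eucl_norm n (\<lambda>i. x i - y i))}"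

text \<open>\<open>C\<^sub>l\<^sub>.\<^sub>L\<^sub>i\<^sub>p(\<real>\<^sup>n)\<close>: locally Lipschitz functions of polynomial growth, Peng's test functions.\<close>

definition C_lLip :: "nat \<Rightarrow> ((nat \<Rightarrow> real) \<Rightarrow> real) set" where
  "C_lLip n = {\<phi>. \<exists>L m. \<forall>x y. \<bar>\<phi> x - \<phi> y\<bar> \<le>
     L * (1 + eucl_norm n x ^ m + eucl_norm n y ^ m) * eucl_norm n (\<lambda>i. x i - y i)}"

locale sublinear_expectation_space =
  fixes H :: "('w \<Rightarrow> real) set" and E :: "('w \<Rightarrow> real) \<Rightarrow> real"
  assumes const_mem: "(\<lambda>_. c) \<in> H"
    and add_mem: "X \<in> H \<Longrightarrow> Y \<in> H \<Longrightarrow> (\<lambda>w. X w + Y w) \<in> H"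
    and scale_mem: "X \<in> H \<Longrightarrow> (\<lambda>w. c * X w) \<in> H"
    and abs_mem: "X \<in> H \<Longrightarrow> (\<lambda>w. \<bar>X w\<bar>) \<in> H"
    and comp_mem: "\<phi> \<in> C_lLip n \<Longrightarrow> (\<And>i. i < n \<Longrightarrow> Z i \<in> H) \<Longrightarrow> (\<lambda>w. \<phi> (\<lambda>i. Z i w)) \<in> H"
    and mono: "X \<in> H \<Longrightarrow> Y \<in> H \<Longrightarrow> (\<And>w. X w \<le> Y w) \<Longrightarrow> E X \<le> E Y"
    and const: "E (\<lambda>_. c) = c"
    and subadd: "X \<in> H \<Longrightarrow> Y \<in> H \<Longrightarrow> E (\<lambda>w. X w + Y w) \<le> E X + E Y"
    and pos_hom: "X \<in> H \<Longrightarrow> 0 \<le> c \<Longrightarrow> E (\<lambda>w. c * X w) = c * E X"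

definition ident_dist ::
  "(('w \<Rightarrow> real) \<Rightarrow> real) \<Rightarrow> ('w \<Rightarrow> real) \<Rightarrow> ('w \<Rightarrow> real) \<Rightarrow> bool" where
  "ident_dist E X Y \<longleftrightarrow> (\<forall>\<phi>\<in>C_lLip 1. E (\<lambda>w. \<phi> (\<lambda>_. X w)) = E (\<lambda>w. \<phi> (\<lambda>_. Y w)))"

text \<open>
  Peng's (non-symmetric) independence of \<open>Y\<close> from \<open>(Z 0, \<dots>, Z (n - 1))\<close>: the inner expectation is
  taken over \<open>Y\<close> with the values of the \<open>Z i\<close> frozen.
\<close>

definition indep_from ::
  "(('w \<Rightarrow> real) \<Rightarrow> real) \<Rightarrow> nat \<Rightarrow> (nat \<Rightarrow> 'w \<Rightarrow> real) \<Rightarrow> ('w \<Rightarrow> real) \<Rightarrow> bool" where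
  "indep_from E n Z Y \<longleftrightarrow> (\<forall>\<phi>\<in>C_lLip (Suc n).
     E (\<lambda>w. \<phi> (\<lambda>i. if i < n then Z i w else Y w)) =
     E (\<lambda>w. E (\<lambda>w'. \<phi> (\<lambda>i. if i < n then Z i w else Y w'))))"

text \<open>
  \<open>X'\<close> is the independent copy of \<open>X\<close> in Peng's definition. Its existence in \<open>H\<close> is part of the
  definition, as otherwise the scaling identity could hold vacuously.
\<close>

definition G_normal ::
  "('w \<Rightarrow> real) set \<Rightarrow> (('w \<Rightarrow> real) \<Rightarrow> real) \<Rightarrow> real \<Rightarrow> real \<Rightarrow> ('w \<Rightarrow> real) \<Rightarrow> bool" where
  "G_normal H E \<sigma>lo \<sigma>hi X \<longleftrightarrow>
     X \<in> H \<and>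
     (\<exists>X'\<in>H. ident_dist E X' X \<and> indep_from E 1 (\<lambda>_. X) X' \<and>
        (\<forall>a b. 0 \<le> a \<longrightarrow> 0 \<le> b \<longrightarrow>
           ident_dist E (\<lambda>w. a * X w + b * X' w) (\<lambda>w. sqrt (a\<^sup>2 + b\<^sup>2) * X w))) \<and>
     E (\<lambda>w. (X w)\<^sup>2) = \<sigma>hi\<^sup>2 \<and> - E (\<lambda>w. - (X w)\<^sup>2) = \<sigma>lo\<^sup>2"


subsection \<open>Path space and cylinder random variables\<close>

text \<open>
  \<open>C([0,T];\<real>)\<close> with the uniform distance. Its points are continuous on \<open>{0..T}\<close> and extensional
  (\<open>undefined\<close> outside \<open>{0..T}\<close>), so they are determined by their values on \<open>{0..T}\<close>.
\<close>

definition path_metric :: "real \<Rightarrow> (real \<Rightarrow> real) metric" where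
  "path_metric T = cfunspace (top_of_set {0..T}) euclidean_metric"

abbreviation path_space :: "real \<Rightarrow> (real \<Rightarrow> real) set" where
  "path_space T \<equiv> mspace (path_metric T)"

definition path_borel :: "real \<Rightarrow> (real \<Rightarrow> real) measure" where
  "path_borel T = sigma (path_space T) {U. openin (mtopology_of (path_metric T)) U}"

definition path_probs :: "real \<Rightarrow> (real \<Rightarrow> real) measure set" where
  "path_probs T = {P. prob_space P \<and> sets P = sets (path_borel T)}"

text \<open>Successive differences, the first one being \<open>x 0\<close> itself.\<close>

definition incr :: "(nat \<Rightarrow> real) \<Rightarrow> nat \<Rightarrow> real" where
  "incr x i = x i - (if i = 0 then 0 else x (i - 1))"

text \<open>Time grids \<open>0 \<le> t\<^sub>1 < \<dots> < t\<^sub>n \<le> T\<close>, with \<open>t\<^sub>i\<close> written \<open>t (i - 1)\<close>.\<close>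

definition time_grid :: "real \<Rightarrow> nat \<Rightarrow> (nat \<Rightarrow> real) \<Rightarrow> bool" where
  "time_grid T n t \<longleftrightarrow> 1 \<le> n \<and> 0 \<le> t 0 \<and> (\<forall>i. Suc i < n \<longrightarrow> t i < t (Suc i)) \<and> t (n - 1) \<le> T"

text \<open>\<open>L\<^sub>i\<^sub>p(\<Omega>\<^sub>t)\<close>; the coordinate process is \<open>B\<^sub>s(\<omega>) = \<omega> s\<close>.\<close>

definition Lip :: "real \<Rightarrow> ((real \<Rightarrow> real) \<Rightarrow> real) set" where
  "Lip t = {\<lambda>\<omega>. \<phi> (incr (\<lambda>i. \<omega> (s i))) | n s \<phi>. time_grid t n s \<and> \<phi> \<in> C_bLip n}"


subsection \<open>G-expectation\<close>

text \<open>
  \<open>E\<close> is the G-expectation on \<open>L\<^sub>i\<^sub>p(\<Omega>\<^sub>T)\<close>, obtained from the sequence \<open>\<xi>\<close> on the sublinear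
  expectation space \<open>(H, E')\<close>. Nothing is said about \<open>E\<close> outside \<open>L\<^sub>i\<^sub>p(\<Omega>\<^sub>T)\<close>.
\<close>

definition G_expectation ::
  "real \<Rightarrow> real \<Rightarrow> real \<Rightarrow> ('w \<Rightarrow> real) set \<Rightarrow> (('w \<Rightarrow> real) \<Rightarrow> real) \<Rightarrow> (nat \<Rightarrow> 'w \<Rightarrow> real) \<Rightarrow>
   (((real \<Rightarrow> real) \<Rightarrow> real) \<Rightarrow> real) \<Rightarrow> bool" where
  "G_expectation \<sigma>lo \<sigma>hi T H E' \<xi> E \<longleftrightarrow>
     sublinear_expectation_space H E' \<and>
     (\<forall>i. G_normal H E' \<sigma>lo \<sigma>hi (\<xi> i)) \<and>
     (\<forall>i j. ident_dist E' (\<xi> i) (\<xi> j)) \<and>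
     (\<forall>i. indep_from E' i \<xi> (\<xi> i)) \<and>
     (\<forall>n t \<phi>. time_grid T n t \<and> \<phi> \<in> C_bLip n \<longrightarrow>
        E (\<lambda>\<omega>. \<phi> (incr (\<lambda>i. \<omega> (t i)))) = E' (\<lambda>w. \<phi> (\<lambda>i. sqrt (incr t i) * \<xi> i w)))"

text \<open>
  The completion \<open>L\<^sub>G\<^sup>p\<close> of \<open>L\<^sub>i\<^sub>p\<close> is realised by random variables on \<open>\<Omega>\<close> rather than by abstract
  classes of Cauchy sequences, so that the linear expectations \<open>E\<^sub>P[X]\<close> are ordinary integrals.
  A random variable \<open>X\<close> represents the class of the sequence \<open>Y\<close>, Cauchy for
  \<open>(E[|\<cdot>|\<^sup>p])\<^sup>1\<^sup>/\<^sup>p\<close>, if it is the limit of \<open>Y\<close> in \<open>L\<^sup>p(P)\<close> for all \<open>P\<close> that are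
  dominated by \<open>E\<close> on \<open>L\<^sub>i\<^sub>p(\<Omega>\<^sub>T)\<close>. Representatives are thus determined up to quasi-sure equality.
\<close>

definition LG_norm :: "(((real \<Rightarrow> real) \<Rightarrow> real) \<Rightarrow> real) \<Rightarrow> nat \<Rightarrow> ((real \<Rightarrow> real) \<Rightarrow> real) \<Rightarrow> real" where
  "LG_norm E p X = root p (E (\<lambda>\<omega>. \<bar>X \<omega>\<bar> ^ p))"

definition Lip_dominated ::
  "real \<Rightarrow> (((real \<Rightarrow> real) \<Rightarrow> real) \<Rightarrow> real) \<Rightarrow> (real \<Rightarrow> real) measure set" where
  "Lip_dominated T E = {P \<in> path_probs T. \<forall>X\<in>Lip T. (\<integral>\<omega>. X \<omega> \<partial>P) \<le> E X}"

definition LG_approx ::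
  "real \<Rightarrow> (((real \<Rightarrow> real) \<Rightarrow> real) \<Rightarrow> real) \<Rightarrow> nat \<Rightarrow> real \<Rightarrow>
   (nat \<Rightarrow> (real \<Rightarrow> real) \<Rightarrow> real) \<Rightarrow> ((real \<Rightarrow> real) \<Rightarrow> real) \<Rightarrow> bool" where
  "LG_approx T E p t Y X \<longleftrightarrow>
     (\<forall>n. Y n \<in> Lip t) \<and>
     (\<forall>\<epsilon>>0. \<exists>N. \<forall>m\<ge>N. \<forall>n\<ge>N. LG_norm E p (\<lambda>\<omega>. Y m \<omega> - Y n \<omega>) < \<epsilon>) \<and>
     (\<forall>P\<in>Lip_dominated T E. (\<lambda>n. \<integral>\<^sup>+\<omega>. ennreal (\<bar>Y n \<omega> - X \<omega>\<bar> ^ p) \<partial>P) \<longlonglongrightarrow> 0)"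

text \<open>\<open>LG T E p t\<close> is \<open>L\<^sub>G\<^sup>p(\<Omega>\<^sub>t)\<close>.\<close>

definition LG ::
  "real \<Rightarrow> (((real \<Rightarrow> real) \<Rightarrow> real) \<Rightarrow> real) \<Rightarrow> nat \<Rightarrow> real \<Rightarrow> ((real \<Rightarrow> real) \<Rightarrow> real) set" where
  "LG T E p t = {X \<in> borel_measurable (path_borel T). \<exists>Y. LG_approx T E p t Y X}"

text \<open>The continuous extension of \<open>E\<close> from \<open>L\<^sub>i\<^sub>p(\<Omega>\<^sub>T)\<close> to \<open>L\<^sub>G\<^sup>1(\<Omega>\<^sub>T)\<close>.\<close>

definition Ehat :: "real \<Rightarrow> (((real \<Rightarrow> real) \<Rightarrow> real) \<Rightarrow> real) \<Rightarrow> ((real \<Rightarrow> real) \<Rightarrow> real) \<Rightarrow> real" where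
  "Ehat T E X = (THE l. \<exists>Y. LG_approx T E 1 T Y X \<and> (\<lambda>n. E (Y n)) \<longlonglongrightarrow> l)"

definition rep_measures ::
  "real \<Rightarrow> (((real \<Rightarrow> real) \<Rightarrow> real) \<Rightarrow> real) \<Rightarrow> (real \<Rightarrow> real) measure set" where
  "rep_measures T E = {P \<in> path_probs T. \<forall>X\<in>LG T E 1 T. (\<integral>\<omega>. X \<omega> \<partial>P) \<le> Ehat T E X}"

definition step_processes ::
  "real \<Rightarrow> (((real \<Rightarrow> real) \<Rightarrow> real) \<Rightarrow> real) \<Rightarrow> (real \<Rightarrow> (real \<Rightarrow> real) \<Rightarrow> real) set" where
  "step_processes T E =
     {\<lambda>r \<omega>. \<Sum>i<N. \<zeta> i \<omega> * indicator {s i<..s (Suc i)} r | N s \<zeta>.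
        0 \<le> s 0 \<and> (\<forall>i<N. s i < s (Suc i)) \<and> s N \<le> T \<and> (\<forall>i<N. \<zeta> i \<in> LG T E 2 (s i))}"

text \<open>
  \<open>M\<^sub>G\<^sup>2(0,T;\<real>)\<close>, realised by jointly measurable processes in the same way as \<open>L\<^sub>G\<^sup>p\<close>: the process is
  the limit, in \<open>L\<^sup>2(dr \<times> P)\<close> for all \<open>P\<close>, of a Cauchy sequence of step processes.
\<close>

definition MG2 ::
  "real \<Rightarrow> (((real \<Rightarrow> real) \<Rightarrow> real) \<Rightarrow> real) \<Rightarrow> (real \<Rightarrow> (real \<Rightarrow> real) \<Rightarrow> real) set" where
  "MG2 T E = {\<xi>.
     (\<lambda>(r, \<omega>). \<xi> r \<omega>) \<in> borel_measurable (restrict_space borel {0..T} \<Otimes>\<^sub>M path_borel T) \<and>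
     (\<exists>h. (\<forall>n. h n \<in> step_processes T E) \<and>
        (\<forall>\<epsilon>>0. \<exists>N. \<forall>m\<ge>N. \<forall>n\<ge>N.
           sqrt (Ehat T E (\<lambda>\<omega>. LINT r:{0..T}|lborel. \<bar>h m r \<omega> - h n r \<omega>\<bar>\<^sup>2)) < \<epsilon>) \<and>
        (\<forall>P\<in>rep_measures T E.
           (\<lambda>n. \<integral>\<^sup>+\<omega>. (\<integral>\<^sup>+r\<in>{0..T}. ennreal (\<bar>h n r \<omega> - \<xi> r \<omega>\<bar>\<^sup>2) \<partial>lborel) \<partial>P) \<longlonglongrightarrow> 0))}"


subsection \<open>Maximising measures\<close>

definition max_measures ::
  "real \<Rightarrow> (((real \<Rightarrow> real) \<Rightarrow> real) \<Rightarrow> real) \<Rightarrow> ((real \<Rightarrow> real) \<Rightarrow> real) \<Rightarrow> (real \<Rightarrow> real) measure set" where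
  "max_measures T E \<zeta> = {P \<in> rep_measures T E. (\<integral>\<omega>. \<zeta> \<omega> \<partial>P) = Ehat T E \<zeta>}"

definition Ehat_on_max ::
  "real \<Rightarrow> (((real \<Rightarrow> real) \<Rightarrow> real) \<Rightarrow> real) \<Rightarrow> ((real \<Rightarrow> real) \<Rightarrow> real) \<Rightarrow> ((real \<Rightarrow> real) \<Rightarrow> real) \<Rightarrow> real" where
  "Ehat_on_max T E \<zeta> \<zeta>' = (SUP P\<in>max_measures T E \<zeta>. \<integral>\<omega>. \<zeta>' \<omega> \<partial>P)"

definition max_measures2 ::
  "real \<Rightarrow> (((real \<Rightarrow> real) \<Rightarrow> real) \<Rightarrow> real) \<Rightarrow> ((real \<Rightarrow> real) \<Rightarrow> real) \<Rightarrow> ((real \<Rightarrow> real) \<Rightarrow> real) \<Rightarrow>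
   (real \<Rightarrow> real) measure set" where
  "max_measures2 T E \<zeta> \<zeta>' = {R \<in> max_measures T E \<zeta>. (\<integral>\<omega>. \<zeta>' \<omega> \<partial>R) = Ehat_on_max T E \<zeta> \<zeta>'}"


subsection \<open>Bounded Lipschitz metric and weak measurability\<close>

text \<open>Valued in \<open>ennreal\<close>, so that it is \<open>\<infinity>\<close> for functions that are unbounded or not Lipschitz.\<close>

definition BL_norm :: "real \<Rightarrow> ((real \<Rightarrow> real) \<Rightarrow> real) \<Rightarrow> ennreal" where
  "BL_norm T f = (SUP \<omega>\<in>path_space T. ennreal \<bar>f \<omega>\<bar>) +
     (SUP (\<omega>, \<omega>')\<in>{(\<omega>, \<omega>'). \<omega> \<in> path_space T \<and> \<omega>' \<in> path_space T \<and> \<omega> \<noteq> \<omega>'}.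
        ennreal (\<bar>f \<omega> - f \<omega>'\<bar> / mdist (path_metric T) \<omega> \<omega>'))"

text \<open>
  The value \<open>0\<close> outside \<open>path_probs T\<close> is irrelevant; it is there because the library's
  \<open>Metric_space\<close> requires distances to be non-negative also outside the carrier.
\<close>

definition BL_dist :: "real \<Rightarrow> (real \<Rightarrow> real) measure \<Rightarrow> (real \<Rightarrow> real) measure \<Rightarrow> real" where
  "BL_dist T P Q = (if P \<in> path_probs T \<and> Q \<in> path_probs T
     then (SUP f\<in>{f. BL_norm T f \<le> 1}. (\<integral>\<omega>. f \<omega> \<partial>P) - (\<integral>\<omega>. f \<omega> \<partial>Q)) else 0)"

definition rep_topology ::
  "real \<Rightarrow> (((real \<Rightarrow> real) \<Rightarrow> real) \<Rightarrow> real) \<Rightarrow> (real \<Rightarrow> real) measure topology" where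
  "rep_topology T E = Metric_space.mtopology (rep_measures T E) (BL_dist T)"

definition weakly_measurable :: "'x measure \<Rightarrow> 'y topology \<Rightarrow> ('x \<Rightarrow> 'y set) \<Rightarrow> bool" where
  "weakly_measurable M Y F \<longleftrightarrow>
     (\<forall>x\<in>space M. F x \<noteq> {} \<and> closedin Y (F x)) \<and>
     (\<forall>U. openin Y U \<longrightarrow> {x \<in> space M. F x \<inter> U \<noteq> {}} \<in> sets M)"

end

theory Submission
  imports Defs
begin

text \<open>
  Let \<open>\<P>\<close> be the set of laws on path space that are dominated by \<open>E\<close> on cylinder functions. On cylinder
  functions \<open>E\<close> is a maximum over \<open>\<P>\<close>: Hahn--Banach gives a linear functional below \<open>E\<close> touching it at a
  prescribed point, that is, a finitely additive law; it is realised by random variables on the unit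
  interval indexed by dyadic times, and the bound \<open>E[\<bar>B\<^sub>t - B\<^sub>s\<bar>\<^sup>4] \<le> M (t - s)\<^sup>2\<close> makes these extend to continuous
  paths. The same bound makes \<open>\<P>\<close> uniformly tight, so that \<open>\<P>\<close>, with the bounded Lipschitz metric, is a
  continuous image of the set of linear functionals below \<open>E\<close>, which is compact by Tychonoff.

  On \<open>L\<^sub>G\<^sup>1\<close> the extended expectation is the maximum over \<open>\<P>\<close>, so the set in question consists of the
  maximisers of \<open>E\<^sub>P[\<eta>\<^sub>t]\<close> among the maximisers of \<open>E\<^sub>P[\<xi>\<^sub>t]\<close>; both are jointly continuous in \<open>(t, P)\<close> by the
  regularity assumption. For compact \<open>K\<close> the times at which a first-stage maximiser in \<open>K\<close> has second
  value at least \<open>a\<close> form a closed set, and whether the set of iterated maximisers meets \<open>K\<close> is decided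
  by these closed sets for rational \<open>a\<close>.
\<close>

subsection \<open>The path space\<close>

text \<open>That \<P> represents \<open>E\<close> and is compact has to be proved from values of
  \<open>E\<close> on cylinder functions alone; \<open>Ehat\<close> and \<P> are built from these
  afterwards. A functional obtained from Hahn--Banach has no continuity along sequences of
  functions, so countable additivity must come from moment bounds: once for single coordinates, to
  keep mass from escaping, and once for the modulus of continuity of paths. Second moments of
  increments give only \<open>t - s\<close>, whereas a union over \<open>2 ^ k\<close> dyadic steps
  needs an exponent above 1; fourth moments scale as \<open>(t - s) ^ 2\<close>. Working with
  functionals makes compactness closed under limits for free: a pointwise limit of linear
  functionals below \<open>E\<close> is again one, and the same representation theorem applies to
  it. In the last part the obstacle is that the first-stage maximisers have a closed graph in
  \<open>t\<close> but may be more numerous at a limit time than nearby. The optimal second-stage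
  value is then only upper semicontinuous in \<open>t\<close>, and the iterated maximisers need not
  have a closed graph, so no plain continuity argument gives measurability.\<close>

lemma path_space_iff:
  "\<omega> \<in> path_space T \<longleftrightarrow> \<omega> \<in> extensional {0..T} \<and> continuous_on {0..T} \<omega>"
proof -
  \<comment> \<open>Members of \<open>cfunspace\<close> are bounded continuous maps; on a compact
    domain boundedness is automatic.\<close>
  have "compactin (top_of_set {0..T}) (topspace (top_of_set {0..T}))"
    by (simp add: compactin_subtopology)
  from compactin_mspace_cfunspace[OF this, of euclidean_metric] show ?thesis
    by (auto simp: path_metric_def)
qed

lemma abs_le_path_dist:
  assumes "\<omega> \<in> path_space T" "\<omega>' \<in> path_space T" "t \<in> {0..T}"
  shows "\<bar>\<omega> t - \<omega>' t\<bar> \<le> mdist (path_metric T) \<omega> \<omega>'"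
  using mdist_cfunspace_imp_mdist_le[of \<omega> "top_of_set {0..T}" euclidean_metric \<omega>'
      "mdist (path_metric T) \<omega> \<omega>'" t] assms
  by (simp add: path_metric_def dist_real_def)

lemma path_dist_le:
  assumes "0 \<le> B" "\<And>t. t \<in> {0..T} \<Longrightarrow> \<bar>\<omega> t - \<omega>' t\<bar> \<le> B"
  shows "mdist (path_metric T) \<omega> \<omega>' \<le> B"
  using mdist_cfunspace_le[of B "top_of_set {0..T}" euclidean_metric \<omega> \<omega>'] assms
  by (simp add: path_metric_def dist_real_def)

lemma space_path_borel [simp]: "space (path_borel T) = path_space T"
  unfolding path_borel_def by (rule space_measure_of) (use openin_subset in fastforce)

lemma sets_path_borel_open:
  "openin (mtopology_of (path_metric T)) U \<Longrightarrow> U \<in> sets (path_borel T)"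
  unfolding path_borel_def by (subst sets_measure_of) (use openin_subset in fastforce, auto)

lemma path_lipschitz_measurable:
  fixes f :: "(real \<Rightarrow> real) \<Rightarrow> real"
  assumes lip: "\<And>\<omega> \<omega>'. \<omega> \<in> path_space T \<Longrightarrow> \<omega>' \<in> path_space T \<Longrightarrow>
      \<bar>f \<omega> - f \<omega>'\<bar> \<le> K * mdist (path_metric T) \<omega> \<omega>'"
  shows "f \<in> borel_measurable (path_borel T)"
proof (rule borel_measurableI)
  fix S :: "real set" assume "open S"
  interpret P: Metric_space "path_space T" "mdist (path_metric T)" by (rule Metric_space_mspace_mdist)
  have "openin (mtopology_of (path_metric T)) (f -` S \<inter> path_space T)"
    unfolding mtopology_of_def P.openin_mtopology
  proof (intro conjI allI impI)
    fix \<omega> assume w: "\<omega> \<in> f -` S \<inter> path_space T"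
    obtain e where e: "e > 0" "\<And>y. dist y (f \<omega>) < e \<Longrightarrow> y \<in> S"
      using w \<open>open S\<close> by (auto simp: open_dist)
    define r where "r = e / (\<bar>K\<bar> + 1)"
    have r: "r > 0" using e by (simp add: r_def)
    have "P.mball \<omega> r \<subseteq> f -` S \<inter> path_space T"
    proof
      fix y assume "y \<in> P.mball \<omega> r"
      then have y: "y \<in> path_space T" "mdist (path_metric T) \<omega> y < r" by auto
      have "\<bar>f \<omega> - f y\<bar> \<le> K * mdist (path_metric T) \<omega> y" using lip y w by auto
      also have "\<dots> \<le> (\<bar>K\<bar> + 1) * mdist (path_metric T) \<omega> y"
        by (intro mult_right_mono) auto
      also have "\<dots> < (\<bar>K\<bar> + 1) * r" using y by (intro mult_strict_left_mono) auto
      also have "\<dots> = e" by (simp add: r_def)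
      finally show "y \<in> f -` S \<inter> path_space T" using e y by (auto simp: dist_real_def abs_minus_commute)
    qed
    then show "\<exists>r>0. P.mball \<omega> r \<subseteq> f -` S \<inter> path_space T" using r by blast
  qed simp
  then show "f -` S \<inter> space (path_borel T) \<in> sets (path_borel T)" by (auto intro: sets_path_borel_open)
qed

lemma path_eval_measurable:
  "t \<in> {0..T} \<Longrightarrow> (\<lambda>\<omega>. \<omega> t) \<in> borel_measurable (path_borel T)"
  by (rule path_lipschitz_measurable[where K = 1]) (auto intro: abs_le_path_dist)

section \<open>Uniform time grids and the coding of paths by their grid values\<close>

definition grid_floor :: "real \<Rightarrow> nat \<Rightarrow> real \<Rightarrow> nat" where
  "grid_floor T N t = nat \<lfloor>t * real N / T\<rfloor>"

definition grid_pt :: "real \<Rightarrow> nat \<Rightarrow> nat \<Rightarrow> real" where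
  "grid_pt T N i = real i * T / real N"

lemma grid_pt_mem: "0 < T \<Longrightarrow> i \<le> N \<Longrightarrow> grid_pt T N i \<in> {0..T}"
  by (cases "N = 0") (auto simp: grid_pt_def field_simps)

lemma grid_floor_le: "0 < T \<Longrightarrow> t \<in> {0..T} \<Longrightarrow> grid_floor T N t \<le> N"
proof -
  assume a: "0 < T" "t \<in> {0..T}"
  have "t * real N / T \<le> real N" using a by (simp add: pos_divide_le_eq mult_right_mono mult.commute[of _ T])
  then show ?thesis unfolding grid_floor_def by linarith
qed

lemma grid_floor_bounds:
  assumes "0 < T" "0 < N" "0 \<le> t"
  shows "grid_pt T N (grid_floor T N t) \<le> t" "t < grid_pt T N (grid_floor T N t) + T / real N"
proof -
  define x where "x = t * real N / T"
  have x: "0 \<le> x" using assms by (simp add: x_def)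
  have t: "t = x * T / real N" using assms by (simp add: x_def)
  have f: "real (grid_floor T N t) \<le> x" "x < real (grid_floor T N t) + 1"
    using x unfolding grid_floor_def x_def[symmetric] by linarith+
  show "grid_pt T N (grid_floor T N t) \<le> t"
    unfolding grid_pt_def by (subst (2) t) (use assms f in \<open>intro divide_right_mono mult_right_mono, auto\<close>)
  have "t < (real (grid_floor T N t) + 1) * T / real N"
    by (subst (1) t) (use assms f in \<open>intro divide_strict_right_mono mult_strict_right_mono, auto\<close>)
  then show "t < grid_pt T N (grid_floor T N t) + T / real N"
    by (simp add: grid_pt_def field_simps add_divide_distrib)
qed

lemma grid_pt_floor_tendsto:
  assumes "0 < T" "0 \<le> t" "filterlim N at_top sequentially"
  shows "(\<lambda>k. grid_pt T (N k) (grid_floor T (N k) t)) \<longlonglongrightarrow> t"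
proof -
  have ev: "eventually (\<lambda>k. 0 < N k) sequentially"
    by (rule eventually_compose_filterlim[OF eventually_gt_at_top assms(3)])
  have lim: "(\<lambda>k. t - T / real (N k)) \<longlonglongrightarrow> t - 0"
    by (intro tendsto_intros real_tendsto_divide_at_top[where c = T]
        filterlim_compose[OF filterlim_real_sequentially assms(3)])
  show ?thesis
  proof (rule tendsto_sandwich[OF _ _ lim[simplified] tendsto_const])
    show "eventually (\<lambda>k. t - T / real (N k) \<le> grid_pt T (N k) (grid_floor T (N k) t)) sequentially"
      using ev by eventually_elim (simp add: grid_floor_bounds(2)[OF assms(1) _ assms(2)] less_imp_le diff_le_eq)
    show "eventually (\<lambda>k. grid_pt T (N k) (grid_floor T (N k) t) \<le> t) sequentially"
      using ev by eventually_elim (rule grid_floor_bounds(1)[OF assms(1) _ assms(2)])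
  qed
qed

text \<open>The modulus of continuity is tied to the mesh of a grid, so that a path is controlled
  uniformly by its \<open>N + 1\<close> grid values. The weak inequality in the conclusion lets the
  bound survive limits.\<close>

definition path_modulus :: "real \<Rightarrow> nat \<Rightarrow> real \<Rightarrow> (real \<Rightarrow> real) \<Rightarrow> bool" where
  "path_modulus T N e \<omega> \<longleftrightarrow>
     (\<forall>s\<in>{0..T}. \<forall>t\<in>{0..T}. \<bar>s - t\<bar> \<le> T / real N \<longrightarrow> \<bar>\<omega> s - \<omega> t\<bar> \<le> e)"

lemma path_dist_le_grid:
  assumes T: "0 < T" "0 < N"
    and "path_modulus T N e \<omega>" "path_modulus T N e \<omega>'" "0 \<le> e" "0 \<le> c"
    and "\<And>i. i \<le> N \<Longrightarrow> \<bar>\<omega> (grid_pt T N i) - \<omega>' (grid_pt T N i)\<bar> \<le> c"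
  shows "mdist (path_metric T) \<omega> \<omega>' \<le> 2 * e + c"
proof (rule path_dist_le)
  fix t assume t: "t \<in> {0..T}"
  let ?i = "grid_floor T N t"
  have i: "?i \<le> N" using grid_floor_le T t by auto
  have s: "grid_pt T N ?i \<in> {0..T}" using grid_pt_mem T i by auto
  have "\<bar>t - grid_pt T N ?i\<bar> \<le> T / real N" using grid_floor_bounds[OF T, of t] t by auto
  then have "\<bar>\<omega> t - \<omega> (grid_pt T N ?i)\<bar> \<le> e" "\<bar>\<omega>' t - \<omega>' (grid_pt T N ?i)\<bar> \<le> e"
    using assms(3,4) s t unfolding path_modulus_def by blast+
  then show "\<bar>\<omega> t - \<omega>' t\<bar> \<le> 2 * e + c" using assms(7)[OF i] by linarith
qed (use assms in auto)

lemma path_modulus_exists: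
  assumes "0 < T" "\<omega> \<in> path_space T" "0 < e"
  shows "\<exists>N>0. path_modulus T N e \<omega>"
proof -
  have "uniformly_continuous_on {0..T} \<omega>"
    using assms by (intro compact_uniformly_continuous) (auto simp: path_space_iff)
  then obtain d where d: "d > 0" "\<And>s t. s \<in> {0..T} \<Longrightarrow> t \<in> {0..T} \<Longrightarrow> dist s t < d \<Longrightarrow> dist (\<omega> s) (\<omega> t) < e"
    unfolding uniformly_continuous_on_def using assms(3) by metis
  obtain N :: nat where N: "T / d < real N" using reals_Archimedean2 by blast
  have "0 < T / d" using d assms by simp
  then have N0: "0 < N" using N by (cases N) auto
  have "T / real N < d" using N N0 d by (simp add: field_simps)
  then have "path_modulus T N e \<omega>"
    using d(2) unfolding path_modulus_def dist_real_def by (meson le_less_trans less_imp_le)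
  then show ?thesis using N0 by blast
qed

text \<open>Grid values rounded down to multiples of \<open>c\<close>. Paths with a common modulus
  and equal codes are uniformly close. There are countably many codes, which yields separability,
  and finitely many on a family bounded at the grid points, which yields total boundedness.\<close>

definition path_code :: "real \<Rightarrow> nat \<Rightarrow> real \<Rightarrow> (real \<Rightarrow> real) \<Rightarrow> int list" where
  "path_code T N c \<omega> = map (\<lambda>i. \<lfloor>\<omega> (grid_pt T N i) / c\<rfloor>) [0..<Suc N]"

lemma path_code_eq_imp_le:
  assumes "path_code T N c \<omega> = path_code T N c \<omega>'" "i \<le> N" "0 < c"
  shows "\<bar>\<omega> (grid_pt T N i) - \<omega>' (grid_pt T N i)\<bar> \<le> c"
proof -
  have "path_code T N c \<omega> ! i = path_code T N c \<omega>' ! i" using assms by simp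
  moreover have "path_code T N c \<omega> ! i = \<lfloor>\<omega> (grid_pt T N i) / c\<rfloor>" for \<omega>
    using assms(2) unfolding path_code_def by (subst nth_map) (simp_all del: upt_Suc)
  ultimately have "\<bar>\<omega> (grid_pt T N i) / c - \<omega>' (grid_pt T N i) / c\<bar> \<le> 1" by (simp, linarith)
  then show ?thesis using assms(3) by (simp add: diff_divide_distrib[symmetric] abs_divide)
qed

text \<open>One path is chosen for each triple of mesh, precision and code that occurs; these
  triples are countable because codes are lists of integers. A path and the representative of its
  triple differ by at most three precisions, two from the moduli and one from the code.\<close>

lemma path_space_separable:
  assumes "0 < T"
  obtains D where "countable D" "D \<subseteq> path_space T"
    "\<And>\<omega> e. \<omega> \<in> path_space T \<Longrightarrow> 0 < e \<Longrightarrow> \<exists>y\<in>D. mdist (path_metric T) \<omega> y < e"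
proof
  define Q where "Q = (\<lambda>(N, m, c) y. y \<in> path_space T \<and> path_modulus T N (1 / real (Suc m)) y
    \<and> path_code T N (1 / real (Suc m)) y = c)"
  define D where "D = (\<lambda>j. SOME y. Q j y) ` {j. \<exists>y. Q j y}"
  show "countable D" unfolding D_def by (intro countable_image countableI_type)
  show "D \<subseteq> path_space T"
  proof
    fix y assume "y \<in> D"
    then obtain j where "Q j y" unfolding D_def by (smt (verit) imageE mem_Collect_eq someI_ex)
    then show "y \<in> path_space T" by (cases j) (auto simp: Q_def)
  qed
  fix \<omega> and e :: real assume w: "\<omega> \<in> path_space T" and e: "0 < e"
  obtain m :: nat where m: "3 / e < real m" using reals_Archimedean2 by blast
  have m': "3 * (1 / real (Suc m)) < e" using m e by (simp add: field_simps)
  obtain N where N: "N > 0" "path_modulus T N (1 / real (Suc m)) \<omega>"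
    using path_modulus_exists[OF assms w, of "1 / real (Suc m)"] by auto
  define j where "j = (N, m, path_code T N (1 / real (Suc m)) \<omega>)"
  have "Q j \<omega>" using w N by (simp add: Q_def j_def)
  then have "Q j (SOME y. Q j y)" by (rule someI[of "Q j"])
  moreover have "(SOME y. Q j y) \<in> D" using \<open>Q j \<omega>\<close> unfolding D_def by blast
  ultimately obtain y where y: "y \<in> D" "Q j y" by blast
  have "mdist (path_metric T) \<omega> y \<le> 2 * (1 / real (Suc m)) + 1 / real (Suc m)"
    using y N by (intro path_dist_le_grid[OF assms N(1)] path_code_eq_imp_le) (auto simp: Q_def j_def)
  then show "\<exists>y\<in>D. mdist (path_metric T) \<omega> y < e" using y m' by (intro bexI[of _ y]) auto
qed

text \<open>By continuity the supremum is determined by countably many grid times. This makes closed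
  balls measurable for the coordinate maps.\<close>

lemma path_dist_le_iff_grid:
  assumes "0 < T" "\<omega> \<in> path_space T" "\<omega>' \<in> path_space T"
  shows "mdist (path_metric T) \<omega> \<omega>' \<le> c \<longleftrightarrow>
    (\<forall>N i. i \<le> Suc N \<longrightarrow> \<bar>\<omega> (grid_pt T (Suc N) i) - \<omega>' (grid_pt T (Suc N) i)\<bar> \<le> c)" (is "?l \<longleftrightarrow> ?r")
proof
  assume ?l then show ?r
    by (intro allI impI order_trans[OF abs_le_path_dist[OF assms(2,3)]] grid_pt_mem assms(1))
next
  assume r: ?r
  show ?l
  proof (rule path_dist_le)
    have "\<bar>\<omega> (grid_pt T 1 0) - \<omega>' (grid_pt T 1 0)\<bar> \<le> c" using r by (metis One_nat_def zero_le)
    then show "0 \<le> c" by linarith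
    fix t assume t: "t \<in> {0..T}"
    let ?s = "\<lambda>N. grid_pt T (Suc N) (grid_floor T (Suc N) t)"
    have s: "?s N \<in> {0..T}" for N by (intro grid_pt_mem grid_floor_le assms(1) t)
    have lim: "?s \<longlonglongrightarrow> t" using grid_pt_floor_tendsto[OF assms(1), of t Suc] t filterlim_Suc by auto
    have "(\<lambda>N. \<omega> (?s N)) \<longlonglongrightarrow> \<omega> t" "(\<lambda>N. \<omega>' (?s N)) \<longlonglongrightarrow> \<omega>' t"
      using assms(2,3) s t lim by (auto simp: path_space_iff intro: continuous_on_tendsto_compose)
    then have "(\<lambda>N. \<bar>\<omega> (?s N) - \<omega>' (?s N)\<bar>) \<longlonglongrightarrow> \<bar>\<omega> t - \<omega>' t\<bar>" by (intro tendsto_intros)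
    then show "\<bar>\<omega> t - \<omega>' t\<bar> \<le> c"
      by (rule LIMSEQ_le_const2) (use r grid_floor_le[OF assms(1) t] in blast)
  qed
qed

text \<open>Separability lets the coordinate maps generate the Borel sets of the path space.\<close>

lemma path_measurableI:
  assumes T: "0 < T" and X: "\<And>u. u \<in> space M \<Longrightarrow> X u \<in> path_space T"
    and meas: "\<And>t. t \<in> {0..T} \<Longrightarrow> (\<lambda>u. X u t) \<in> borel_measurable M"
  shows "X \<in> measurable M (path_borel T)"
  unfolding path_borel_def
proof (rule measurable_measure_of)
  show "X \<in> space M \<rightarrow> path_space T" using X by auto
  show "{U. openin (mtopology_of (path_metric T)) U} \<subseteq> Pow (path_space T)"
    using openin_subset by fastforce
  fix U assume "U \<in> {U. openin (mtopology_of (path_metric T)) U}"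
  interpret P: Metric_space "path_space T" "mdist (path_metric T)" by (rule Metric_space_mspace_mdist)
  from \<open>U \<in> _\<close> have U: "openin P.mtopology U" by (simp add: mtopology_of_def)
  obtain D where D: "countable D" "D \<subseteq> path_space T"
    "\<And>\<omega> e. \<omega> \<in> path_space T \<Longrightarrow> 0 < e \<Longrightarrow> \<exists>y\<in>D. mdist (path_metric T) \<omega> y < e"
    using path_space_separable[OF T] by blast
  \<comment> \<open>The countably many closed balls inside \<open>U\<close> with centre in the dense
    set and radius \<open>1 / (k + 1)\<close>. They cover \<open>U\<close>: a ball whose centre is
    closer to \<open>X u\<close> than its radius stays within twice that radius of
    \<open>X u\<close>.\<close>
  define J where "J = {(y, k). y \<in> D \<and> P.mcball y (1 / real (Suc k)) \<subseteq> U}"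
  have "J \<subseteq> D \<times> UNIV" by (auto simp: J_def)
  then have J: "countable J" using D(1) by (meson countable_SIGMA countable_subset countableI_type)
  have *: "{u \<in> space M. X u \<in> P.mcball y r} \<in> sets M" if "y \<in> D" for y r
  proof -
    have "{u \<in> space M. X u \<in> P.mcball y r} =
      {u \<in> space M. \<forall>N. \<forall>i\<in>{..Suc N}. \<bar>y (grid_pt T (Suc N) i) - X u (grid_pt T (Suc N) i)\<bar> \<le> r}"
      using that D(2) X path_dist_le_iff_grid[OF T] by (auto simp: subset_iff)
    also have "\<dots> \<in> sets M"
    proof (intro sets.sets_Collect_countable_All sets.sets_Collect_finite_All)
      fix N i assume "i \<in> {..Suc N}"
      then have [measurable]: "(\<lambda>u. X u (grid_pt T (Suc N) i)) \<in> borel_measurable M"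
        by (intro meas grid_pt_mem T) auto
      show "{u \<in> space M. \<bar>y (grid_pt T (Suc N) i) - X u (grid_pt T (Suc N) i)\<bar> \<le> r} \<in> sets M"
        by measurable
    qed simp
    finally show ?thesis .
  qed
  have "X -` U \<inter> space M = (\<Union>(y,k)\<in>J. {u \<in> space M. X u \<in> P.mcball y (1 / real (Suc k))})" (is "?L = ?R")
  proof (intro equalityI subsetI)
    fix u assume u: "u \<in> ?L"
    then obtain r where r: "r > 0" "P.mball (X u) r \<subseteq> U" using U by (auto simp: P.openin_mtopology)
    obtain k :: nat where k: "2 / r < real k" using reals_Archimedean2 by blast
    have k': "2 * (1 / real (Suc k)) < r" using k r by (simp add: field_simps)
    obtain y where y: "y \<in> D" "mdist (path_metric T) (X u) y < 1 / real (Suc k)"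
      using D(3)[of "X u" "1 / real (Suc k)"] X u by auto
    have "P.mcball y (1 / real (Suc k)) \<subseteq> P.mball (X u) r"
    proof
      fix z assume z: "z \<in> P.mcball y (1 / real (Suc k))"
      have "mdist (path_metric T) (X u) z \<le> mdist (path_metric T) (X u) y + mdist (path_metric T) y z"
        using z X u by (intro P.triangle) auto
      then show "z \<in> P.mball (X u) r" using z X u y k' by auto
    qed
    then have "(y, k) \<in> J" using r y by (auto simp: J_def)
    moreover have "X u \<in> P.mcball y (1 / real (Suc k))"
      using y D(2) X u by (auto simp: P.commute)
    ultimately show "u \<in> ?R" using u by blast
  qed (auto simp: J_def)
  also have "\<dots> \<in> sets M" using J * by (intro sets.countable_UN') (auto simp: J_def)
  finally show "X -` U \<inter> space M \<in> sets M" .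
qed

subsection \<open>Cylinder functions\<close>

text \<open>The index type is left open because the notion serves both paths indexed by times and
  sequences indexed by \<open>nat\<close>. The sum norm, equivalent to the Euclidean one on finitely
  many coordinates, grows with \<open>A\<close>, so that cylinder functions can be moved to a common
  larger index set.\<close>

definition cyl :: "'i set \<Rightarrow> (('i \<Rightarrow> real) \<Rightarrow> real) set" where
  "cyl A = {X. (\<exists>K. \<forall>\<omega>. \<bar>X \<omega>\<bar> \<le> K) \<and> (\<exists>L. \<forall>\<omega> \<omega>'. \<bar>X \<omega> - X \<omega>'\<bar> \<le> L * (\<Sum>a\<in>A. \<bar>\<omega> a - \<omega>' a\<bar>))}"

lemma cylI:
  "(\<And>\<omega>. \<bar>X \<omega>\<bar> \<le> K) \<Longrightarrow> (\<And>\<omega> \<omega>'. \<bar>X \<omega> - X \<omega>'\<bar> \<le> L * (\<Sum>a\<in>A. \<bar>\<omega> a - \<omega>' a\<bar>)) \<Longrightarrow> X \<in> cyl A"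
  unfolding cyl_def by blast

lemma cylE:
  assumes "X \<in> cyl A"
  obtains K L where "\<And>\<omega>. \<bar>X \<omega>\<bar> \<le> K" "\<And>\<omega> \<omega>'. \<bar>X \<omega> - X \<omega>'\<bar> \<le> L * (\<Sum>a\<in>A. \<bar>\<omega> a - \<omega>' a\<bar>)" "0 < K" "0 < L"
proof -
  obtain K L where 1: "\<And>\<omega>. \<bar>X \<omega>\<bar> \<le> K" "\<And>\<omega> \<omega>'. \<bar>X \<omega> - X \<omega>'\<bar> \<le> L * (\<Sum>a\<in>A. \<bar>\<omega> a - \<omega>' a\<bar>)"
    using assms by (auto simp: cyl_def)
  show thesis
  proof (rule that[of "\<bar>K\<bar> + 1" "\<bar>L\<bar> + 1"])
    show "\<bar>X \<omega>\<bar> \<le> \<bar>K\<bar> + 1" for \<omega> using 1(1)[of \<omega>] by linarith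
    show "\<bar>X \<omega> - X \<omega>'\<bar> \<le> (\<bar>L\<bar> + 1) * (\<Sum>a\<in>A. \<bar>\<omega> a - \<omega>' a\<bar>)" for \<omega> \<omega>'
      by (rule order_trans[OF 1(2)]) (intro mult_right_mono sum_nonneg, auto)
  qed auto
qed

lemma cyl_mono: "finite B \<Longrightarrow> A \<subseteq> B \<Longrightarrow> cyl A \<subseteq> cyl B"
proof
  fix X assume B: "finite B" "A \<subseteq> B" and "X \<in> cyl A"
  then obtain K L where 1: "\<And>\<omega>. \<bar>X \<omega>\<bar> \<le> K" "0 < L"
    "\<And>\<omega> \<omega>'. \<bar>X \<omega> - X \<omega>'\<bar> \<le> L * (\<Sum>a\<in>A. \<bar>\<omega> a - \<omega>' a\<bar>)" by (elim cylE) (rule that)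
  show "X \<in> cyl B"
    by (rule cylI[OF 1(1), where L = L], rule order_trans[OF 1(3)])
      (use 1(2) B in \<open>intro mult_left_mono sum_mono2, auto\<close>)
qed

lemma cyl_cong: "X \<in> cyl A \<Longrightarrow> (\<And>a. a \<in> A \<Longrightarrow> \<omega> a = \<omega>' a) \<Longrightarrow> X \<omega> = X \<omega>'"
proof -
  assume "X \<in> cyl A" and eq: "\<And>a. a \<in> A \<Longrightarrow> \<omega> a = \<omega>' a"
  then obtain L where "\<bar>X \<omega> - X \<omega>'\<bar> \<le> L * (\<Sum>a\<in>A. \<bar>\<omega> a - \<omega>' a\<bar>)" by (metis cylE)
  also have "(\<Sum>a\<in>A. \<bar>\<omega> a - \<omega>' a\<bar>) = 0" using eq by simp
  finally show ?thesis by simp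
qed

text \<open>A Lipschitz bound on bounded squares suffices for composition because cylinder functions
  are bounded; products are thereby included.\<close>

definition loc_lip2 :: "(real \<Rightarrow> real \<Rightarrow> real) \<Rightarrow> bool" where
  "loc_lip2 g \<longleftrightarrow> (\<forall>K>0. \<exists>L\<ge>0. \<forall>a b a' b'. \<bar>a\<bar> \<le> K \<longrightarrow> \<bar>b\<bar> \<le> K \<longrightarrow> \<bar>a'\<bar> \<le> K \<longrightarrow> \<bar>b'\<bar> \<le> K \<longrightarrow>
      \<bar>g a b - g a' b'\<bar> \<le> L * (\<bar>a - a'\<bar> + \<bar>b - b'\<bar>))"

lemma cyl_comp2:
  assumes X: "X \<in> cyl A" and Y: "Y \<in> cyl A" and g: "loc_lip2 g"
  shows "(\<lambda>\<omega>. g (X \<omega>) (Y \<omega>)) \<in> cyl A"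
proof -
  obtain K1 L1 where 1: "\<And>\<omega>. \<bar>X \<omega>\<bar> \<le> K1" "0 < K1" "0 < L1"
    "\<And>\<omega> \<omega>'. \<bar>X \<omega> - X \<omega>'\<bar> \<le> L1 * (\<Sum>a\<in>A. \<bar>\<omega> a - \<omega>' a\<bar>)" using X by (elim cylE) (rule that)
  obtain K2 L2 where 2: "\<And>\<omega>. \<bar>Y \<omega>\<bar> \<le> K2" "0 < K2" "0 < L2"
    "\<And>\<omega> \<omega>'. \<bar>Y \<omega> - Y \<omega>'\<bar> \<le> L2 * (\<Sum>a\<in>A. \<bar>\<omega> a - \<omega>' a\<bar>)" using Y by (elim cylE) (rule that)
  define K where "K = max K1 K2"
  have K: "\<bar>X \<omega>\<bar> \<le> K" "\<bar>Y \<omega>\<bar> \<le> K" "0 < K" for \<omega>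
    using 1(1)[of \<omega>] 2(1)[of \<omega>] 1(2) by (auto simp: K_def)
  obtain L where L: "L \<ge> 0" "\<And>a b a' b'. \<bar>a\<bar> \<le> K \<Longrightarrow> \<bar>b\<bar> \<le> K \<Longrightarrow> \<bar>a'\<bar> \<le> K \<Longrightarrow> \<bar>b'\<bar> \<le> K \<Longrightarrow>
      \<bar>g a b - g a' b'\<bar> \<le> L * (\<bar>a - a'\<bar> + \<bar>b - b'\<bar>)"
    using g K(3) unfolding loc_lip2_def by metis
  show ?thesis
  proof (rule cylI[of _ "\<bar>g 0 0\<bar> + L * (K + K)" "L * (L1 + L2)"])
    fix \<omega> \<omega>'
    have "\<bar>g (X \<omega>) (Y \<omega>) - g 0 0\<bar> \<le> L * (\<bar>X \<omega> - 0\<bar> + \<bar>Y \<omega> - 0\<bar>)"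
      using K by (intro L) auto
    also have "\<dots> \<le> L * (K + K)" using K L by (intro mult_left_mono add_mono) auto
    finally show "\<bar>g (X \<omega>) (Y \<omega>)\<bar> \<le> \<bar>g 0 0\<bar> + L * (K + K)" by linarith
    have "\<bar>g (X \<omega>) (Y \<omega>) - g (X \<omega>') (Y \<omega>')\<bar> \<le> L * (\<bar>X \<omega> - X \<omega>'\<bar> + \<bar>Y \<omega> - Y \<omega>'\<bar>)"
      using K by (intro L) auto
    also have "\<dots> \<le> L * (L1 * (\<Sum>a\<in>A. \<bar>\<omega> a - \<omega>' a\<bar>) + L2 * (\<Sum>a\<in>A. \<bar>\<omega> a - \<omega>' a\<bar>))"
      using L by (intro mult_left_mono add_mono 1 2) auto
    finally show "\<bar>g (X \<omega>) (Y \<omega>) - g (X \<omega>') (Y \<omega>')\<bar> \<le> L * (L1 + L2) * (\<Sum>a\<in>A. \<bar>\<omega> a - \<omega>' a\<bar>)"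
      by (simp add: algebra_simps)
  qed
qed

lemma loc_lip2_lip:
  "0 \<le> L \<Longrightarrow> (\<And>a b a' b'. \<bar>g a b - g a' b'\<bar> \<le> L * (\<bar>a - a'\<bar> + \<bar>b - b'\<bar>)) \<Longrightarrow> loc_lip2 g"
  unfolding loc_lip2_def by blast

lemma loc_lip2_add: "loc_lip2 (\<lambda>a b. a + b)"
  by (rule loc_lip2_lip[of 1]) auto

lemma loc_lip2_diff: "loc_lip2 (\<lambda>a b. a - b)"
  by (rule loc_lip2_lip[of 1]) auto

lemma loc_lip2_scale: "loc_lip2 (\<lambda>a b. c * a)"
  by (rule loc_lip2_lip[of "\<bar>c\<bar>"]) (auto simp: abs_mult[symmetric] algebra_simps simp flip: right_diff_distrib)

lemma loc_lip2_abs: "loc_lip2 (\<lambda>a b. \<bar>a\<bar>)"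
  by (rule loc_lip2_lip[of 1]) auto

lemma loc_lip2_mult: "loc_lip2 (\<lambda>a b. a * b)"
  unfolding loc_lip2_def
proof (intro allI impI)
  fix K :: real assume "0 < K"
  have "\<bar>a * b - a' * b'\<bar> \<le> K * (\<bar>a - a'\<bar> + \<bar>b - b'\<bar>)"
    if "\<bar>a\<bar> \<le> K" "\<bar>b\<bar> \<le> K" "\<bar>a'\<bar> \<le> K" "\<bar>b'\<bar> \<le> K" for a b a' b'
  proof -
    have "a * b - a' * b' = b * (a - a') + a' * (b - b')" by (simp add: algebra_simps)
    also have "\<bar>\<dots>\<bar> \<le> \<bar>b\<bar> * \<bar>a - a'\<bar> + \<bar>a'\<bar> * \<bar>b - b'\<bar>" by (metis abs_mult abs_triangle_ineq)
    also have "\<dots> \<le> K * \<bar>a - a'\<bar> + K * \<bar>b - b'\<bar>" using that by (intro add_mono mult_right_mono) auto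
    finally show ?thesis by (simp add: algebra_simps)
  qed
  then show "\<exists>L\<ge>0. \<forall>a b a' b'. \<bar>a\<bar> \<le> K \<longrightarrow> \<bar>b\<bar> \<le> K \<longrightarrow> \<bar>a'\<bar> \<le> K \<longrightarrow> \<bar>b'\<bar> \<le> K \<longrightarrow>
      \<bar>a * b - a' * b'\<bar> \<le> L * (\<bar>a - a'\<bar> + \<bar>b - b'\<bar>)"
    using \<open>0 < K\<close> by (intro exI[of _ K]) auto
qed

section \<open>Functions of increments versus functions of coordinates\<close>

lemma time_grid_le:
  assumes "time_grid T n s" "i \<le> j" "j < n" shows "s i \<le> s j"
  using assms(2,3)
proof (induction j)
  case (Suc j)
  then show ?case using assms(1) unfolding time_grid_def
    by (metis Suc_lessD le_Suc_eq less_eq_real_def order_trans)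
qed simp

lemma time_grid_mem:
  assumes "time_grid T n s" "i < n" shows "s i \<in> {0..T}"
  using time_grid_le[OF assms(1), of 0 i] time_grid_le[OF assms(1), of i "n - 1"] assms
  by (fastforce simp: time_grid_def)

lemma abs_le_eucl_norm: "j < n \<Longrightarrow> \<bar>x j\<bar> \<le> eucl_norm n x"
  using member_le_L2_set[of "{..<n}" j "\<lambda>j. \<bar>x j\<bar>"] by (simp add: eucl_norm_def L2_set_def)

text \<open>An increment is a difference of at most two coordinates, whence the factor 2 in the
  Lipschitz constant.\<close>

lemma Lip_subset_cyl:
  assumes "X \<in> Lip T"
  shows "\<exists>A. finite A \<and> A \<subseteq> {0..T} \<and> X \<in> cyl A"
proof -
  obtain n s \<phi> where g: "time_grid T n s" and \<phi>: "\<phi> \<in> C_bLip n"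
    and X: "X = (\<lambda>\<omega>. \<phi> (incr (\<lambda>i. \<omega> (s i))))"
    using assms unfolding Lip_def by blast
  obtain K where K: "\<And>x. \<bar>\<phi> x\<bar> \<le> K" using \<phi> by (auto simp: C_bLip_def)
  obtain L where L: "\<And>x y. \<bar>\<phi> x - \<phi> y\<bar> \<le> L * eucl_norm n (\<lambda>i. x i - y i)"
    using \<phi> by (auto simp: C_bLip_def)
  let ?A = "s ` {..<n}"
  show ?thesis
  proof (intro exI[of _ ?A] conjI)
    show "?A \<subseteq> {0..T}" using time_grid_mem[OF g] by auto
    show "X \<in> cyl ?A"
    proof (rule cylI[of _ K "\<bar>L\<bar> * (real n * 2)"])
      show "\<bar>X \<omega>\<bar> \<le> K" for \<omega> using K X by simp
      fix \<omega> \<omega>' :: "real \<Rightarrow> real"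
      define S where "S = (\<Sum>a\<in>?A. \<bar>\<omega> a - \<omega>' a\<bar>)"
      define x where "x = (\<lambda>i. incr (\<lambda>i. \<omega> (s i)) i - incr (\<lambda>i. \<omega>' (s i)) i)"
      have m: "\<bar>\<omega> (s i) - \<omega>' (s i)\<bar> \<le> S" if "i < n" for i
        unfolding S_def using that by (intro member_le_sum) auto
      have x: "\<bar>x i\<bar> \<le> 2 * S" if "i < n" for i
      proof (cases "i = 0")
        case False
        then have "x i = (\<omega> (s i) - \<omega>' (s i)) - (\<omega> (s (i - 1)) - \<omega>' (s (i - 1)))"
          by (simp add: x_def incr_def)
        then show ?thesis using m[OF that] m[of "i - 1"] that by linarith
      qed (use m[OF that] in \<open>simp add: x_def incr_def\<close>)
      have "\<bar>X \<omega> - X \<omega>'\<bar> \<le> L * eucl_norm n x" using L by (simp add: X x_def)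
      also have "\<dots> \<le> \<bar>L\<bar> * (\<Sum>i<n. \<bar>x i\<bar>)"
        unfolding eucl_norm_def by (intro mult_mono L2_set_le_sum_abs) auto
      also have "\<dots> \<le> \<bar>L\<bar> * (\<Sum>i<n. 2 * S)"
        using x by (intro mult_left_mono sum_mono) auto
      finally show "\<bar>X \<omega> - X \<omega>'\<bar> \<le> \<bar>L\<bar> * (real n * 2) * (\<Sum>a\<in>?A. \<bar>\<omega> a - \<omega>' a\<bar>)"
        by (simp add: S_def)
    qed
  qed simp
qed

lemma sum_incr: "(\<Sum>j\<le>i. incr x j) = x i"
  by (induction i) (auto simp: incr_def)

text \<open>Coordinates are partial sums of increments, and \<open>p\<close> forms these sums. Grid
  and \<open>p\<close> depend on \<open>A\<close> alone, so several cylinder functions can be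
  evaluated through the same increments; the transfer of sublinearity rests on this.\<close>

lemma cyl_grid_representation:
  assumes A: "finite A" "A \<subseteq> {0..T}" and T: "0 \<le> T"
  obtains n s p where "time_grid T n s"
    "\<And>X. X \<in> cyl A \<Longrightarrow> (\<lambda>x. X (p x)) \<in> C_bLip n"
    "\<And>X \<omega>. X \<in> cyl A \<Longrightarrow> X (p (incr (\<lambda>i. \<omega> (s i)))) = X \<omega>"
proof -
  \<comment> \<open>Time 0 is inserted so that the grid has a point even when \<open>A\<close> is
    empty.\<close>
  define xs where "xs = sorted_list_of_set (insert 0 A)"
  define n where "n = length xs"
  define s where "s = (\<lambda>i. xs ! i)"
  define p where "p = (\<lambda>x a. \<Sum>j | j < n \<and> s j \<le> a. x j :: real)"
  have set: "set xs = insert 0 A" using A by (simp add: xs_def del: sorted_list_of_set_insert_remove)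
  have n0: "0 < n" using set n_def by auto
  have sl: "s i < s j" if "i < j" "j < n" for i j
    using that unfolding s_def n_def xs_def
    using sorted_wrt_nth_less[OF strict_sorted_list_of_set] by blast
  have mem: "s i \<in> insert 0 A" if "i < n" for i
    using that nth_mem set unfolding s_def n_def by blast
  have g: "time_grid T n s"
    unfolding time_grid_def
  proof (intro conjI allI impI)
    show "0 \<le> s 0" "s (n - 1) \<le> T" using mem[of 0] mem[of "n - 1"] n0 A(2) T by auto
    show "s i < s (Suc i)" if "Suc i < n" for i using that by (intro sl) auto
  qed (use n0 in auto)
  show thesis
  proof (rule that[OF g])
    fix X :: "(real \<Rightarrow> real) \<Rightarrow> real" assume X: "X \<in> cyl A"
    then obtain K L where 1: "\<And>\<omega>. \<bar>X \<omega>\<bar> \<le> K" "0 < L"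
      "\<And>\<omega> \<omega>'. \<bar>X \<omega> - X \<omega>'\<bar> \<le> L * (\<Sum>a\<in>A. \<bar>\<omega> a - \<omega>' a\<bar>)" by (elim cylE) (rule that)
    have "\<bar>X (p x) - X (p y)\<bar> \<le> L * (real (card A) * real n) * eucl_norm n (\<lambda>i. x i - y i)" for x y
    proof -
      have "\<bar>p x a - p y a\<bar> \<le> real n * eucl_norm n (\<lambda>i. x i - y i)" for a
      proof -
        have "\<bar>p x a - p y a\<bar> \<le> (\<Sum>j | j < n \<and> s j \<le> a. \<bar>x j - y j\<bar>)"
          unfolding p_def by (simp add: sum_subtractf[symmetric])
        also have "\<dots> \<le> (\<Sum>j<n. \<bar>x j - y j\<bar>)" by (rule sum_mono2) auto
        also have "\<dots> \<le> (\<Sum>j<n. eucl_norm n (\<lambda>i. x i - y i))"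
          by (intro sum_mono abs_le_eucl_norm) auto
        finally show ?thesis by simp
      qed
      then have "(\<Sum>a\<in>A. \<bar>p x a - p y a\<bar>) \<le> (\<Sum>a\<in>A. real n * eucl_norm n (\<lambda>i. x i - y i))"
        by (intro sum_mono) auto
      then have "L * (\<Sum>a\<in>A. \<bar>p x a - p y a\<bar>) \<le> L * (\<Sum>a\<in>A. real n * eucl_norm n (\<lambda>i. x i - y i))"
        using 1(2) by (intro mult_left_mono) auto
      with 1(3)[of "p x" "p y"] show ?thesis by (simp add: mult.assoc)
    qed
    then show "(\<lambda>x. X (p x)) \<in> C_bLip n" unfolding C_bLip_def using 1(1) by blast
    fix \<omega> show "X (p (incr (\<lambda>i. \<omega> (s i)))) = X \<omega>"
    proof (rule cyl_cong[OF X])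
      fix a assume "a \<in> A"
      then have "a \<in> set xs" using set by simp
      then obtain i where i: "i < n" "a = s i" unfolding n_def s_def by (metis in_set_conv_nth)
      have "{j. j < n \<and> s j \<le> s i} = {..i}"
      proof (intro equalityI subsetI)
        fix j assume "j \<in> {j. j < n \<and> s j \<le> s i}"
        then show "j \<in> {..i}" using sl[of i j] by (metis atMost_iff leI linorder_not_le mem_Collect_eq)
      next
        fix j assume "j \<in> {..i}"
        then show "j \<in> {j. j < n \<and> s j \<le> s i}" using i sl[of j i] by (cases "j = i") auto
      qed
      then show "p (incr (\<lambda>i. \<omega> (s i))) a = \<omega> a" using i by (simp add: p_def sum_incr)
    qed
  qed
qed

lemma cyl_subset_Lip:
  assumes "finite A" "A \<subseteq> {0..T}" "0 \<le> T" "X \<in> cyl A"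
  shows "X \<in> Lip T"
proof -
  obtain n s p where 1: "time_grid T n s" "(\<lambda>x. X (p x)) \<in> C_bLip n"
    "\<And>\<omega>. X (p (incr (\<lambda>i. \<omega> (s i)))) = X \<omega>"
    using cyl_grid_representation[OF assms(1-3)] assms(4) by metis
  have "X = (\<lambda>\<omega>. (\<lambda>x. X (p x)) (incr (\<lambda>i. \<omega> (s i))))" using 1(3) by simp
  with 1(1,2) show ?thesis unfolding Lip_def mem_Collect_eq
    by (intro exI[of _ n] exI[of _ s] exI[of _ "\<lambda>x. X (p x)"] conjI)
qed

lemma Lip_comp2:
  assumes "0 \<le> T" "X \<in> Lip T" "Y \<in> Lip T" "loc_lip2 g"
  shows "(\<lambda>\<omega>. g (X \<omega>) (Y \<omega>)) \<in> Lip T"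
proof -
  obtain A where A: "finite A" "A \<subseteq> {0..T}" "X \<in> cyl A" using Lip_subset_cyl[OF assms(2)] by blast
  obtain B where B: "finite B" "B \<subseteq> {0..T}" "Y \<in> cyl B" using Lip_subset_cyl[OF assms(3)] by blast
  have "X \<in> cyl (A \<union> B)" "Y \<in> cyl (A \<union> B)"
    using A B cyl_mono[of "A \<union> B" A] cyl_mono[of "A \<union> B" B] by auto
  then show ?thesis
    using cyl_subset_Lip[of "A \<union> B" T] cyl_comp2[OF _ _ assms(4)] A B assms(1) by blast
qed

lemma Lip_const: "0 \<le> T \<Longrightarrow> (\<lambda>_. c) \<in> Lip T"
  by (rule cyl_subset_Lip[of "{}"]) (auto intro!: cylI[of _ "\<bar>c\<bar>" 0])

lemma cyl_coord:
  fixes s t :: 'i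
  assumes "\<And>x. \<bar>h x\<bar> \<le> K" "\<And>x y. \<bar>h x - h y\<bar> \<le> \<bar>x - y\<bar>"
  shows "(\<lambda>\<omega>. h (\<omega> t - \<omega> s)) \<in> cyl {s, t}" "(\<lambda>\<omega>. h (\<omega> t)) \<in> cyl {t}"
proof -
  show "(\<lambda>\<omega>. h (\<omega> t - \<omega> s)) \<in> cyl {s, t}"
  proof (rule cylI[of _ K 2])
    show "\<bar>h (\<omega> t - \<omega> s) - h (\<omega>' t - \<omega>' s)\<bar> \<le> 2 * (\<Sum>a\<in>{s, t}. \<bar>\<omega> a - \<omega>' a\<bar>)" for \<omega> \<omega>' :: "'i \<Rightarrow> real"
      using assms(2)[of "\<omega> t - \<omega> s" "\<omega>' t - \<omega>' s"] by (cases "s = t") (simp_all add: abs_if split: if_splits)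
  qed (use assms in auto)
  show "(\<lambda>\<omega>. h (\<omega> t)) \<in> cyl {t}"
    by (rule cylI[of _ K 1]) (use assms in auto)
qed

lemma cyl_power:
  assumes "X \<in> cyl A"
  shows "(\<lambda>\<omega>. X \<omega> ^ p) \<in> cyl A"
proof (induction p)
  case 0
  show ?case by (rule cylI[of _ 1 0]) auto
next
  case (Suc p)
  from cyl_comp2[OF assms this loc_lip2_mult] show ?case by simp
qed

lemma cyl_min_power4:
  assumes "0 \<le> k"
  shows "(\<lambda>\<omega>. min \<bar>\<omega> t - \<omega> s\<bar> k ^ 4) \<in> cyl {s, t}" "(\<lambda>\<omega>. min \<bar>\<omega> t\<bar> k ^ 4) \<in> cyl {t}"
proof -
  let ?h = "\<lambda>x. min \<bar>x\<bar> k"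
  have h: "\<bar>?h x\<bar> \<le> k" "\<bar>?h x - ?h y\<bar> \<le> \<bar>x - y\<bar>" for x y :: real using assms by auto
  show "(\<lambda>\<omega>. min \<bar>\<omega> t - \<omega> s\<bar> k ^ 4) \<in> cyl {s, t}" by (rule cyl_power[OF cyl_coord(1)[of ?h, OF h]])
  show "(\<lambda>\<omega>. min \<bar>\<omega> t\<bar> k ^ 4) \<in> cyl {t}" by (rule cyl_power[OF cyl_coord(2)[of ?h, OF h]])
qed

lemma Lip_abs_power:
  assumes "0 \<le> T" "X \<in> Lip T"
  shows "(\<lambda>\<omega>. \<bar>X \<omega>\<bar> ^ p) \<in> Lip T"
proof -
  obtain A where A: "finite A" "A \<subseteq> {0..T}" "X \<in> cyl A" using Lip_subset_cyl[OF assms(2)] by blast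
  show ?thesis
    using cyl_subset_Lip[OF A(1,2) assms(1) cyl_power[OF cyl_comp2[OF A(3,3) loc_lip2_abs]]] .
qed

lemma Lip_lipschitz:
  assumes "0 < T" "X \<in> Lip T"
  obtains K where "0 < K" "\<And>\<omega>. \<bar>X \<omega>\<bar> \<le> K"
    "\<And>\<omega> \<omega>'. \<omega> \<in> path_space T \<Longrightarrow> \<omega>' \<in> path_space T \<Longrightarrow> \<bar>X \<omega> - X \<omega>'\<bar> \<le> K * mdist (path_metric T) \<omega> \<omega>'"
proof -
  obtain A where A: "finite A" "A \<subseteq> {0..T}" "X \<in> cyl A" using Lip_subset_cyl[OF assms(2)] by blast
  obtain K L where 1: "\<And>\<omega>. \<bar>X \<omega>\<bar> \<le> K" "0 < L" "0 < K"
    "\<And>\<omega> \<omega>'. \<bar>X \<omega> - X \<omega>'\<bar> \<le> L * (\<Sum>a\<in>A. \<bar>\<omega> a - \<omega>' a\<bar>)" using A(3) by (elim cylE) (rule that)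
  show thesis
  proof (rule that[of "max K (L * real (card A))"])
    fix \<omega> \<omega>' assume w: "\<omega> \<in> path_space T" "\<omega>' \<in> path_space T"
    have "(\<Sum>a\<in>A. \<bar>\<omega> a - \<omega>' a\<bar>) \<le> (\<Sum>a\<in>A. mdist (path_metric T) \<omega> \<omega>')"
      using A w by (intro sum_mono abs_le_path_dist) auto
    then have "L * (\<Sum>a\<in>A. \<bar>\<omega> a - \<omega>' a\<bar>) \<le> L * real (card A) * mdist (path_metric T) \<omega> \<omega>'"
      using 1(2) by (simp add: mult.assoc)
    also have "\<dots> \<le> max K (L * real (card A)) * mdist (path_metric T) \<omega> \<omega>'"
      by (intro mult_right_mono) auto
    finally show "\<bar>X \<omega> - X \<omega>'\<bar> \<le> max K (L * real (card A)) * mdist (path_metric T) \<omega> \<omega>'"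
      using 1(4) order_trans by blast
  qed (use 1 in \<open>auto intro: order_trans[OF 1(1)]\<close>)
qed

text \<open>
  Of the \<open>G\<close>-expectation only sublinearity and a fourth-moment bound on increments are needed;
  the truncation at \<open>k\<close> keeps the moments within the cylinder functions.
\<close>

locale lip_expectation =
  fixes T M :: real and E :: "((real \<Rightarrow> real) \<Rightarrow> real) \<Rightarrow> real"
  assumes T_pos: "0 < T" and M_nonneg: "0 \<le> M"
    and E_add: "X \<in> Lip T \<Longrightarrow> Y \<in> Lip T \<Longrightarrow> E (\<lambda>\<omega>. X \<omega> + Y \<omega>) \<le> E X + E Y"
    and E_scale: "X \<in> Lip T \<Longrightarrow> 0 \<le> c \<Longrightarrow> E (\<lambda>\<omega>. c * X \<omega>) = c * E X"
    and E_mono: "X \<in> Lip T \<Longrightarrow> Y \<in> Lip T \<Longrightarrow> (\<And>\<omega>. X \<omega> \<le> Y \<omega>) \<Longrightarrow> E X \<le> E Y"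
    and E_const: "E (\<lambda>_. c) = c"
    and E_incr: "s \<in> {0..T} \<Longrightarrow> t \<in> {0..T} \<Longrightarrow> 0 \<le> k \<Longrightarrow> E (\<lambda>\<omega>. min \<bar>\<omega> t - \<omega> s\<bar> k ^ 4) \<le> M * (t - s)\<^sup>2"
    and E_coord: "t \<in> {0..T} \<Longrightarrow> 0 \<le> k \<Longrightarrow> E (\<lambda>\<omega>. min \<bar>\<omega> t\<bar> k ^ 4) \<le> M * t\<^sup>2"

section \<open>Fourth moments under the G-expectation\<close>

lemma C_bLip_subset_C_lLip: "C_bLip n \<subseteq> C_lLip n"
proof
  fix \<phi> assume "\<phi> \<in> C_bLip n"
  then obtain L where L: "\<And>x y. \<bar>\<phi> x - \<phi> y\<bar> \<le> L * eucl_norm n (\<lambda>i. x i - y i)"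
    by (auto simp: C_bLip_def)
  have "\<bar>\<phi> x - \<phi> y\<bar> \<le> \<bar>L\<bar> * (1 + eucl_norm n x ^ 0 + eucl_norm n y ^ 0) * eucl_norm n (\<lambda>i. x i - y i)" for x y
    by (rule order_trans[OF L]) (intro mult_right_mono, auto simp: eucl_norm_def)
  then show "\<phi> \<in> C_lLip n" unfolding C_lLip_def by blast
qed

lemma fourth_power_C_lLip: "(\<lambda>x. x 0 ^ 4) \<in> C_lLip 1"
proof -
  have e: "eucl_norm 1 x = \<bar>x 0\<bar>" for x by (simp add: eucl_norm_def L2_set_def)
  have "\<bar>a ^ 4 - b ^ 4\<bar> \<le> 4 * (1 + \<bar>a\<bar> ^ 3 + \<bar>b\<bar> ^ 3) * \<bar>a - b\<bar>" for a b :: real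
  proof -
    define m where "m = max \<bar>a\<bar> \<bar>b\<bar>"
    have m: "\<bar>a\<bar> \<le> m" "\<bar>b\<bar> \<le> m" "0 \<le> m" by (auto simp: m_def)
    have "a ^ 4 - b ^ 4 = (a - b) * ((a + b) * (a\<^sup>2 + b\<^sup>2))" by (simp add: power2_eq_square power4_eq_xxxx algebra_simps)
    then have "\<bar>a ^ 4 - b ^ 4\<bar> = \<bar>a - b\<bar> * (\<bar>a + b\<bar> * (\<bar>a\<bar>\<^sup>2 + \<bar>b\<bar>\<^sup>2))" by (simp add: abs_mult)
    also have "\<dots> \<le> \<bar>a - b\<bar> * ((m + m) * (m\<^sup>2 + m\<^sup>2))"
      using m by (intro mult_left_mono mult_mono add_mono power_mono) auto
    also have "\<dots> = 4 * m ^ 3 * \<bar>a - b\<bar>" by (simp add: power2_eq_square power3_eq_cube)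
    also have "\<dots> \<le> 4 * (1 + \<bar>a\<bar> ^ 3 + \<bar>b\<bar> ^ 3) * \<bar>a - b\<bar>"
      by (intro mult_right_mono mult_left_mono) (auto simp: m_def max_def)
    finally show ?thesis .
  qed
  then show ?thesis unfolding C_lLip_def mem_Collect_eq e by blast
qed

lemma (in sublinear_expectation_space) grid_rv_mem:
  assumes "\<phi> \<in> C_bLip n" "\<And>i. \<xi> i \<in> H"
  shows "(\<lambda>w. \<phi> (\<lambda>i. c i * \<xi> i w)) \<in> H"
  using comp_mem[of \<phi> n "\<lambda>i w. c i * \<xi> i w"] assms C_bLip_subset_C_lLip scale_mem by blast

text \<open>The fourth power turns the scaling \<open>sqrt d\<close> of a normal increment into
  \<open>d\<^sup>2\<close>: this is the source of the quadratic dependence on the time step.\<close>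

lemma min_abs_scaled_power4_le:
  fixes d z :: real
  assumes "0 \<le> d" "0 \<le> k"
  shows "min \<bar>sqrt d * z\<bar> k ^ 4 \<le> d\<^sup>2 * z ^ 4"
proof -
  have "min \<bar>sqrt d * z\<bar> k ^ 4 \<le> \<bar>sqrt d * z\<bar> ^ 4" using assms by (intro power_mono) auto
  also have "\<dots> = ((sqrt d)\<^sup>2)\<^sup>2 * z ^ 4" by (simp add: power_mult_distrib abs_mult)
  finally show ?thesis using assms by simp
qed

lemma min_power4_C_bLip:
  assumes "j < n" "0 \<le> k"
  shows "(\<lambda>x. min \<bar>x j\<bar> k ^ 4) \<in> C_bLip n"
proof -
  have "\<bar>min \<bar>x j\<bar> k ^ 4 - min \<bar>y j\<bar> k ^ 4\<bar> \<le> 4 * k ^ 3 * eucl_norm n (\<lambda>i. x i - y i)" for x y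
  proof -
    define a b where "a = min \<bar>x j\<bar> k" and "b = min \<bar>y j\<bar> k"
    have ab: "0 \<le> a" "a \<le> k" "0 \<le> b" "b \<le> k" "\<bar>a - b\<bar> \<le> \<bar>x j - y j\<bar>" using assms by (auto simp: a_def b_def)
    have "a ^ 4 - b ^ 4 = (a - b) * ((a + b) * (a\<^sup>2 + b\<^sup>2))" by (simp add: power2_eq_square power4_eq_xxxx algebra_simps)
    then have "\<bar>a ^ 4 - b ^ 4\<bar> = \<bar>a - b\<bar> * ((a + b) * (a\<^sup>2 + b\<^sup>2))" using ab by (simp add: abs_mult)
    also have "\<dots> \<le> \<bar>x j - y j\<bar> * ((k + k) * (k\<^sup>2 + k\<^sup>2))"
      using ab by (intro mult_mono add_mono power_mono) auto
    also have "\<dots> = 4 * k ^ 3 * \<bar>x j - y j\<bar>" by (simp add: power2_eq_square power3_eq_cube)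
    also have "\<dots> \<le> 4 * k ^ 3 * eucl_norm n (\<lambda>i. x i - y i)"
      using abs_le_eucl_norm[OF assms(1), of "\<lambda>i. x i - y i"] assms by (intro mult_left_mono) auto
    finally show ?thesis by (simp add: a_def b_def)
  qed
  moreover have "\<bar>min \<bar>x j\<bar> k ^ 4\<bar> \<le> k ^ 4" for x :: "nat \<Rightarrow> real"
    using assms by (auto intro!: power_mono)
  ultimately show ?thesis unfolding C_bLip_def by blast
qed

text \<open>Cylinder functions over the same times are evaluated on the sublinear expectation space
  through one common map \<open>p\<close>, which carries the sublinear structure over to
  \<open>E\<close>. The constant \<open>M\<close> is the fourth moment shared by all
  \<open>\<xi> i\<close>; fourth powers are admissible test functions because these may grow
  polynomially.\<close>

lemma G_expectation_imp_lip_expectation: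
  assumes T: "0 < T" and G: "G_expectation \<sigma>lo \<sigma>hi T H E' \<xi> E"
  shows "\<exists>M. lip_expectation T M E"
proof -
  interpret S: sublinear_expectation_space H E' using G by (simp add: G_expectation_def)
  have mem: "\<xi> i \<in> H" for i using G by (auto simp: G_expectation_def G_normal_def)
  have idd: "ident_dist E' (\<xi> i) (\<xi> j)" for i j using G by (auto simp: G_expectation_def)
  have rep: "E (\<lambda>\<omega>. \<phi> (incr (\<lambda>i. \<omega> (t i)))) = E' (\<lambda>w. \<phi> (\<lambda>i. sqrt (incr t i) * \<xi> i w))"
    if "time_grid T n t" "\<phi> \<in> C_bLip n" for n t \<phi>
    using G that by (auto simp: G_expectation_def)
  have cyl: "\<exists>p. \<forall>X\<in>cyl A. E X = E' (\<lambda>w. X (p w)) \<and> (\<lambda>w. X (p w)) \<in> H" if A: "finite A" "A \<subseteq> {0..T}" for A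
  proof -
    obtain n s p where 1: "time_grid T n s"
      "\<And>X. X \<in> cyl A \<Longrightarrow> (\<lambda>x. X (p x)) \<in> C_bLip n"
      "\<And>X \<omega>. X \<in> cyl A \<Longrightarrow> X (p (incr (\<lambda>i. \<omega> (s i)))) = X \<omega>"
      using cyl_grid_representation[OF A] T by (metis less_imp_le)
    show ?thesis
    proof (intro exI ballI conjI)
      fix X :: "(real \<Rightarrow> real) \<Rightarrow> real" assume X: "X \<in> cyl A"
      have "E X = E (\<lambda>\<omega>. X (p (incr (\<lambda>i. \<omega> (s i)))))" using 1(3)[OF X] by simp
      also have "\<dots> = E' (\<lambda>w. X (p (\<lambda>i. sqrt (incr s i) * \<xi> i w)))" by (rule rep[OF 1(1) 1(2)[OF X]])
      finally show "E X = E' (\<lambda>w. X (p (\<lambda>i. sqrt (incr s i) * \<xi> i w)))" .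
      show "(\<lambda>w. X (p (\<lambda>i. sqrt (incr s i) * \<xi> i w))) \<in> H" by (rule S.grid_rv_mem[OF 1(2)[OF X] mem])
    qed
  qed
  \<comment> \<open>Both functions are put on the union of their times, since the sum has to be
    evaluated at the same random point as its summands.\<close>
  have two: "\<exists>p. E X = E' (\<lambda>w. X (p w)) \<and> (\<lambda>w. X (p w)) \<in> H \<and> E Y = E' (\<lambda>w. Y (p w)) \<and> (\<lambda>w. Y (p w)) \<in> H
      \<and> E (\<lambda>\<omega>. X \<omega> + Y \<omega>) = E' (\<lambda>w. X (p w) + Y (p w)) \<and> (\<forall>c. E (\<lambda>\<omega>. c * X \<omega>) = E' (\<lambda>w. c * X (p w)))"
    if X: "X \<in> Lip T" and Y: "Y \<in> Lip T" for X Y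
  proof -
    obtain A where A: "finite A" "A \<subseteq> {0..T}" "X \<in> cyl A" using Lip_subset_cyl[OF X] by blast
    obtain B where B: "finite B" "B \<subseteq> {0..T}" "Y \<in> cyl B" using Lip_subset_cyl[OF Y] by blast
    have XY: "X \<in> cyl (A \<union> B)" "Y \<in> cyl (A \<union> B)"
      using A B cyl_mono[of "A \<union> B" A] cyl_mono[of "A \<union> B" B] by auto
    obtain p where p: "\<And>X. X \<in> cyl (A \<union> B) \<Longrightarrow> E X = E' (\<lambda>w. X (p w)) \<and> (\<lambda>w. X (p w)) \<in> H"
      using cyl[of "A \<union> B"] A B by auto
    show ?thesis
      using p[OF XY(1)] p[OF XY(2)] p[OF cyl_comp2[OF XY loc_lip2_add]] p[OF cyl_comp2[OF XY loc_lip2_scale]]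
      by (intro exI[of _ p]) blast
  qed
  define M where "M = E' (\<lambda>w. \<xi> 0 w ^ 4)"
  have mem4: "(\<lambda>w. \<xi> i w ^ 4) \<in> H" for i
    using S.comp_mem[OF fourth_power_C_lLip, of "\<lambda>_. \<xi> i"] mem by simp
  have M: "E' (\<lambda>w. \<xi> i w ^ 4) = M" for i
    using idd[of i 0] fourth_power_C_lLip unfolding ident_dist_def M_def by fast
  have mom: "E (\<lambda>\<omega>. min \<bar>incr (\<lambda>i. \<omega> (t i)) j\<bar> k ^ 4) \<le> M * (incr t j)\<^sup>2"
    if t: "time_grid T n t" "j < n" "0 \<le> k" for n t j k
  proof -
    have d: "0 \<le> incr t j" using t time_grid_le[OF t(1), of "j - 1" j] time_grid_mem[OF t(1,2)] by (auto simp: incr_def)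
    have "E (\<lambda>\<omega>. min \<bar>incr (\<lambda>i. \<omega> (t i)) j\<bar> k ^ 4) = E' (\<lambda>w. min \<bar>sqrt (incr t j) * \<xi> j w\<bar> k ^ 4)"
      using rep[OF t(1) min_power4_C_bLip[OF t(2,3)]] .
    also have "\<dots> \<le> E' (\<lambda>w. (incr t j)\<^sup>2 * \<xi> j w ^ 4)"
      using S.grid_rv_mem[OF min_power4_C_bLip[OF t(2,3)] mem, of "\<lambda>i. sqrt (incr t i)"] mem4
      by (intro S.mono S.scale_mem min_abs_scaled_power4_le d t)
    also have "\<dots> = (incr t j)\<^sup>2 * M" using mem4 M by (subst S.pos_hom) auto
    finally show ?thesis by (simp add: mult.commute)
  qed
  \<comment> \<open>On the two-point grid \<open>s < t\<close> the increment with index 1 is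
    \<open>\<omega> t - \<omega> s\<close>; the increment with index 0 of a one-point grid is the
    coordinate itself, which later gives the bound for single coordinates.\<close>
  have incr_le: "E (\<lambda>\<omega>. min \<bar>\<omega> t - \<omega> s\<bar> k ^ 4) \<le> M * (t - s)\<^sup>2" if "s \<in> {0..T}" "t \<in> {0..T}" "0 \<le> k" "s < t" for s t k
    using mom[of 2 "\<lambda>i. if i = 0 then s else t" 1 k] that by (auto simp: incr_def time_grid_def less_2_cases_iff)
  have const: "E (\<lambda>_. c) = c" for c
  proof -
    have "(\<lambda>_. c) \<in> cyl {}" by (rule cylI[of _ "\<bar>c\<bar>" 0]) auto
    then show ?thesis using cyl[of "{}"] S.const[of c] by fastforce
  qed
  have "0 \<le> M"
    using S.mono[OF S.const_mem[of 0] mem4[of 0]] by (simp add: S.const M_def)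
  moreover have "E (\<lambda>\<omega>. min \<bar>\<omega> t - \<omega> s\<bar> k ^ 4) \<le> M * (t - s)\<^sup>2" if "s \<in> {0..T}" "t \<in> {0..T}" "0 \<le> k" for s t k
  proof (cases s t rule: linorder_cases)
    case greater
    then show ?thesis using incr_le[of t s k] that by (simp add: abs_minus_commute power2_commute)
  qed (use incr_le that const in auto)
  moreover have "E (\<lambda>\<omega>. min \<bar>\<omega> t\<bar> k ^ 4) \<le> M * t\<^sup>2" if "t \<in> {0..T}" "0 \<le> k" for t k
    using mom[of 1 "\<lambda>_. t" 0 k] that by (auto simp: incr_def time_grid_def)
  ultimately show ?thesis
  proof (intro exI[of _ M] lip_expectation.intro T const)
    fix X Y assume XY: "X \<in> Lip T" "Y \<in> Lip T"
    obtain p where p: "E X = E' (\<lambda>w. X (p w))" "(\<lambda>w. X (p w)) \<in> H" "E Y = E' (\<lambda>w. Y (p w))" "(\<lambda>w. Y (p w)) \<in> H"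
      "E (\<lambda>\<omega>. X \<omega> + Y \<omega>) = E' (\<lambda>w. X (p w) + Y (p w))" "\<And>c. E (\<lambda>\<omega>. c * X \<omega>) = E' (\<lambda>w. c * X (p w))"
      using two[OF XY] by auto
    show "E (\<lambda>\<omega>. X \<omega> + Y \<omega>) \<le> E X + E Y" using p S.subadd by simp
    show "E X \<le> E Y" if "\<And>\<omega>. X \<omega> \<le> Y \<omega>" using p S.mono that by simp
  next
    fix X :: "(real \<Rightarrow> real) \<Rightarrow> real" and c :: real assume X: "X \<in> Lip T" "0 \<le> c"
    then show "E (\<lambda>\<omega>. c * X \<omega>) = c * E X" using two[OF X(1) X(1)] S.pos_hom[of _ c] by auto
  qed
qed

subsection \<open>Hahn--Banach extension\<close>

definition sublinear_on :: "('a \<Rightarrow> real) set \<Rightarrow> (('a \<Rightarrow> real) \<Rightarrow> real) \<Rightarrow> bool" where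
  "sublinear_on V p \<longleftrightarrow> (\<forall>X\<in>V. \<forall>Y\<in>V. p (\<lambda>\<omega>. X \<omega> + Y \<omega>) \<le> p X + p Y) \<and>
     (\<forall>X\<in>V. \<forall>c\<ge>0. p (\<lambda>\<omega>. c * X \<omega>) = c * p X)"

text \<open>An inequality for positive factors is enough for homogeneity: applied to
  \<open>1 / c\<close> and \<open>c * X\<close> it gives the reverse inequality.\<close>

lemma sublinear_onI:
  assumes "\<And>X Y. X \<in> V \<Longrightarrow> Y \<in> V \<Longrightarrow> p (\<lambda>\<omega>. X \<omega> + Y \<omega>) \<le> p X + p Y"
    and "\<And>X. X \<in> V \<Longrightarrow> p (\<lambda>\<omega>. 0) = 0"
    and "\<And>X c. X \<in> V \<Longrightarrow> 0 < c \<Longrightarrow> p (\<lambda>\<omega>. c * X \<omega>) \<le> c * p X"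
    and V: "\<And>X c. X \<in> V \<Longrightarrow> (\<lambda>\<omega>. c * X \<omega>) \<in> V"
  shows "sublinear_on V p"
  unfolding sublinear_on_def
proof (intro conjI ballI allI impI)
  fix X c assume X: "X \<in> V" and c: "0 \<le> (c :: real)"
  show "p (\<lambda>\<omega>. c * X \<omega>) = c * p X"
  proof (cases "c = 0")
    case False
    with c have c: "0 < c" by simp
    have "p (\<lambda>\<omega>. (1 / c) * (c * X \<omega>)) \<le> (1 / c) * p (\<lambda>\<omega>. c * X \<omega>)"
      using assms(3)[OF V[OF X], of "1 / c" c] c by simp
    then have "c * p X \<le> p (\<lambda>\<omega>. c * X \<omega>)" using c by (simp add: field_simps)
    with assms(3)[OF X c] show ?thesis by simp
  qed (use assms(2) X in simp)
qed (use assms(1) in auto)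

lemma sublinear_add: "sublinear_on V p \<Longrightarrow> X \<in> V \<Longrightarrow> Y \<in> V \<Longrightarrow> p (\<lambda>\<omega>. X \<omega> + Y \<omega>) \<le> p X + p Y"
  by (simp add: sublinear_on_def)

lemma sublinear_scale: "sublinear_on V p \<Longrightarrow> X \<in> V \<Longrightarrow> 0 \<le> c \<Longrightarrow> p (\<lambda>\<omega>. c * X \<omega>) = c * p X"
  by (simp add: sublinear_on_def)

locale function_subspace =
  fixes V :: "('a \<Rightarrow> real) set"
  assumes add: "X \<in> V \<Longrightarrow> Y \<in> V \<Longrightarrow> (\<lambda>\<omega>. X \<omega> + Y \<omega>) \<in> V"
    and scale: "X \<in> V \<Longrightarrow> (\<lambda>\<omega>. c * X \<omega>) \<in> V"
begin

text \<open>Subadditivity for the sum of \<open>X + Y\<close> and \<open>- X\<close>. The bound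
  serves to keep the infima below finite.\<close>

lemma sublinear_lower:
  assumes "sublinear_on V p" "X \<in> V" "Y \<in> V"
  shows "p Y - p (\<lambda>\<omega>. - X \<omega>) \<le> p (\<lambda>\<omega>. X \<omega> + Y \<omega>)"
proof -
  have "(\<lambda>\<omega>. - X \<omega>) \<in> V" using scale[OF assms(2), of "-1"] by simp
  then have "p (\<lambda>\<omega>. (X \<omega> + Y \<omega>) + - X \<omega>) \<le> p (\<lambda>\<omega>. X \<omega> + Y \<omega>) + p (\<lambda>\<omega>. - X \<omega>)"
    by (intro sublinear_add[OF assms(1)] add assms(2,3))
  then show ?thesis by simp
qed

lemma sublinear_zero: "sublinear_on V p \<Longrightarrow> X \<in> V \<Longrightarrow> p (\<lambda>_. 0) = 0"
  using sublinear_scale[of V p X 0] by simp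

text \<open>The infimum over \<open>t \<ge> 0\<close> of \<open>p (X + t * Y) - t * p Y\<close> is
  again sublinear, as parameters of two summands add up; \<open>t = 0\<close> and
  \<open>t = 1\<close> give the two bounds. If \<open>p\<close> cannot be lowered, the second bound
  says that \<open>p\<close> is superadditive in the direction \<open>Y\<close>.\<close>

lemma sublinear_decrease:
  assumes p: "sublinear_on V p" and Y: "Y \<in> V"
  obtains r where "sublinear_on V r" "\<And>X. X \<in> V \<Longrightarrow> r X \<le> p X"
    "\<And>X. X \<in> V \<Longrightarrow> r X \<le> p (\<lambda>\<omega>. X \<omega> + Y \<omega>) - p Y"
proof
  define r where "r = (\<lambda>X. INF t\<in>{0..}. p (\<lambda>\<omega>. X \<omega> + t * Y \<omega>) - t * p Y)"
  have ps: "p (\<lambda>\<omega>. c * X \<omega>) = c * p X" if "X \<in> V" "0 \<le> c" for X c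
    by (rule sublinear_scale[OF p that])
  have bdd: "bdd_below ((\<lambda>t. p (\<lambda>\<omega>. X \<omega> + t * Y \<omega>) - t * p Y) ` {0..})" if "X \<in> V" for X
  proof (rule bdd_belowI2)
    show "- p (\<lambda>\<omega>. - X \<omega>) \<le> p (\<lambda>\<omega>. X \<omega> + t * Y \<omega>) - t * p Y" if "t \<in> {0..}" for t
      using sublinear_lower[OF p \<open>X \<in> V\<close> scale[OF Y], of t] ps[OF Y, of t] that by simp
  qed
  have le: "r X \<le> p (\<lambda>\<omega>. X \<omega> + t * Y \<omega>) - t * p Y" if "X \<in> V" "0 \<le> t" for X t
    unfolding r_def using that by (intro cINF_lower[OF bdd]) auto
  have ge: "b \<le> r X" if "\<And>t. 0 \<le> t \<Longrightarrow> b \<le> p (\<lambda>\<omega>. X \<omega> + t * Y \<omega>) - t * p Y" for b X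
    unfolding r_def using that by (intro cINF_greatest) auto
  show "r X \<le> p X" "r X \<le> p (\<lambda>\<omega>. X \<omega> + Y \<omega>) - p Y" if "X \<in> V" for X
    using le[OF that, of 0] le[OF that, of 1] by simp_all
  show "sublinear_on V r"
  proof (rule sublinear_onI[OF _ _ _ scale])
    fix X Z assume X: "X \<in> V" and Z: "Z \<in> V"
    have "r (\<lambda>\<omega>. X \<omega> + Z \<omega>) \<le> (p (\<lambda>\<omega>. X \<omega> + t * Y \<omega>) - t * p Y) + (p (\<lambda>\<omega>. Z \<omega> + t' * Y \<omega>) - t' * p Y)"
      if t: "0 \<le> t" "0 \<le> t'" for t t'
    proof -
      have "p (\<lambda>\<omega>. (X \<omega> + t * Y \<omega>) + (Z \<omega> + t' * Y \<omega>)) \<le> p (\<lambda>\<omega>. X \<omega> + t * Y \<omega>) + p (\<lambda>\<omega>. Z \<omega> + t' * Y \<omega>)"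
        by (intro sublinear_add[OF p] add scale X Y Z)
      moreover have "r (\<lambda>\<omega>. X \<omega> + Z \<omega>) \<le> p (\<lambda>\<omega>. X \<omega> + Z \<omega> + (t + t') * Y \<omega>) - (t + t') * p Y"
        using t by (intro le add X Z) auto
      ultimately show ?thesis by (simp add: algebra_simps)
    qed
    note * = this
    have "r (\<lambda>\<omega>. X \<omega> + Z \<omega>) - (p (\<lambda>\<omega>. X \<omega> + t * Y \<omega>) - t * p Y) \<le> r Z" if "0 \<le> t" for t
    proof (rule ge)
      fix t' :: real assume "0 \<le> t'"
      from *[OF that this] show "r (\<lambda>\<omega>. X \<omega> + Z \<omega>) - (p (\<lambda>\<omega>. X \<omega> + t * Y \<omega>) - t * p Y)
          \<le> p (\<lambda>\<omega>. Z \<omega> + t' * Y \<omega>) - t' * p Y" by linarith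
    qed
    then have "r (\<lambda>\<omega>. X \<omega> + Z \<omega>) - r Z \<le> r X" by (intro ge) (simp add: algebra_simps)
    then show "r (\<lambda>\<omega>. X \<omega> + Z \<omega>) \<le> r X + r Z" by simp
  next
    fix X assume X: "X \<in> V"
    have "0 \<le> r (\<lambda>_. 0)" by (rule ge) (use ps[OF Y] in simp)
    moreover have "r (\<lambda>_. 0) \<le> 0"
      using le[OF scale[OF X, of 0], of 0] sublinear_zero[OF p X] by simp
    ultimately show "r (\<lambda>_. 0) = 0" by simp
  next
    fix X c assume X: "X \<in> V" and c: "0 < (c :: real)"
    have "r (\<lambda>\<omega>. c * X \<omega>) / c \<le> r X"
    proof (rule ge)
      fix t :: real assume t: "0 \<le> t"
      have "r (\<lambda>\<omega>. c * X \<omega>) \<le> p (\<lambda>\<omega>. c * X \<omega> + (c * t) * Y \<omega>) - (c * t) * p Y"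
        using c t by (intro le scale X) auto
      also have "p (\<lambda>\<omega>. c * X \<omega> + (c * t) * Y \<omega>) = c * p (\<lambda>\<omega>. X \<omega> + t * Y \<omega>)"
        using ps[OF add[OF X scale[OF Y]], of c t] c by (simp add: algebra_simps)
      finally show "r (\<lambda>\<omega>. c * X \<omega>) / c \<le> p (\<lambda>\<omega>. X \<omega> + t * Y \<omega>) - t * p Y"
        using c by (simp add: field_simps)
    qed
    then show "r (\<lambda>\<omega>. c * X \<omega>) \<le> c * r X" using c by (simp add: field_simps)
  qed
qed

text \<open>A pointwise infimum of sublinear functionals need not be subadditive. Along a chain it
  is, since two members bounding the two summands can be replaced by the smaller of them.\<close>

lemma sublinear_chain_Inf:
  assumes C: "C \<noteq> {}" "\<And>q. q \<in> C \<Longrightarrow> sublinear_on V q" "\<And>q X. q \<in> C \<Longrightarrow> X \<in> V \<Longrightarrow> q X \<le> p X"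
    and chain: "\<And>q q'. q \<in> C \<Longrightarrow> q' \<in> C \<Longrightarrow> (\<forall>X\<in>V. q X \<le> q' X) \<or> (\<forall>X\<in>V. q' X \<le> q X)"
  shows "sublinear_on V (\<lambda>X. INF q\<in>C. q X)" "\<And>q X. q \<in> C \<Longrightarrow> X \<in> V \<Longrightarrow> (INF q\<in>C. q X) \<le> q X"
proof -
  let ?u = "\<lambda>X. INF q\<in>C. q X"
  have bdd: "bdd_below ((\<lambda>q. q X) ` C)" if "X \<in> V" for X
  proof (rule bdd_belowI2)
    fix q assume q: "q \<in> C"
    have X': "(\<lambda>\<omega>. - X \<omega>) \<in> V" using scale[OF that, of "-1"] by simp
    have "- q (\<lambda>\<omega>. - X \<omega>) \<le> q X"
      using sublinear_lower[OF C(2)[OF q] that scale[OF that, of 0]] sublinear_zero[OF C(2)[OF q] that]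
      by simp
    then show "- p (\<lambda>\<omega>. - X \<omega>) \<le> q X" using C(3)[OF q X'] by simp
  qed
  show le: "?u X \<le> q X" if "q \<in> C" "X \<in> V" for q X
    using that by (intro cINF_lower bdd)
  have ge: "b \<le> ?u X" if "\<And>q. q \<in> C \<Longrightarrow> b \<le> q X" for b X
    using that by (intro cINF_greatest C)
  show "sublinear_on V ?u"
  proof (rule sublinear_onI[OF _ _ _ scale])
    fix X Y assume X: "X \<in> V" and Y: "Y \<in> V"
    have "?u (\<lambda>\<omega>. X \<omega> + Y \<omega>) \<le> q X + q' Y" if q: "q \<in> C" "q' \<in> C" for q q'
    proof -
      obtain q'' where q'': "q'' \<in> C" "q'' X \<le> q X" "q'' Y \<le> q' Y"
        using chain[OF q] q X Y by fastforce
      have "?u (\<lambda>\<omega>. X \<omega> + Y \<omega>) \<le> q'' (\<lambda>\<omega>. X \<omega> + Y \<omega>)" by (rule le[OF q''(1) add[OF X Y]])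
      also have "\<dots> \<le> q'' X + q'' Y" by (rule sublinear_add[OF C(2)[OF q''(1)] X Y])
      finally show ?thesis using q'' by linarith
    qed
    note * = this
    have "?u (\<lambda>\<omega>. X \<omega> + Y \<omega>) - q X \<le> ?u Y" if "q \<in> C" for q
    proof (rule ge)
      fix q' assume "q' \<in> C"
      from *[OF that this] show "?u (\<lambda>\<omega>. X \<omega> + Y \<omega>) - q X \<le> q' Y" by linarith
    qed
    then have "?u (\<lambda>\<omega>. X \<omega> + Y \<omega>) - ?u Y \<le> ?u X" by (intro ge) (simp add: algebra_simps)
    then show "?u (\<lambda>\<omega>. X \<omega> + Y \<omega>) \<le> ?u X + ?u Y" by simp
  next
    fix X assume X: "X \<in> V"
    have "q (\<lambda>_. 0) = 0" if "q \<in> C" for q using sublinear_zero[OF C(2)[OF that] X] .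
    then have "(\<lambda>q. q (\<lambda>_. 0)) ` C = {0}" using C(1) by (auto simp: image_iff)
    then show "?u (\<lambda>_. 0) = 0" by simp
  next
    fix X c assume X: "X \<in> V" and c: "0 < (c :: real)"
    have "?u (\<lambda>\<omega>. c * X \<omega>) / c \<le> ?u X"
    proof (rule ge)
      fix q assume q: "q \<in> C"
      have "?u (\<lambda>\<omega>. c * X \<omega>) \<le> q (\<lambda>\<omega>. c * X \<omega>)" by (rule le[OF q scale[OF X]])
      also have "\<dots> = c * q X" using sublinear_scale[OF C(2)[OF q] X, of c] c by simp
      finally show "?u (\<lambda>\<omega>. c * X \<omega>) / c \<le> q X" using c by (simp add: field_simps)
    qed
    then show "?u (\<lambda>\<omega>. c * X \<omega>) \<le> c * ?u X" using c by (simp add: field_simps)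
  qed
qed

text \<open>Hahn--Banach: Zorn's lemma gives a minimal sublinear functional, which \<open>sublinear_decrease\<close> cannot
  lower any further and which is therefore additive.\<close>

theorem sublinear_dominates_linear:
  assumes p: "sublinear_on V p" and X0: "X0 \<in> V"
  obtains L where "\<And>X Y. X \<in> V \<Longrightarrow> Y \<in> V \<Longrightarrow> L (\<lambda>\<omega>. X \<omega> + Y \<omega>) = L X + L Y"
    "\<And>X c. X \<in> V \<Longrightarrow> L (\<lambda>\<omega>. c * X \<omega>) = c * L X" "\<And>X. X \<in> V \<Longrightarrow> L X \<le> p X" "L X0 = p X0"
proof -
  \<comment> \<open>Lowering \<open>p\<close> once in the direction \<open>X0\<close> prepares the
    touching point: at \<open>- X0\<close> the second bound reads
    \<open>p1 (- X0) \<le> - p X0\<close>, so every linear functional below \<open>p1\<close> takes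
    the value \<open>p X0\<close> at \<open>X0\<close>.\<close>
  obtain p1 where p1: "sublinear_on V p1" "\<And>X. X \<in> V \<Longrightarrow> p1 X \<le> p X"
    "\<And>X. X \<in> V \<Longrightarrow> p1 X \<le> p (\<lambda>\<omega>. X \<omega> + X0 \<omega>) - p X0"
    using sublinear_decrease[OF p X0] by blast
  \<comment> \<open>Functionals are made extensional so that agreement on \<open>V\<close> is
    equality and the order is antisymmetric. The relation \<open>P\<close> below is the reversed
    pointwise order, so the element that Zorn's lemma provides is minimal.\<close>
  define A where "A = {q \<in> extensional V. sublinear_on V q \<and> (\<forall>X\<in>V. q X \<le> p1 X)}"
  define P where "P = (\<lambda>q r. \<forall>X\<in>V. (r X :: real) \<le> q X)"
  have sub_restrict: "sublinear_on V (restrict q V)" if "sublinear_on V q" for q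
    using that add scale unfolding sublinear_on_def by simp
  have "\<exists>m\<in>A. \<forall>a\<in>A. P m a \<longrightarrow> a = m"
  proof (rule predicate_Zorn)
    show "partial_order_on A (relation_of P A)"
    proof (rule partial_order_on_relation_ofI)
      show "P a a" if "a \<in> A" for a by (simp add: P_def)
      show "P a c" if "a \<in> A" "b \<in> A" "c \<in> A" "P a b" "P b c" for a b c
        using that unfolding P_def by (meson order_trans)
      show "a = b" if "a \<in> A" "b \<in> A" "P a b" "P b a" for a b
        using that unfolding P_def A_def by (intro extensionalityI[of a V b]) (auto intro: order_antisym)
    qed
    fix C assume C: "C \<in> Chains (relation_of P A)"
    then have CA: "C \<subseteq> A" by (auto simp: Chains_def relation_of_def)
    show "\<exists>u\<in>A. \<forall>a\<in>C. P a u"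
    proof (cases "C = {}")
      case True
      then show ?thesis using sub_restrict[OF p1(1)] by (intro bexI[of _ "restrict p1 V"]) (auto simp: A_def)
    next
      case False
      have chain: "(\<forall>X\<in>V. q X \<le> q' X) \<or> (\<forall>X\<in>V. q' X \<le> q X)" if "q \<in> C" "q' \<in> C" for q q'
        using C that unfolding Chains_def relation_of_def P_def by blast
      note u = sublinear_chain_Inf[OF False, of p1]
      have 1: "sublinear_on V (\<lambda>X. INF q\<in>C. q X)" by (rule u(1)) (use CA chain in \<open>auto simp: A_def\<close>)
      have 2: "(INF q\<in>C. q X) \<le> q X" if "q \<in> C" "X \<in> V" for q X
        by (rule u(2)) (use CA chain that in \<open>auto simp: A_def\<close>)
      have 3: "(INF q\<in>C. q X) \<le> p1 X" if "X \<in> V" for X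
      proof -
        obtain q where q: "q \<in> C" using False by blast
        then have "q X \<le> p1 X" using CA that by (auto simp: A_def)
        then show ?thesis using 2[OF q that] by linarith
      qed
      show ?thesis
        by (intro bexI[of _ "restrict (\<lambda>X. INF q\<in>C. q X) V"])
          (use 2 3 sub_restrict[OF 1] in \<open>auto simp: P_def A_def\<close>)
    qed
  qed
  then obtain m where m: "m \<in> A" "\<And>a. a \<in> A \<Longrightarrow> P m a \<Longrightarrow> a = m" by blast
  have ms: "sublinear_on V m" and mp: "\<And>X. X \<in> V \<Longrightarrow> m X \<le> p1 X" using m(1) by (auto simp: A_def)
  have add_m: "m (\<lambda>\<omega>. X \<omega> + Y \<omega>) = m X + m Y" if X: "X \<in> V" and Y: "Y \<in> V" for X Y
  proof -
    obtain r where r: "sublinear_on V r" "\<And>X. X \<in> V \<Longrightarrow> r X \<le> m X"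
      "\<And>X. X \<in> V \<Longrightarrow> r X \<le> m (\<lambda>\<omega>. X \<omega> + Y \<omega>) - m Y"
      using sublinear_decrease[OF ms Y] by blast
    have "restrict r V \<in> A" using sub_restrict[OF r(1)] order_trans[OF r(2) mp] by (auto simp: A_def)
    then have "restrict r V = m" using r(2) by (intro m(2)) (auto simp: P_def)
    then have "m X = r X" using X by auto
    then have "m X \<le> m (\<lambda>\<omega>. X \<omega> + Y \<omega>) - m Y" using r(3)[OF X] by simp
    moreover have "m (\<lambda>\<omega>. X \<omega> + Y \<omega>) \<le> m X + m Y" by (rule sublinear_add[OF ms X Y])
    ultimately show ?thesis by simp
  qed
  have neg: "m (\<lambda>\<omega>. - X \<omega>) = - m X" if "X \<in> V" for X
    using add_m[OF that scale[OF that, of "-1"]] sublinear_zero[OF ms that] by simp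
  have scale_m: "m (\<lambda>\<omega>. c * X \<omega>) = c * m X" if "X \<in> V" for X c
  proof (cases "0 \<le> c")
    case True
    then show ?thesis by (rule sublinear_scale[OF ms that])
  next
    case False
    then have "m (\<lambda>\<omega>. - c * X \<omega>) = - c * m X" using sublinear_scale[OF ms that, of "- c"] by simp
    then show ?thesis using neg[OF scale[OF that, of "- c"]] by simp
  qed
  show thesis
  proof (rule that[of m])
    show "m X \<le> p X" if "X \<in> V" for X using mp[OF that] p1(2)[OF that] by simp
    have "(\<lambda>\<omega>. - X0 \<omega>) \<in> V" using scale[OF X0, of "-1"] by simp
    then have "- m X0 \<le> - p X0"
      using neg[OF X0] mp p1(3) sublinear_zero[OF p X0] by fastforce
    then show "m X0 = p X0" using mp[OF X0] p1(2)[OF X0] by simp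
  qed (use add_m scale_m in auto)
qed

end

text \<open>No measurability is imposed: the coding below needs the functional on indicators of
  arbitrary sets and on functions composed with choice maps.\<close>

definition bounded_funs :: "('a \<Rightarrow> real) set" where
  "bounded_funs = {X. \<exists>K. \<forall>\<omega>. \<bar>X \<omega>\<bar> \<le> K}"

lemma bounded_funsI: "(\<And>\<omega>. \<bar>X \<omega>\<bar> \<le> K) \<Longrightarrow> X \<in> bounded_funs"
  by (auto simp: bounded_funs_def)

lemma bounded_funs_add: "X \<in> bounded_funs \<Longrightarrow> Y \<in> bounded_funs \<Longrightarrow> (\<lambda>\<omega>. X \<omega> + Y \<omega>) \<in> bounded_funs"
proof -
  assume "X \<in> bounded_funs" "Y \<in> bounded_funs"
  then obtain K K' where "\<And>\<omega>. \<bar>X \<omega>\<bar> \<le> K" "\<And>\<omega>. \<bar>Y \<omega>\<bar> \<le> K'" by (auto simp: bounded_funs_def)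
  then show ?thesis by (intro bounded_funsI[of _ "K + K'"] order_trans[OF abs_triangle_ineq] add_mono)
qed

lemma bounded_funs_scale: "X \<in> bounded_funs \<Longrightarrow> (\<lambda>\<omega>. c * X \<omega>) \<in> bounded_funs"
proof -
  assume "X \<in> bounded_funs"
  then obtain K where "\<And>\<omega>. \<bar>X \<omega>\<bar> \<le> K" by (auto simp: bounded_funs_def)
  then show ?thesis by (intro bounded_funsI[of _ "\<bar>c\<bar> * K"]) (simp add: abs_mult mult_left_mono)
qed

interpretation bounded_funs: function_subspace bounded_funs
  by unfold_locales (auto intro: bounded_funs_add bounded_funs_scale)

lemma cyl_subset_bounded_funs: "cyl A \<subseteq> bounded_funs"
  by (auto simp: cyl_def bounded_funs_def)

lemma Lip_subset_bounded_funs: "Lip T \<subseteq> bounded_funs"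
  using Lip_subset_cyl cyl_subset_bounded_funs by fast

text \<open>A finitely additive probability on all subsets, given through its integral.\<close>

locale positive_functional =
  fixes L :: "('a \<Rightarrow> real) \<Rightarrow> real"
  assumes L_add: "X \<in> bounded_funs \<Longrightarrow> Y \<in> bounded_funs \<Longrightarrow> L (\<lambda>\<omega>. X \<omega> + Y \<omega>) = L X + L Y"
    and L_scale: "X \<in> bounded_funs \<Longrightarrow> L (\<lambda>\<omega>. c * X \<omega>) = c * L X"
    and L_nonneg: "X \<in> bounded_funs \<Longrightarrow> (\<And>\<omega>. 0 \<le> X \<omega>) \<Longrightarrow> 0 \<le> L X"
    and L_one: "L (\<lambda>_. 1) = 1"
begin

lemma L_diff: "X \<in> bounded_funs \<Longrightarrow> Y \<in> bounded_funs \<Longrightarrow> L (\<lambda>\<omega>. X \<omega> - Y \<omega>) = L X - L Y"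
  using L_add[of X "\<lambda>\<omega>. -1 * Y \<omega>"] L_scale[of Y "-1"] bounded_funs_scale[of Y "-1"] by simp

lemma L_mono: "X \<in> bounded_funs \<Longrightarrow> Y \<in> bounded_funs \<Longrightarrow> (\<And>\<omega>. X \<omega> \<le> Y \<omega>) \<Longrightarrow> L X \<le> L Y"
  using L_nonneg[of "\<lambda>\<omega>. Y \<omega> - X \<omega>"] L_diff[of Y X] bounded_funs_add[of Y "\<lambda>\<omega>. -1 * X \<omega>"]
    bounded_funs_scale[of X "-1"] by simp

lemma L_const: "L (\<lambda>_. c) = c"
  using L_scale[of "\<lambda>_. 1" c] L_one bounded_funsI[of "\<lambda>_. 1" 1] by simp

lemma L_sum:
  "finite S \<Longrightarrow> (\<And>i. i \<in> S \<Longrightarrow> X i \<in> bounded_funs) \<Longrightarrow>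
    (\<lambda>\<omega>. \<Sum>i\<in>S. X i \<omega>) \<in> bounded_funs \<and> L (\<lambda>\<omega>. \<Sum>i\<in>S. X i \<omega>) = (\<Sum>i\<in>S. L (X i))"
proof (induction S rule: finite_induct)
  case empty
  then show ?case using L_const[of 0] bounded_funsI[of "\<lambda>_. 0" 0] by simp
next
  case (insert x F)
  then show ?case using L_add[of "X x" "\<lambda>\<omega>. \<Sum>i\<in>F. X i \<omega>"] bounded_funs_add[of "X x"] by simp
qed

lemma L_abs: "X \<in> bounded_funs \<Longrightarrow> \<bar>L X\<bar> \<le> L (\<lambda>\<omega>. \<bar>X \<omega>\<bar>)"
proof -
  assume X: "X \<in> bounded_funs"
  then have "(\<lambda>\<omega>. \<bar>X \<omega>\<bar>) \<in> bounded_funs" by (auto simp: bounded_funs_def)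
  then have "L X \<le> L (\<lambda>\<omega>. \<bar>X \<omega>\<bar>)" "L (\<lambda>\<omega>. -1 * X \<omega>) \<le> L (\<lambda>\<omega>. \<bar>X \<omega>\<bar>)"
    using X bounded_funs_scale[OF X, of "-1"] by (auto intro!: L_mono)
  then show ?thesis using L_scale[OF X, of "-1"] by linarith
qed

end

context lip_expectation
begin

lemma E_zero: "E (\<lambda>_. 0) = 0" by (rule E_const)

text \<open>Extending through the upper expectation \<open>inf {E Y. X \<le> Y}\<close> makes the functional positive.\<close>

lemma functional_below:
  assumes X0: "X0 \<in> Lip T"
  obtains L where "positive_functional L" "\<And>X. X \<in> Lip T \<Longrightarrow> L X \<le> E X" "L X0 = E X0"
proof -
  define U where "U = (\<lambda>X. {Y \<in> Lip T. \<forall>\<omega>. X \<omega> \<le> Y \<omega>})"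
  define p where "p = (\<lambda>X. INF Y\<in>U X. E Y)"
  have T0: "0 \<le> T" using T_pos by simp
  have ne: "U X \<noteq> {}" if "X \<in> bounded_funs" for X
  proof -
    obtain K where K: "\<And>\<omega>. \<bar>X \<omega>\<bar> \<le> K" using \<open>X \<in> _\<close> by (auto simp: bounded_funs_def)
    have "(\<lambda>_. K) \<in> U X" using Lip_const[OF T0] K by (auto simp: U_def intro: order_trans[OF abs_ge_self])
    then show ?thesis by blast
  qed
  have bdd: "bdd_below (E ` U X)" if "X \<in> bounded_funs" for X
  proof -
    obtain K where K: "\<And>\<omega>. \<bar>X \<omega>\<bar> \<le> K" using \<open>X \<in> _\<close> by (auto simp: bounded_funs_def)
    have "- K \<le> E Y" if "Y \<in> U X" for Y
    proof -
      have "- K \<le> Y \<omega>" for \<omega> using K[of \<omega>] \<open>Y \<in> U X\<close> unfolding U_def by (smt (verit) mem_Collect_eq)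
      then have "E (\<lambda>_. - K) \<le> E Y" using that by (intro E_mono Lip_const T0) (auto simp: U_def)
      then show ?thesis by (simp add: E_const)
    qed
    then show ?thesis by (rule bdd_belowI2)
  qed
  have le: "p X \<le> E Y" if "X \<in> bounded_funs" "Y \<in> Lip T" "\<And>\<omega>. X \<omega> \<le> Y \<omega>" for X Y
    unfolding p_def using that by (intro cINF_lower bdd) (auto simp: U_def)
  have ge: "b \<le> p X" if "X \<in> bounded_funs" "\<And>Y. Y \<in> Lip T \<Longrightarrow> (\<And>\<omega>. X \<omega> \<le> Y \<omega>) \<Longrightarrow> b \<le> E Y" for b X
    unfolding p_def using that(2) by (intro cINF_greatest ne that) (auto simp: U_def)
  have pE: "p X = E X" if "X \<in> Lip T" for X
    using that Lip_subset_bounded_funs by (intro antisym le ge E_mono) auto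
  have "sublinear_on bounded_funs p"
  proof (rule sublinear_onI[OF _ _ _ bounded_funs_scale])
    fix X Y :: "(real \<Rightarrow> real) \<Rightarrow> real" assume X: "X \<in> bounded_funs" and Y: "Y \<in> bounded_funs"
    have "p (\<lambda>\<omega>. X \<omega> + Y \<omega>) \<le> E X' + E Y'"
      if "X' \<in> Lip T" "\<And>\<omega>. X \<omega> \<le> X' \<omega>" "Y' \<in> Lip T" "\<And>\<omega>. Y \<omega> \<le> Y' \<omega>" for X' Y'
      using that Lip_comp2[OF T0 _ _ loc_lip2_add]
      by (intro order_trans[OF _ E_add] le bounded_funs_add X Y add_mono) auto
    note * = this
    have "p (\<lambda>\<omega>. X \<omega> + Y \<omega>) - E X' \<le> p Y" if "X' \<in> Lip T" "\<And>\<omega>. X \<omega> \<le> X' \<omega>" for X'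
    proof (rule ge[OF Y])
      fix Y' assume "Y' \<in> Lip T" "\<And>\<omega>. Y \<omega> \<le> Y' \<omega>"
      from *[OF that this] show "p (\<lambda>\<omega>. X \<omega> + Y \<omega>) - E X' \<le> E Y'" by linarith
    qed
    then have "p (\<lambda>\<omega>. X \<omega> + Y \<omega>) - p Y \<le> p X" by (intro ge X) (simp add: algebra_simps)
    then show "p (\<lambda>\<omega>. X \<omega> + Y \<omega>) \<le> p X + p Y" by simp
  next
    show "p (\<lambda>_. 0) = 0" using pE[OF Lip_const[OF T0]] E_zero by simp
  next
    fix X :: "(real \<Rightarrow> real) \<Rightarrow> real" and c :: real assume X: "X \<in> bounded_funs" and c: "0 < c"
    have "p (\<lambda>\<omega>. c * X \<omega>) / c \<le> p X"
    proof (rule ge[OF X])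
      fix Y assume Y: "Y \<in> Lip T" "\<And>\<omega>. X \<omega> \<le> Y \<omega>"
      have "p (\<lambda>\<omega>. c * X \<omega>) \<le> E (\<lambda>\<omega>. c * Y \<omega>)"
        using c Y Lip_comp2[OF T0 Y(1) Y(1) loc_lip2_scale] by (intro le bounded_funs_scale X mult_left_mono) auto
      then show "p (\<lambda>\<omega>. c * X \<omega>) / c \<le> E Y" using c Y E_scale[of Y c] by (simp add: field_simps)
    qed
    then show "p (\<lambda>\<omega>. c * X \<omega>) \<le> c * p X" using c by (simp add: field_simps)
  qed
  then obtain L where L: "\<And>X Y. X \<in> bounded_funs \<Longrightarrow> Y \<in> bounded_funs \<Longrightarrow> L (\<lambda>\<omega>. X \<omega> + Y \<omega>) = L X + L Y"
    "\<And>X c. X \<in> bounded_funs \<Longrightarrow> L (\<lambda>\<omega>. c * X \<omega>) = c * L X" "\<And>X. X \<in> bounded_funs \<Longrightarrow> L X \<le> p X" "L X0 = p X0"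
    using bounded_funs.sublinear_dominates_linear X0 Lip_subset_bounded_funs by blast
  have c: "L (\<lambda>_. c) \<le> c" for c
    using L(3)[of "\<lambda>_. c"] pE[OF Lip_const[OF T0, of c]] bounded_funsI[of "\<lambda>_. c" "\<bar>c\<bar>"] E_const by simp
  \<comment> \<open>Domination at the constants 1 and -1 bounds the value at 1 from both
    sides.\<close>
  have "L (\<lambda>_. -1 * 1) = -1 * L (\<lambda>_. 1)" by (rule L(2)) (rule bounded_funsI[of _ 1], simp)
  then have one: "L (\<lambda>_. 1) = 1" using c[of "-1"] c[of 1] by simp
  show thesis
  proof (rule that[of L])
    show "positive_functional L"
    proof (unfold_locales)
      fix X :: "(real \<Rightarrow> real) \<Rightarrow> real" assume X: "X \<in> bounded_funs" "\<And>\<omega>. 0 \<le> X \<omega>"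
      \<comment> \<open>The constant 0 is a cylinder function above \<open>- X\<close>, so the upper
        expectation of \<open>- X\<close> is at most 0.\<close>
      have "L (\<lambda>\<omega>. -1 * X \<omega>) \<le> p (\<lambda>\<omega>. -1 * X \<omega>)" by (intro L(3) bounded_funs_scale X)
      also have "\<dots> \<le> E (\<lambda>_. 0)" using X by (intro le Lip_const T0 bounded_funs_scale) auto
      finally show "0 \<le> L X" using L(2)[OF X(1), of "-1"] E_zero by simp
    qed (use L one in auto)
    show "L X \<le> E X" if "X \<in> Lip T" for X using L(3)[of X] pE[OF that] that Lip_subset_bounded_funs by fastforce
    show "L X0 = E X0" using L(4) pE[OF X0] by simp
  qed
qed

end

subsection \<open>Realising finitely additive functionals\<close>

text \<open>Membership in the first \<open>n\<close> sets. New bits go to the front, so a coarser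
  pattern is a suffix of a finer one and is recovered by \<open>drop\<close>.\<close>

fun pattern :: "(nat \<Rightarrow> 'a set) \<Rightarrow> nat \<Rightarrow> 'a \<Rightarrow> bool list" where
  "pattern A 0 \<omega> = []"
| "pattern A (Suc n) \<omega> = (\<omega> \<in> A n) # pattern A n \<omega>"

lemma length_pattern [simp]: "length (pattern A n \<omega>) = n"
  by (induction n) auto

lemma pattern_eq_iff: "pattern A n \<omega> = pattern A n \<omega>' \<longleftrightarrow> (\<forall>j<n. \<omega> \<in> A j \<longleftrightarrow> \<omega>' \<in> A j)"
  by (induction n) (auto simp: less_Suc_eq)

lemma pattern_drop: "m \<le> n \<Longrightarrow> pattern A m \<omega> = drop (n - m) (pattern A n \<omega>)"
  by (induction n) (auto simp: le_Suc_eq Suc_diff_le)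

lemma measure_preimage_eq_integral:
  "measure M {x \<in> space M. f x \<in> S} = (\<integral>x. indicator S (f x) \<partial>M)"
proof -
  have "{x \<in> space M. f x \<in> S} = f -` S \<inter> space M" by auto
  moreover have "(\<lambda>x. indicator S (f x) :: real) = indicator (f -` S)" by (auto simp: indicator_def)
  ultimately show ?thesis by simp
qed

abbreviation unit_interval :: "real measure" where
  "unit_interval \<equiv> restrict_space lborel {0..<1}"

lemma prob_space_unit_interval: "prob_space unit_interval"
  by (rule prob_spaceI) (simp add: emeasure_restrict_space space_restrict_space)

text \<open>
  A finitely additive functional is realised on the unit interval: nested intervals are
  allotted to the cells that the sets \<open>A j\<close> generate, of length the mass of the cell.
\<close>

locale pattern_coding = positive_functional L for L :: "('a \<Rightarrow> real) \<Rightarrow> real" +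
  fixes A :: "nat \<Rightarrow> 'a set"
begin

definition cell :: "bool list \<Rightarrow> 'a set" where
  "cell s = {\<omega>. pattern A (length s) \<omega> = s}"

definition weight :: "bool list \<Rightarrow> real" where
  "weight s = L (indicator (cell s))"

text \<open>Lays the intervals side by side: inside the parent's interval the \<open>False\<close>
  child comes first, and the \<open>True\<close> child is shifted by its sibling's weight.\<close>

primrec left_end :: "bool list \<Rightarrow> real" where
  "left_end [] = 0"
| "left_end (b # s) = left_end s + (if b then weight (False # s) else 0)"

primrec code :: "real \<Rightarrow> nat \<Rightarrow> bool list" where
  "code u 0 = []"
| "code u (Suc n) = (left_end (code u n) + weight (False # code u n) \<le> u) # code u n"

lemma length_code [simp]: "length (code u n) = n"
  by (induction n) auto

lemma code_drop: "m \<le> n \<Longrightarrow> code u m = drop (n - m) (code u n)"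
  by (induction n) (auto simp: le_Suc_eq Suc_diff_le)

lemma indicator_bounded [simp]: "indicator S \<in> bounded_funs"
  by (rule bounded_funsI[of _ 1]) (auto simp: indicator_def)

lemma weight_nonneg: "0 \<le> weight s"
  unfolding weight_def by (rule L_nonneg) auto

lemma weight_Nil: "weight [] = 1"
  using L_one by (simp add: weight_def cell_def)

lemma weight_split: "weight s = weight (True # s) + weight (False # s)"
proof -
  have "(indicator (cell s) :: 'a \<Rightarrow> real) = (\<lambda>\<omega>. indicator (cell (True # s)) \<omega> + indicator (cell (False # s)) \<omega>)"
    by (auto simp: cell_def indicator_def)
  then show ?thesis unfolding weight_def by (simp add: L_add)
qed

text \<open>Each bit tells on which side of the cut between the two children \<open>u\<close> lies.
  With half-open intervals a cell of weight 0 gets the empty interval and is the code of no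
  \<open>u\<close>.\<close>

lemma code_eq_iff:
  assumes u: "0 \<le> u" "u < 1"
  shows "code u n = s \<longleftrightarrow> length s = n \<and> left_end s \<le> u \<and> u < left_end s + weight s"
proof (induction n arbitrary: s)
  case 0
  then show ?case using u weight_Nil by auto
next
  case (Suc n)
  show ?case
  proof (cases s)
    case (Cons b s')
    have "code u (Suc n) = s \<longleftrightarrow> code u n = s' \<and> (left_end s' + weight (False # s') \<le> u) = b"
      using Cons by auto
    also have "\<dots> \<longleftrightarrow> length s = Suc n \<and> left_end s \<le> u \<and> u < left_end s + weight s"
      unfolding Suc.IH using weight_split[of s'] weight_nonneg[of "False # s'"] weight_nonneg[of "True # s'"]
      by (cases b) (auto simp: Cons)
    finally show ?thesis .
  qed auto
qed

lemma interval_bounds: "0 \<le> left_end s \<and> left_end s + weight s \<le> 1"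
proof (induction s)
  case (Cons b s)
  then show ?case using weight_split[of s] weight_nonneg[of "False # s"] weight_nonneg[of "True # s"]
    by (cases b) auto
qed (simp add: weight_Nil)

lemma code_level_set:
  assumes "length s = n"
  shows "{u \<in> space unit_interval. code u n = s} = {left_end s..<left_end s + weight s}"
  using code_eq_iff[of _ n s] assms interval_bounds[of s] by (auto simp: space_restrict_space)

lemma code_measurable [measurable]: "(\<lambda>u. code u n) \<in> measurable unit_interval (count_space UNIV)"
proof (subst measurable_count_space_eq2_countable, intro conjI ballI)
  fix s :: "bool list"
  have "(\<lambda>u. code u n) -` {s} \<inter> space unit_interval = {u \<in> space unit_interval. code u n = s}" by auto
  also have "\<dots> \<in> sets unit_interval"
  proof (cases "length s = n")
    case True
    then show ?thesis using interval_bounds[of s]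
      by (subst code_level_set) (auto simp: sets_restrict_space_iff)
  next
    case False
    then have "{u \<in> space unit_interval. code u n = s} = {}" using length_code by blast
    then show ?thesis by (simp only: sets.empty_sets)
  qed
  finally show "(\<lambda>u. code u n) -` {s} \<inter> space unit_interval \<in> sets unit_interval" .
qed auto

lemma measure_code:
  assumes "length s = n"
  shows "measure unit_interval {u \<in> space unit_interval. code u n = s} = weight s"
  unfolding code_level_set[OF assms] using interval_bounds[of s] weight_nonneg[of s]
  by (subst measure_restrict_space) auto

text \<open>Both sides are finite sums over the bit lists of length \<open>n\<close>, and interval
  length equals cell weight; finite additivity therefore suffices.\<close>

lemma integral_code:
  fixes g :: "bool list \<Rightarrow> real"
  shows "(\<integral>u. g (code u n) \<partial>unit_interval) = L (\<lambda>\<omega>. g (pattern A n \<omega>))"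
proof -
  interpret U: prob_space unit_interval by (rule prob_space_unit_interval)
  define S where "S = {s :: bool list. length s = n}"
  have S: "finite S" using finite_lists_length_eq[of "UNIV :: bool set" n] by (simp add: S_def)
  define B where "B = (\<lambda>s. {u \<in> space unit_interval. code u n = s})"
  have B: "B s \<in> sets unit_interval" "B s \<inter> space unit_interval = B s" for s
    unfolding B_def by measurable auto
  have BS: "U.prob (B s) = weight s" if "s \<in> S" for s
    using measure_code[of s n] that by (simp add: B_def S_def)
  have int: "integrable unit_interval (\<lambda>u. g s * indicator (B s) u)" for s
    using B(1) by (intro integrable_mult_right integrable_real_indicator) (auto simp: U.emeasure_eq_measure)
  have "(\<integral>u. g (code u n) \<partial>unit_interval) = (\<integral>u. (\<Sum>s\<in>S. g s * indicator (B s) u) \<partial>unit_interval)"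
  proof (rule Bochner_Integration.integral_cong[OF refl])
    fix u assume u: "u \<in> space unit_interval"
    have "(\<Sum>s\<in>S. g s * indicator (B s) u) = (\<Sum>s\<in>S. if s = code u n then g s else 0)"
      using u by (intro sum.cong) (auto simp: indicator_def B_def)
    also have "\<dots> = g (code u n)" using S by (simp add: S_def)
    finally show "g (code u n) = (\<Sum>s\<in>S. g s * indicator (B s) u)" ..
  qed
  also have "\<dots> = (\<Sum>s\<in>S. g s * weight s)"
    by (subst Bochner_Integration.integral_sum[OF int], intro sum.cong) (simp_all add: BS B(2) del: space_restrict_space space_restrict_space2)
  also have "\<dots> = L (\<lambda>\<omega>. \<Sum>s\<in>S. g s * indicator (cell s) \<omega>)"
    using L_sum[OF S, of "\<lambda>s \<omega>. g s * indicator (cell s) \<omega>"]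
    by (simp add: bounded_funs_scale L_scale weight_def)
  also have "(\<lambda>\<omega>. \<Sum>s\<in>S. g s * indicator (cell s) \<omega>) = (\<lambda>\<omega>. g (pattern A n \<omega>))"
  proof
    fix \<omega>
    have "(\<Sum>s\<in>S. g s * indicator (cell s) \<omega>) = (\<Sum>s\<in>S. if s = pattern A n \<omega> then g s else 0)"
      by (intro sum.cong) (auto simp: indicator_def cell_def S_def)
    also have "\<dots> = g (pattern A n \<omega>)" using S by (simp add: S_def)
    finally show "(\<Sum>s\<in>S. g s * indicator (cell s) \<omega>) = g (pattern A n \<omega>)" .
  qed
  finally show ?thesis .
qed

text \<open>A point of the cell that \<open>u\<close> codes. Like \<open>repr\<close> below it is
  chosen as a function of the bit list alone and by the same choice, so that
  \<open>integral_code\<close> relates the two.\<close>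

definition point :: "nat \<Rightarrow> real \<Rightarrow> 'a" where
  "point n u = (SOME \<omega>. pattern A n \<omega> = code u n)"

definition repr :: "nat \<Rightarrow> 'a \<Rightarrow> 'a" where
  "repr n \<omega> = (SOME \<omega>'. pattern A n \<omega>' = pattern A n \<omega>)"

lemma pattern_repr: "pattern A n (repr n \<omega>) = pattern A n \<omega>"
  unfolding repr_def by (rule someI[of _ \<omega>]) simp

text \<open>The interval of the code contains \<open>u\<close>, hence the weight is positive and the
  cell is not empty; otherwise the choice in \<open>point\<close> would be arbitrary.\<close>

lemma pattern_point:
  assumes "u \<in> {0..<1}"
  shows "pattern A n (point n u) = code u n"
proof -
  have "weight (code u n) > 0" using code_eq_iff[of u n "code u n"] assms by auto
  moreover have "weight (code u n) = 0" if "cell (code u n) = {}"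
  proof -
    have "(indicator {} :: 'a \<Rightarrow> real) = (\<lambda>_. 0)" by auto
    then show ?thesis using L_const[of 0] that by (simp add: weight_def)
  qed
  ultimately have "cell (code u n) \<noteq> {}" by (metis less_irrefl)
  then obtain \<omega> where "\<omega> \<in> cell (code u n)" unfolding ex_in_conv[symmetric] ..
  then show ?thesis unfolding point_def by (intro someI_ex[of "\<lambda>\<omega>. pattern A n \<omega> = code u n"] exI[of _ \<omega>]) (simp add: cell_def)
qed

lemma pattern_point_le:
  assumes "u \<in> {0..<1}" "m \<le> n" "m \<le> n'"
  shows "pattern A m (point n u) = pattern A m (point n' u)"
  using pattern_point[OF assms(1)] code_drop pattern_drop assms(2,3) by metis

lemma point_measurable:
  fixes g :: "'a \<Rightarrow> real"
  shows "(\<lambda>u. g (point n u)) \<in> borel_measurable unit_interval"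
  unfolding point_def by (rule measurable_compose[OF code_measurable]) simp

lemma integral_point: "(\<integral>u. g (point n u) \<partial>unit_interval) = L (\<lambda>\<omega>. g (repr n \<omega>))"
  unfolding point_def repr_def by (rule integral_code)

end

lemma cyl_isCont:
  fixes X :: "('i :: countable \<Rightarrow> real) \<Rightarrow> real"
  assumes "X \<in> cyl A"
  shows "isCont X x"
proof -
  obtain K C where KC: "\<And>\<omega>. \<bar>X \<omega>\<bar> \<le> K" "\<And>\<omega> \<omega>'. \<bar>X \<omega> - X \<omega>'\<bar> \<le> C * (\<Sum>a\<in>A. \<bar>\<omega> a - \<omega>' a\<bar>)" "0 < K" "0 < C"
    using assms by (rule cylE) (rule that)
  have coord: "((\<lambda>y. y a) \<longlongrightarrow> x a) (at x)" for a
  proof -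
    have "isCont (\<lambda>y :: 'i \<Rightarrow> real. y a) x"
      using continuous_on_product_coordinates[where i = a] continuous_on_eq_continuous_at[OF open_UNIV] by blast
    then show ?thesis by (simp add: isCont_def)
  qed
  show ?thesis unfolding isCont_def
  proof (rule LIM_zero_cancel, rule Lim_null_comparison)
    show "\<forall>\<^sub>F y in at x. norm (X y - X x) \<le> C * (\<Sum>a\<in>A. \<bar>y a - x a\<bar>)"
      using KC(2) by (intro always_eventually) auto
    have "((\<lambda>y. C * (\<Sum>a\<in>A. \<bar>y a - x a\<bar>)) \<longlongrightarrow> C * (\<Sum>a\<in>A. \<bar>x a - x a\<bar>)) (at x)"
      by (intro tendsto_intros coord)
    then show "((\<lambda>y. C * (\<Sum>a\<in>A. \<bar>y a - x a\<bar>)) \<longlongrightarrow> 0) (at x)" by simp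
  qed
qed

lemma cyl_tendsto:
  assumes X: "X \<in> cyl A" and lim: "\<And>i. i \<in> A \<Longrightarrow> (\<lambda>n. y n i) \<longlonglongrightarrow> x i"
  shows "(\<lambda>n. X (y n)) \<longlonglongrightarrow> X x"
proof -
  obtain K C where KC: "\<And>\<omega>. \<bar>X \<omega>\<bar> \<le> K" "\<And>\<omega> \<omega>'. \<bar>X \<omega> - X \<omega>'\<bar> \<le> C * (\<Sum>a\<in>A. \<bar>\<omega> a - \<omega>' a\<bar>)" "0 < K" "0 < C"
    using X by (rule cylE) (rule that)
  show ?thesis
  proof (rule LIM_zero_cancel, rule Lim_null_comparison)
    show "\<forall>\<^sub>F n in sequentially. norm (X (y n) - X x) \<le> C * (\<Sum>a\<in>A. \<bar>y n a - x a\<bar>)"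
      using KC(2) by (intro always_eventually) auto
    have "(\<lambda>n. C * (\<Sum>a\<in>A. \<bar>y n a - x a\<bar>)) \<longlonglongrightarrow> C * (\<Sum>a\<in>A. \<bar>x a - x a\<bar>)"
      by (intro tendsto_intros lim)
    then show "(\<lambda>n. C * (\<Sum>a\<in>A. \<bar>y n a - x a\<bar>)) \<longlonglongrightarrow> 0" by simp
  qed
qed

text \<open>With a countable index type, coordinatewise measurability gives Borel measurability for
  the product topology, in which cylinder functions are continuous.\<close>

lemma cyl_measurable_compose:
  fixes X :: "('i :: countable \<Rightarrow> real) \<Rightarrow> real"
  assumes "X \<in> cyl A" "\<And>i. V i \<in> borel_measurable M"
  shows "(\<lambda>u. X (\<lambda>i. V i u)) \<in> borel_measurable M"
proof (rule measurable_compose[of "\<lambda>u i. V i u" M borel])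
  show "(\<lambda>u i. V i u) \<in> borel_measurable M"
    by (rule measurable_coordinatewise_then_product) (rule assms)
  show "X \<in> borel_measurable borel"
    using cyl_isCont[OF assms(1)] by (intro borel_measurable_continuous_onI continuous_at_imp_continuous_on) auto
qed

text \<open>
  If no mass escapes to infinity, the points that code ever finer cells converge almost surely in
  each coordinate, and this yields random variables whose joint law is \<open>L\<close>.
\<close>

theorem functional_realised:
  fixes L :: "((nat \<Rightarrow> real) \<Rightarrow> real) \<Rightarrow> real"
  assumes L: "positive_functional L"
    and tight: "\<And>i e. 0 < e \<Longrightarrow> \<exists>R>0. L (indicator {\<omega>. R \<le> \<bar>\<omega> i\<bar>}) < e"
  obtains V where "\<And>i. V i \<in> borel_measurable unit_interval"
    "\<And>k X. X \<in> cyl {..<k} \<Longrightarrow> (\<integral>u. X (\<lambda>i. V i u) \<partial>unit_interval) = L X"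
proof -
  \<comment> \<open>Half-spaces with rational thresholds, enumerated over all coordinates: finitely
    many of them locate a bounded coordinate up to any given precision.\<close>
  define A where "A = (\<lambda>j. let (i, q) = from_nat j :: nat \<times> rat in {\<omega>. real_of_rat q \<le> \<omega> i} :: (nat \<Rightarrow> real) set)"
  interpret positive_functional L by fact
  interpret pattern_coding L A by unfold_locales
  interpret U: prob_space unit_interval by (rule prob_space_unit_interval)
  \<comment> \<open>A long enough pattern determines coordinate \<open>i\<close> up to
    \<open>e\<close>. Only one of the two points is assumed to lie in the bounded range; the
    thresholds around its coordinate confine the other.\<close>
  have sep: "\<exists>N. \<forall>n\<ge>N. \<forall>\<omega> \<omega>'. pattern A n \<omega> = pattern A n \<omega>' \<longrightarrow> \<bar>\<omega> i\<bar> < R \<longrightarrow> \<bar>\<omega> i - \<omega>' i\<bar> \<le> e"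
    if e: "0 < e" for i and R e :: real
  proof -
    obtain k :: nat where k: "1 / e < real k" using reals_Archimedean2 by blast
    have k0: "0 < k" using k e by (cases k) (auto simp: divide_less_0_iff)
    have k1: "1 / real k \<le> e" using k k0 e by (simp add: field_simps)
    \<comment> \<open>Large enough that both thresholds enclosing a value of modulus below
      \<open>R\<close>, with numerators \<open>j\<close> and \<open>j + 1\<close>, are among those
      tested.\<close>
    define m where "m = \<lceil>R * real k\<rceil> + 1"
    define J where "J = (\<lambda>j. to_nat (i, rat_of_int j / rat_of_nat k)) ` {- m..m}"
    define N where "N = Suc (Max (insert 0 J))"
    have N: "to_nat (i, rat_of_int j / rat_of_nat k) < N" if "j \<in> {- m..m}" for j
    proof -
      have "to_nat (i, rat_of_int j / rat_of_nat k) \<in> insert 0 J" using that by (auto simp: J_def)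
      then have "to_nat (i, rat_of_int j / rat_of_nat k) \<le> Max (insert 0 J)"
        by (intro Max_ge) (auto simp: J_def)
      then show ?thesis by (simp add: N_def)
    qed
    have mem: "\<omega> \<in> A (to_nat (i, rat_of_int j / rat_of_nat k)) \<longleftrightarrow> real_of_int j / real k \<le> \<omega> i" for j \<omega>
      by (simp add: A_def of_rat_divide)
    have "\<bar>\<omega> i - \<omega>' i\<bar> \<le> e" if n: "N \<le> n" and p: "pattern A n \<omega> = pattern A n \<omega>'" and R: "\<bar>\<omega> i\<bar> < R" for n \<omega> \<omega>'
    proof -
      have iff: "real_of_int j / real k \<le> \<omega> i \<longleftrightarrow> real_of_int j / real k \<le> \<omega>' i" if "j \<in> {- m..m}" for j
        using p N[OF that] n unfolding pattern_eq_iff mem[symmetric] by auto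
      define j where "j = \<lfloor>\<omega> i * real k\<rfloor>"
      have "\<bar>\<omega> i * real k\<bar> \<le> R * real k" using R k0 by (simp add: abs_mult)
      then have j: "j \<in> {- m..m}" "j + 1 \<in> {- m..m}" unfolding j_def m_def by (simp, linarith)+
      have "real_of_int j \<le> \<omega> i * real k" "\<omega> i * real k < real_of_int (j + 1)" by (auto simp: j_def)
      then have w: "real_of_int j / real k \<le> \<omega> i" "\<not> real_of_int (j + 1) / real k \<le> \<omega> i"
        using k0 by (auto simp: field_simps)
      then have w': "real_of_int j / real k \<le> \<omega>' i" "\<not> real_of_int (j + 1) / real k \<le> \<omega>' i"
        using iff[OF j(1)] iff[OF j(2)] by auto
      have "real_of_int (j + 1) / real k = real_of_int j / real k + 1 / real k" by (simp add: add_divide_distrib)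
      then have "\<bar>\<omega> i - \<omega>' i\<bar> \<le> 1 / real k" using w w' by linarith
      then show ?thesis using k1 by linarith
    qed
    then show ?thesis by blast
  qed
  \<comment> \<open>The depth from which coordinate \<open>i\<close>, once seen below
    \<open>R\<close>, is known up to 1. All later points then stay below \<open>R + 1\<close>, and
    \<open>sep\<close> applies to them with every precision.\<close>
  define N1 where "N1 = (\<lambda>i R. SOME N. \<forall>n\<ge>N. \<forall>\<omega> \<omega>'. pattern A n \<omega> = pattern A n \<omega>' \<longrightarrow> \<bar>\<omega> i\<bar> < R \<longrightarrow> \<bar>\<omega> i - \<omega>' i\<bar> \<le> 1)"
  have N1: "\<bar>\<omega> i - \<omega>' i\<bar> \<le> 1" if "N1 i R \<le> n" "pattern A n \<omega> = pattern A n \<omega>'" "\<bar>\<omega> i\<bar> < R" for i R n \<omega> \<omega>'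
    using someI_ex[OF sep[of 1 i R, simplified]] that unfolding N1_def by blast
  have conv: "convergent (\<lambda>n. point n u i)"
    if u: "u \<in> {0..<1}" and R: "\<bar>point (N1 i R) u i\<bar> < R" for u i R
  proof (rule Cauchy_convergent, rule metric_CauchyI)
    fix e :: real assume e: "0 < e"
    obtain N where N: "\<And>n \<omega> \<omega>'. N \<le> n \<Longrightarrow> pattern A n \<omega> = pattern A n \<omega>' \<Longrightarrow> \<bar>\<omega> i\<bar> < R + 1 \<Longrightarrow> \<bar>\<omega> i - \<omega>' i\<bar> \<le> e / 2"
      using sep[of "e / 2" i "R + 1"] e by auto
    have bd: "\<bar>point n u i\<bar> < R + 1" if "N1 i R \<le> n" for n
      using N1[OF order_refl pattern_point_le[OF u order_refl that] R] R by linarith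
    have le: "\<bar>point m u i - point n u i\<bar> \<le> e / 2" if "max N (N1 i R) \<le> m" "m \<le> n" for m n
      using N[of m "point m u" "point n u"] pattern_point_le[OF u order_refl that(2)] bd[of m] that by auto
    have "dist (point m u i) (point n u i) < e" if "max N (N1 i R) \<le> m" "max N (N1 i R) \<le> n" for m n
      using le[of m n] le[of n m] that e by (cases "m \<le> n") (auto simp: dist_real_def abs_minus_commute)
    then show "\<exists>M. \<forall>m\<ge>M. \<forall>n\<ge>M. dist (point m u i) (point n u i) < e" by blast
  qed
  have AE_conv: "AE u in unit_interval. \<forall>i. convergent (\<lambda>n. point n u i)"
  proof (subst AE_all_countable, rule allI)
    fix i
    \<comment> \<open>Outside \<open>B\<close> some bound \<open>m\<close> exceeds the coordinate at
      depth \<open>N1 i m\<close>, and \<open>conv\<close> gives convergence there. Tightness makes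
      \<open>B\<close> a null set.\<close>
    define B where "B = {u \<in> space unit_interval. \<forall>m :: nat. real m \<le> \<bar>point (N1 i (real m)) u i\<bar>}"
    have [measurable]: "(\<lambda>u. point n u i) \<in> borel_measurable unit_interval" for n
      by (rule point_measurable[of "\<lambda>\<omega>. \<omega> i"])
    have B: "B \<in> sets unit_interval" unfolding B_def by measurable
    have "U.prob B \<le> e" if e: "0 < e" for e
    proof -
      obtain R where R: "0 < R" "L (indicator {\<omega>. R \<le> \<bar>\<omega> i\<bar>}) < e" using tight[OF e] by blast
      \<comment> \<open>The margin 1 absorbs the shift of the coordinate between a point and the
        representative of its cell.\<close>
      obtain m :: nat where m: "R + 1 \<le> real m" using real_arch_simple by blast
      define n where "n = N1 i (real m)"
      have "{u \<in> space unit_interval. real m \<le> \<bar>point n u i\<bar>} \<in> sets unit_interval" by measurable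
      then have "U.prob B \<le> U.prob {u \<in> space unit_interval. real m \<le> \<bar>point n u i\<bar>}"
        by (intro U.finite_measure_mono) (auto simp: B_def n_def)
      also have "{u \<in> space unit_interval. real m \<le> \<bar>point n u i\<bar>} = {u \<in> space unit_interval. point n u \<in> {\<omega>. real m \<le> \<bar>\<omega> i\<bar>}}"
        by simp
      also have "U.prob \<dots> = (\<integral>u. indicator {\<omega>. real m \<le> \<bar>\<omega> i\<bar>} (point n u) \<partial>unit_interval)"
        by (rule measure_preimage_eq_integral)
      also have "\<dots> = L (\<lambda>\<omega>. indicator {\<omega>. real m \<le> \<bar>\<omega> i\<bar>} (repr n \<omega>))" by (rule integral_point)
      also have "\<dots> \<le> L (indicator {\<omega>. R \<le> \<bar>\<omega> i\<bar>})"
      proof (rule L_mono)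
        show "(indicator {\<omega>. real m \<le> \<bar>\<omega> i\<bar>} (repr n \<omega>) :: real) \<le> indicator {\<omega>. R \<le> \<bar>\<omega> i\<bar>} \<omega>" for \<omega>
        proof (cases "\<bar>\<omega> i\<bar> < R")
          case True
          then have "\<bar>\<omega> i - repr n \<omega> i\<bar> \<le> 1"
            by (intro N1[of i "real m" n]) (use True m in \<open>auto simp: n_def pattern_repr\<close>)
          then have "\<bar>repr n \<omega> i\<bar> < real m" using True m by linarith
          then show ?thesis by simp
        qed (auto simp: indicator_def)
      qed (auto intro!: bounded_funsI[of _ 1] simp: indicator_def)
      finally show ?thesis using R by simp
    qed
    then have "U.prob B \<le> 0" by (rule field_le_epsilon[where y = 0, simplified])
    then have "U.prob B = 0" using measure_nonneg[of unit_interval B] by linarith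
    then show "AE u in unit_interval. convergent (\<lambda>n. point n u i)"
    proof (intro AE_I[of _ _ B])
      show "{u \<in> space unit_interval. \<not> convergent (\<lambda>n. point n u i)} \<subseteq> B"
        using conv[of _ i] by (auto simp: B_def not_less[symmetric])
    qed (use B in \<open>auto simp: U.emeasure_eq_measure\<close>)
  qed
  define V where "V = (\<lambda>i u. lim (\<lambda>n. point n u i))"
  have AE_lim: "AE u in unit_interval. \<forall>i. (\<lambda>n. point n u i) \<longlonglongrightarrow> V i u"
    using AE_conv by eventually_elim (auto simp: V_def convergent_LIMSEQ_iff)
  show thesis
  proof (rule that[of V])
    show V: "V i \<in> borel_measurable unit_interval" for i
      unfolding V_def by (intro borel_measurable_lim_metric point_measurable[of "\<lambda>\<omega>. \<omega> i"])
    fix k X assume X: "X \<in> cyl {..<(k::nat)}"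
    then obtain K C where KC: "\<And>\<omega>. \<bar>X \<omega>\<bar> \<le> K" "\<And>\<omega> \<omega>'. \<bar>X \<omega> - X \<omega>'\<bar> \<le> C * (\<Sum>a<k. \<bar>\<omega> a - \<omega>' a\<bar>)" "0 < K" "0 < C"
      by (rule cylE) (rule that)
    have Xb: "X \<in> bounded_funs" using X cyl_subset_bounded_funs by blast
    have Xrb: "(\<lambda>\<omega>. X (repr n \<omega>)) \<in> bounded_funs" for n by (rule bounded_funsI[of _ K]) (rule KC(1))
    have 1: "(\<lambda>n. \<integral>u. X (point n u) \<partial>unit_interval) \<longlonglongrightarrow> (\<integral>u. X (\<lambda>i. V i u) \<partial>unit_interval)"
    proof (rule integral_dominated_convergence[where w = "\<lambda>_. K"])
      show lim: "AE u in unit_interval. (\<lambda>n. X (point n u)) \<longlonglongrightarrow> X (\<lambda>i. V i u)"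
        using AE_lim by eventually_elim (auto intro: cyl_tendsto[OF X])
      show "(\<lambda>u. X (\<lambda>i. V i u)) \<in> borel_measurable unit_interval"
        by (rule cyl_measurable_compose[OF X V])
    qed (use KC point_measurable[of X] in auto)
    have 2: "(\<lambda>n. L (\<lambda>\<omega>. X (repr n \<omega>))) \<longlonglongrightarrow> L X"
    proof (rule LIMSEQ_I)
      fix r :: real assume r: "0 < r"
      \<comment> \<open>The error is \<open>C * k * e\<close> where the first \<open>k\<close>
        coordinates are bounded by the \<open>R i\<close>, and at most \<open>2 * K\<close>
        elsewhere, on sets of total mass at most \<open>k * e'\<close>. Both parts are made smaller
        than \<open>r / 2\<close>; the summand 1 keeps the denominators positive.\<close>
      define e where "e = r / (2 * (C * real k + 1))"
      have e: "0 < e" using r KC by (auto simp: e_def intro!: divide_pos_pos add_nonneg_pos)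
      define e' where "e' = r / (2 * (2 * K * real k + 1))"
      have e': "0 < e'" using r KC by (auto simp: e'_def intro!: divide_pos_pos add_nonneg_pos)
      obtain R where R: "\<And>i. L (indicator {\<omega>. R i \<le> \<bar>\<omega> i\<bar>}) < e'" using tight[OF e'] by metis
      obtain N where N: "\<And>i n \<omega> \<omega>'. N i \<le> n \<Longrightarrow> pattern A n \<omega> = pattern A n \<omega>' \<Longrightarrow> \<bar>\<omega> i\<bar> < R i \<Longrightarrow> \<bar>\<omega> i - \<omega>' i\<bar> \<le> e"
      proof -
        have "\<forall>i. \<exists>N. \<forall>n\<ge>N. \<forall>\<omega> \<omega>'. pattern A n \<omega> = pattern A n \<omega>' \<longrightarrow> \<bar>\<omega> i\<bar> < R i \<longrightarrow> \<bar>\<omega> i - \<omega>' i\<bar> \<le> e"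
          using sep[OF e] by blast
        from choice[OF this] show ?thesis using that by blast
      qed
      show "\<exists>n0. \<forall>n\<ge>n0. norm (L (\<lambda>\<omega>. X (repr n \<omega>)) - L X) < r"
      proof (intro exI allI impI)
        fix n assume n: "Max (N ` {..k}) \<le> n"
        have Nn: "N i \<le> n" if "i < k" for i
          using n that by (meson Max_ge atMost_iff finite_atMost finite_imageI imageI less_imp_le order_trans)
        define Z :: "(nat \<Rightarrow> real) \<Rightarrow> real" where "Z = (\<lambda>\<omega>. \<Sum>i<k. 2 * K * indicator {\<omega>. R i \<le> \<bar>\<omega> i\<bar>} \<omega>)"
        have Z: "Z \<in> bounded_funs" "L Z = (\<Sum>i<k. 2 * K * L (indicator {\<omega>. R i \<le> \<bar>\<omega> i\<bar>}))"
          using L_sum[of "{..<k}" "\<lambda>i \<omega>. 2 * K * indicator {\<omega>. R i \<le> \<bar>\<omega> i\<bar>} \<omega>"]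
          by (auto simp: Z_def bounded_funs_scale L_scale)
        have pt: "\<bar>X (repr n \<omega>) - X \<omega>\<bar> \<le> C * real k * e + Z \<omega>" for \<omega>
        proof (cases "\<forall>i<k. \<bar>\<omega> i\<bar> < R i")
          case True
          have "\<bar>X (repr n \<omega>) - X \<omega>\<bar> \<le> C * (\<Sum>a<k. \<bar>repr n \<omega> a - \<omega> a\<bar>)" by (rule KC)
          also have "(\<Sum>a<k. \<bar>repr n \<omega> a - \<omega> a\<bar>) \<le> (\<Sum>a<k. e)"
            using True Nn N[of _ n \<omega> "repr n \<omega>"] by (intro sum_mono) (auto simp: pattern_repr abs_minus_commute)
          finally show ?thesis using KC by (auto simp: Z_def intro!: sum_nonneg add_increasing2)
        next
          case False
          then obtain i where i: "i < k" "R i \<le> \<bar>\<omega> i\<bar>" by auto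
          have "\<bar>X (repr n \<omega>) - X \<omega>\<bar> \<le> 2 * K" using KC(1)[of "repr n \<omega>"] KC(1)[of \<omega>] by linarith
          also have "\<dots> = 2 * K * indicator {\<omega>. R i \<le> \<bar>\<omega> i\<bar>} \<omega>" using i by simp
          also have "\<dots> \<le> Z \<omega>" unfolding Z_def using i KC by (intro member_le_sum[of i]) auto
          also have "\<dots> \<le> C * real k * e + Z \<omega>" using KC e by simp
          finally show ?thesis .
        qed
        have Db: "(\<lambda>\<omega>. X (repr n \<omega>) - X \<omega>) \<in> bounded_funs"
          using bounded_funs_add[OF Xrb bounded_funs_scale[OF Xb, of "-1"]] by simp
        have cb: "(\<lambda>_ :: nat \<Rightarrow> real. c) \<in> bounded_funs" for c by (rule bounded_funsI[of _ "\<bar>c\<bar>"]) simp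
        have "\<bar>L (\<lambda>\<omega>. X (repr n \<omega>)) - L X\<bar> = \<bar>L (\<lambda>\<omega>. X (repr n \<omega>) - X \<omega>)\<bar>"
          using L_diff[OF Xrb Xb] by simp
        also have "\<dots> \<le> L (\<lambda>\<omega>. \<bar>X (repr n \<omega>) - X \<omega>\<bar>)" by (rule L_abs[OF Db])
        also have "\<dots> \<le> L (\<lambda>\<omega>. C * real k * e + Z \<omega>)"
          using Db pt Z cb by (intro L_mono bounded_funs_add) (auto simp: bounded_funs_def)
        also have "\<dots> = C * real k * e + (\<Sum>i<k. 2 * K * L (indicator {\<omega>. R i \<le> \<bar>\<omega> i\<bar>}))"
          using L_add[OF cb Z(1)] L_const Z(2) by simp
        also have "\<dots> \<le> C * real k * e + (\<Sum>i<k. 2 * K * e')"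
          using R KC by (intro add_left_mono sum_mono mult_left_mono) (auto intro: less_imp_le)
        also have "\<dots> = C * real k * e + 2 * K * real k * e'" by simp
        also have "\<dots> < r / 2 + r / 2"
        proof (rule add_strict_mono)
          have *: "x * (r / (2 * (x + 1))) < r / 2" if "0 \<le> x" for x
            using that r by (simp add: field_simps)
          show "C * real k * e < r / 2" "2 * K * real k * e' < r / 2"
            unfolding e_def e'_def using KC by (intro *; simp)+
        qed
        finally show "norm (L (\<lambda>\<omega>. X (repr n \<omega>)) - L X) < r" by simp
      qed
    qed
    show "(\<integral>u. X (\<lambda>i. V i u) \<partial>unit_interval) = L X"
      by (rule LIMSEQ_unique[OF 1]) (use 2 in \<open>simp add: integral_point\<close>)
  qed
qed

subsection \<open>Kolmogorov continuity along dyadic times\<close>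

definition dyadic_times :: "real \<Rightarrow> real set" where
  "dyadic_times T = {grid_pt T (2 ^ k) i | k i. i \<le> 2 ^ k}"

abbreviation dyadic_floor :: "real \<Rightarrow> nat \<Rightarrow> real \<Rightarrow> real" where
  "dyadic_floor T k t \<equiv> grid_pt T (2 ^ k) (grid_floor T (2 ^ k) t)"

text \<open>
  The ratio \<open>r = 9/10\<close> satisfies \<open>r\<^sup>4 > 1/2\<close>, which makes the Chebyshev bounds for fourth moments
  summable in Kolmogorov's argument.
\<close>

definition dyadic_regular :: "real \<Rightarrow> nat \<Rightarrow> (real \<Rightarrow> real) \<Rightarrow> bool" where
  "dyadic_regular T k0 v \<longleftrightarrow> (\<forall>k\<ge>k0. \<forall>i<2 ^ k.
     \<bar>v (grid_pt T (2 ^ k) (Suc i)) - v (grid_pt T (2 ^ k) i)\<bar> \<le> (9 / 10) ^ k)"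

lemma countable_dyadic_times: "countable (dyadic_times T)"
proof -
  have "dyadic_times T \<subseteq> range (\<lambda>(k, i). grid_pt T (2 ^ k) i)" by (auto simp: dyadic_times_def)
  then show ?thesis by (rule countable_subset) auto
qed

lemma dyadic_times_subset: "0 < T \<Longrightarrow> dyadic_times T \<subseteq> {0..T}"
  using grid_pt_mem by (fastforce simp: dyadic_times_def)

lemma zero_mem_dyadic_times: "0 \<in> dyadic_times T"
  unfolding dyadic_times_def by (auto intro!: exI[of _ 0] simp: grid_pt_def)

lemma dyadic_floor_mem: "0 < T \<Longrightarrow> t \<in> {0..T} \<Longrightarrow> dyadic_floor T k t \<in> dyadic_times T"
  unfolding dyadic_times_def using grid_floor_le by blast

lemma dyadic_floor_close:
  assumes "0 < T" "t \<in> {0..T}"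
  shows "\<bar>t - dyadic_floor T k t\<bar> \<le> T / 2 ^ k"
  using grid_floor_bounds[of T "2 ^ k" t] assms by auto

text \<open>Dyadic floors are nested: coarsening by \<open>d\<close> levels is integer division of
  the index by \<open>2 ^ d\<close>.\<close>

lemma grid_floor_div:
  assumes "0 < T" "0 \<le> t"
  shows "grid_floor T (2 ^ (k + d)) t div 2 ^ d = grid_floor T (2 ^ k) t"
proof -
  define x where "x = t * 2 ^ (k + d) / T"
  have "\<lfloor>x / real_of_int (2 ^ d)\<rfloor> = \<lfloor>x\<rfloor> div 2 ^ d" by (rule floor_divide_real_eq_div) simp
  moreover have "x / real_of_int (2 ^ d) = t * 2 ^ k / T" by (simp add: x_def power_add)
  ultimately have "nat (\<lfloor>x\<rfloor> div 2 ^ d) = nat \<lfloor>t * 2 ^ k / T\<rfloor>" by simp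
  moreover have "nat (\<lfloor>x\<rfloor> div 2 ^ d) = nat \<lfloor>x\<rfloor> div 2 ^ d"
    using assms by (subst nat_div_distrib) (auto simp: x_def nat_power_eq)
  ultimately show ?thesis by (simp add: grid_floor_def x_def)
qed

lemma grid_pt_double: "grid_pt T (2 ^ Suc k) (2 * i) = grid_pt T (2 ^ k) i"
  by (simp add: grid_pt_def)

text \<open>Passing to the parent changes the value by at most one regular step, or not at all for
  an even index. The steps form a geometric series with ratio 9/10, and
  \<open>(9/10) / (1 - 9/10) = 9\<close> is the constant.\<close>

lemma chain_to_ancestor:
  assumes v: "dyadic_regular T k0 v" "k0 \<le> k"
  shows "i \<le> 2 ^ (k + d) \<Longrightarrow> \<bar>v (grid_pt T (2 ^ (k + d)) i) - v (grid_pt T (2 ^ k) (i div 2 ^ d))\<bar>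
    \<le> 9 * ((9 / 10) ^ k - (9 / 10) ^ (k + d))"
proof (induction d arbitrary: i)
  case (Suc d)
  let ?j = "i div 2"
  have j: "?j \<le> 2 ^ (k + d)" using Suc.prems by simp
  have "\<bar>v (grid_pt T (2 ^ Suc (k + d)) i) - v (grid_pt T (2 ^ Suc (k + d)) (2 * ?j))\<bar> \<le> (9 / 10) ^ Suc (k + d)"
  proof (cases "even i")
    case False
    then have i: "i = Suc (2 * ?j)" by presburger
    then have "2 * ?j < 2 ^ Suc (k + d)" using Suc.prems by simp
    moreover have "k0 \<le> Suc (k + d)" using v by simp
    ultimately show ?thesis using v(1) i unfolding dyadic_regular_def by metis
  qed simp
  moreover have "\<bar>v (grid_pt T (2 ^ (k + d)) ?j) - v (grid_pt T (2 ^ k) (?j div 2 ^ d))\<bar>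
    \<le> 9 * ((9 / 10) ^ k - (9 / 10) ^ (k + d))" by (rule Suc.IH[OF j])
  moreover have "?j div 2 ^ d = i div 2 ^ Suc d" by (simp add: div_mult2_eq)
  moreover have "\<bar>a - b\<bar> \<le> 9 / 10 * q \<Longrightarrow> \<bar>b - c\<bar> \<le> 9 * (p - q) \<Longrightarrow> \<bar>a - c\<bar> \<le> 9 * (p - 9 / 10 * q)"
    for a b c p q :: real by argo
  ultimately show ?case unfolding grid_pt_double add_Suc_right power_Suc[of "9 / 10"] by metis
qed simp

text \<open>The ancestors at level \<open>k\<close> coincide or are adjacent. Two chains to them and
  one step between them give 19 = 9 + 9 + 1.\<close>

lemma chain_neighbours:
  assumes v: "dyadic_regular T k0 v" "k0 \<le> k"
    and ij: "i \<le> j" "j \<le> i + 2 ^ d" "j \<le> 2 ^ (k + d)"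
  shows "\<bar>v (grid_pt T (2 ^ (k + d)) i) - v (grid_pt T (2 ^ (k + d)) j)\<bar> \<le> 19 * (9 / 10) ^ k"
proof -
  let ?i = "i div 2 ^ d" and ?j = "j div 2 ^ d"
  have "?i \<le> ?j" using ij by (intro div_le_mono)
  moreover have "?j \<le> (i + 2 ^ d) div 2 ^ d" using ij by (intro div_le_mono)
  moreover have "(i + 2 ^ d) div 2 ^ d = Suc ?i" by simp
  moreover have "?j \<le> 2 ^ k"
  proof -
    have "?j \<le> 2 ^ (k + d) div 2 ^ d" using ij by (intro div_le_mono)
    then show ?thesis by (simp add: power_add)
  qed
  ultimately have "?j = ?i \<or> (?j = Suc ?i \<and> ?i < 2 ^ k)" by linarith
  then have "\<bar>v (grid_pt T (2 ^ k) ?i) - v (grid_pt T (2 ^ k) ?j)\<bar> \<le> (9 / 10) ^ k"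
    using v unfolding dyadic_regular_def by (auto simp: abs_minus_commute)
  moreover have "\<bar>v (grid_pt T (2 ^ (k + d)) i) - v (grid_pt T (2 ^ k) ?i)\<bar> \<le> 9 * ((9 / 10) ^ k - (9 / 10) ^ (k + d))"
    "\<bar>v (grid_pt T (2 ^ (k + d)) j) - v (grid_pt T (2 ^ k) ?j)\<bar> \<le> 9 * ((9 / 10) ^ k - (9 / 10) ^ (k + d))"
    using ij by (intro chain_to_ancestor[OF v]; simp)+
  moreover have "(0 :: real) \<le> (9 / 10) ^ (k + d)" by simp
  ultimately show ?thesis by argo
qed

lemma grid_floor_mono: "0 < T \<Longrightarrow> s \<le> t \<Longrightarrow> grid_floor T N s \<le> grid_floor T N t"
  unfolding grid_floor_def by (intro nat_mono floor_mono divide_right_mono mult_right_mono) auto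

text \<open>Times at distance at most \<open>T / 2 ^ m\<close> have indices at level
  \<open>m + d\<close> that differ by at most \<open>2 ^ d\<close>, which is what
  \<open>chain_neighbours\<close> needs.\<close>

lemma dyadic_regular_floor_close:
  assumes T: "0 < T" and v: "dyadic_regular T k0 v" "k0 \<le> m" "m \<le> n"
    and st: "s \<in> {0..T}" "t \<in> {0..T}" "\<bar>s - t\<bar> \<le> T / 2 ^ m"
  shows "\<bar>v (dyadic_floor T n s) - v (dyadic_floor T n t)\<bar> \<le> 19 * (9 / 10) ^ m"
proof -
  obtain d where n: "n = m + d" using v(3) le_Suc_ex by blast
  have *: "\<bar>v (dyadic_floor T n s) - v (dyadic_floor T n t)\<bar> \<le> 19 * (9 / 10) ^ m"
    if "s \<in> {0..T}" "t \<in> {0..T}" "s \<le> t" "t \<le> s + T / 2 ^ m" for s t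
    unfolding n
  proof (rule chain_neighbours[OF v(1,2)])
    show "grid_floor T (2 ^ (m + d)) s \<le> grid_floor T (2 ^ (m + d)) t" using grid_floor_mono T that by auto
    show "grid_floor T (2 ^ (m + d)) t \<le> 2 ^ (m + d)" using grid_floor_le T that by auto
    have "t * real (2 ^ (m + d)) / T \<le> (s + T / 2 ^ m) * real (2 ^ (m + d)) / T"
      using T that by (intro divide_right_mono mult_right_mono) auto
    also have "\<dots> = s * real (2 ^ (m + d)) / T + 2 ^ d" using T by (simp add: power_add field_simps)
    finally have "\<lfloor>t * real (2 ^ (m + d)) / T\<rfloor> \<le> \<lfloor>s * real (2 ^ (m + d)) / T + real_of_int (2 ^ d)\<rfloor>"
      by (intro floor_mono) simp
    also have "\<dots> = \<lfloor>s * real (2 ^ (m + d)) / T\<rfloor> + 2 ^ d" by (simp add: floor_add_int[symmetric] del: of_int_power)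
    finally have "\<lfloor>t * real (2 ^ (m + d)) / T\<rfloor> \<le> \<lfloor>s * real (2 ^ (m + d)) / T\<rfloor> + 2 ^ d" .
    moreover have "0 \<le> \<lfloor>s * real (2 ^ (m + d)) / T\<rfloor>" using T that by simp
    moreover have "nat (2 ^ d) = 2 ^ d" by (simp add: nat_power_eq)
    ultimately show "grid_floor T (2 ^ (m + d)) t \<le> grid_floor T (2 ^ (m + d)) s + 2 ^ d"
      unfolding grid_floor_def by (metis nat_add_distrib nat_mono zero_le_numeral zero_le_power)
  qed
  show ?thesis
  proof (cases "s \<le> t")
    case True
    then show ?thesis using *[OF st(1,2) True] st(3) by auto
  next
    case False
    then show ?thesis using *[OF st(2,1)] st(3) by (auto simp: abs_minus_commute)
  qed
qed

lemma power_9_10_tendsto: "(\<lambda>m. c * (9 / 10 :: real) ^ m) \<longlonglongrightarrow> 0"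
  using tendsto_mult_left[OF LIMSEQ_realpow_zero[of "9 / 10 :: real"], of c] by simp

lemma power_9_10_small: "0 < e \<Longrightarrow> \<exists>m\<ge>m0. c * (9 / 10 :: real) ^ m < e"
proof -
  assume "0 < e"
  then have "\<forall>\<^sub>F m in sequentially. c * (9 / 10 :: real) ^ m < e"
    by (rule order_tendstoD(2)[OF power_9_10_tendsto])
  then have "\<forall>\<^sub>F m in sequentially. m0 \<le> m \<and> c * (9 / 10 :: real) ^ m < e"
    by (intro eventually_conj eventually_ge_at_top)
  then show ?thesis using eventually_happens' sequentially_bot by fastforce
qed

lemma dyadic_regular_convergent:
  assumes T: "0 < T" and v: "dyadic_regular T k0 v" and t: "t \<in> {0..T}"
  shows "convergent (\<lambda>k. v (dyadic_floor T k t))"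
proof (rule Cauchy_convergent, rule metric_CauchyI)
  fix e :: real assume "0 < e"
  \<comment> \<open>18 is twice 9: both indices are compared with level \<open>m\<close>.\<close>
  then obtain m where m: "m \<ge> k0" "18 * (9 / 10 :: real) ^ m < e" using power_9_10_small by blast
  have le: "\<bar>v (dyadic_floor T n t) - v (dyadic_floor T m t)\<bar> \<le> 9 * (9 / 10) ^ m" if "m \<le> n" for n
  proof -
    obtain d where n: "n = m + d" using \<open>m \<le> n\<close> le_Suc_ex by blast
    have "grid_floor T (2 ^ (m + d)) t \<le> 2 ^ (m + d)" using grid_floor_le T t by auto
    from chain_to_ancestor[OF v m(1) this] have
      "\<bar>v (dyadic_floor T n t) - v (dyadic_floor T m t)\<bar> \<le> 9 * ((9 / 10) ^ m - (9 / 10) ^ (m + d))"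
      using T t by (simp add: grid_floor_div n)
    moreover have "(0 :: real) \<le> (9 / 10) ^ (m + d)" by simp
    ultimately show ?thesis by argo
  qed
  have "dist (v (dyadic_floor T n t)) (v (dyadic_floor T n' t)) < e" if "m \<le> n" "m \<le> n'" for n n'
    using le[OF that(1)] le[OF that(2)] m(2) by (simp add: dist_real_def)
  then show "\<exists>M. \<forall>m\<ge>M. \<forall>n\<ge>M. dist (v (dyadic_floor T m t)) (v (dyadic_floor T n t)) < e" by blast
qed

lemma dyadic_limit_modulus:
  assumes T: "0 < T" and v: "dyadic_regular T k0 v" "k0 \<le> m"
    and lim: "\<And>t. t \<in> {0..T} \<Longrightarrow> (\<lambda>k. v (dyadic_floor T k t)) \<longlonglongrightarrow> x t"
  shows "path_modulus T (2 ^ m) (19 * (9 / 10) ^ m) x"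
  unfolding path_modulus_def
proof (intro ballI impI)
  fix s t assume st: "s \<in> {0..T}" "t \<in> {0..T}" "\<bar>s - t\<bar> \<le> T / real (2 ^ m)"
  have "(\<lambda>k. \<bar>v (dyadic_floor T k s) - v (dyadic_floor T k t)\<bar>) \<longlonglongrightarrow> \<bar>x s - x t\<bar>"
    by (intro tendsto_intros lim st)
  then show "\<bar>x s - x t\<bar> \<le> 19 * (9 / 10) ^ m"
    by (rule LIMSEQ_le_const2) (use dyadic_regular_floor_close[OF T v _ st(1,2)] st(3) in auto)
qed

lemma dyadic_floor_tendsto: "0 < T \<Longrightarrow> 0 \<le> t \<Longrightarrow> (\<lambda>k. dyadic_floor T k t) \<longlonglongrightarrow> t"
proof (rule grid_pt_floor_tendsto)
  show "filterlim (\<lambda>k. 2 ^ k :: nat) sequentially sequentially"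
    by (rule filterlim_subseq) (simp add: strict_mono_def)
qed

lemma path_dyadic_tendsto:
  assumes "0 < T" "\<omega> \<in> path_space T" "t \<in> {0..T}"
  shows "(\<lambda>k. \<omega> (dyadic_floor T k t)) \<longlonglongrightarrow> \<omega> t"
proof (rule continuous_on_tendsto_compose[of "{0..T}" \<omega>])
  show "\<forall>\<^sub>F k in sequentially. dyadic_floor T k t \<in> {0..T}"
    using dyadic_floor_mem[OF assms(1,3)] dyadic_times_subset[OF assms(1)] by (intro always_eventually) blast
qed (use assms dyadic_floor_tendsto in \<open>auto simp: path_space_iff\<close>)

lemma path_modulus_continuous:
  assumes T: "0 < T" and mod: "\<And>m. k0 \<le> m \<Longrightarrow> path_modulus T (2 ^ m) (19 * (9 / 10) ^ m) x"
  shows "continuous_on {0..T} x"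
  unfolding continuous_on_iff
proof (intro ballI allI impI)
  fix t e assume t: "t \<in> {0..T}" and e: "0 < (e :: real)"
  obtain m where m: "m \<ge> k0" "19 * (9 / 10 :: real) ^ m < e" using power_9_10_small e by blast
  have "dist (x s) (x t) < e" if "s \<in> {0..T}" "dist s t < T / 2 ^ m" for s
    using mod[OF m(1)] that t m(2) unfolding path_modulus_def dist_real_def by fastforce
  then show "\<exists>d>0. \<forall>x'\<in>{0..T}. dist x' t < d \<longrightarrow> dist (x x') (x t) < e"
    using T by (intro exI[of _ "T / 2 ^ m"]) auto
qed

text \<open>Truncating at the threshold \<open>d\<close> itself costs nothing in Chebyshev's
  inequality, since the truncated variable equals \<open>d\<close> on the event.\<close>

lemma (in prob_space) prob_greater_le_fourth_moment:
  assumes [measurable]: "X \<in> borel_measurable M" and d: "0 < d"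
    and le: "(\<integral>u. min \<bar>X u\<bar> d ^ 4 \<partial>M) \<le> B"
  shows "prob {u \<in> space M. d < \<bar>X u\<bar>} \<le> B / d ^ 4"
proof -
  have int: "integrable M (\<lambda>u. min \<bar>X u\<bar> d ^ 4)"
    by (rule integrable_const_bound[of _ "d ^ 4"]) (use d in \<open>auto intro!: AE_I2 power_mono simp: abs_le_iff\<close>)
  define S where "S = {u \<in> space M. d < \<bar>X u\<bar>}"
  have S: "S \<in> sets M" "S \<inter> space M = S" unfolding S_def by measurable
  have "d ^ 4 * prob S = (\<integral>u. d ^ 4 * indicator S u \<partial>M)" using S(2) by simp
  also have "\<dots> \<le> (\<integral>u. min \<bar>X u\<bar> d ^ 4 \<partial>M)"
  proof (rule integral_mono[OF _ int])
    show "integrable M (\<lambda>u. d ^ 4 * indicator S u)"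
      using S(1) by (intro integrable_mult_right integrable_real_indicator) (auto simp: emeasure_eq_measure)
    show "d ^ 4 * indicator S u \<le> min \<bar>X u\<bar> d ^ 4" for u
      using d by (auto simp: indicator_def S_def min_def)
  qed
  finally have "d ^ 4 * prob S \<le> B" using le by linarith
  then show ?thesis using d by (simp add: field_simps S_def)
qed

text \<open>The constant is \<open>5000/6561 = 1/(2 r\<^sup>4)\<close> for \<open>r = 9/10\<close>.\<close>

lemma (in prob_space) prob_dyadic_irregular:
  fixes V :: "real \<Rightarrow> 'a \<Rightarrow> real"
  assumes T: "0 < T" and C: "0 \<le> C"
    and meas: "\<And>t. t \<in> dyadic_times T \<Longrightarrow> V t \<in> borel_measurable M"
    and mom: "\<And>s t k. s \<in> dyadic_times T \<Longrightarrow> t \<in> dyadic_times T \<Longrightarrow> 0 \<le> k \<Longrightarrow>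
      (\<integral>u. min \<bar>V t u - V s u\<bar> k ^ 4 \<partial>M) \<le> C * (t - s)\<^sup>2"
  shows "{u \<in> space M. dyadic_regular T k0 (\<lambda>t. V t u)} \<in> sets M"
    and "prob {u \<in> space M. \<not> dyadic_regular T k0 (\<lambda>t. V t u)} \<le> C * T\<^sup>2 * (6561 / 1561) * (5000 / 6561) ^ k0"
proof -
  let ?D = "\<lambda>k i u. \<bar>V (grid_pt T (2 ^ k) (Suc i)) u - V (grid_pt T (2 ^ k) i) u\<bar>"
  have mem: "grid_pt T (2 ^ k) i \<in> dyadic_times T" if "i \<le> 2 ^ k" for k i
    using that by (auto simp: dyadic_times_def)
  have D: "?D k i \<in> borel_measurable M" if "i < 2 ^ k" for k i by (intro borel_measurable_abs borel_measurable_diff meas mem) (use that in auto)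
  define A where "A = (\<lambda>k i. {u \<in> space M. (9 / 10) ^ k < ?D k i u})"
  have A: "A k i \<in> sets M" if "i < 2 ^ k" for k i
    using D[OF that] unfolding A_def by measurable
  have PA: "prob (A k i) \<le> C * (T / 2 ^ k)\<^sup>2 / ((9 / 10) ^ k) ^ 4" if i: "i < 2 ^ k" for k i
    unfolding A_def
  proof (rule prob_greater_le_fourth_moment)
    have "grid_pt T (2 ^ k) (Suc i) - grid_pt T (2 ^ k) i = T / 2 ^ k"
      by (simp add: grid_pt_def diff_divide_distrib[symmetric] algebra_simps)
    then show "(\<integral>u. min \<bar>V (grid_pt T (2 ^ k) (Suc i)) u - V (grid_pt T (2 ^ k) i) u\<bar> ((9 / 10) ^ k) ^ 4 \<partial>M) \<le> C * (T / 2 ^ k)\<^sup>2"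
      using mom[OF mem[of i k] mem[of "Suc i" k], of "(9 / 10) ^ k"] i by simp
  qed (use i in \<open>auto intro!: borel_measurable_diff meas mem\<close>)
  define B where "B = (\<lambda>k. \<Union>i<2 ^ k. A k i)"
  have B: "B k \<in> sets M" for k unfolding B_def using A by (intro sets.finite_UN) auto
  \<comment> \<open>There are \<open>2 ^ k\<close> steps, each failing with probability at most
    \<open>C * (T / 2 ^ k)\<^sup>2 / (9 / 10) ^ (4 * k)\<close>; together they give a geometric
    sequence of ratio \<open>2 / (4 * (9 / 10) ^ 4)\<close>, which is below 1.\<close>
  have PB: "prob (B k) \<le> C * T\<^sup>2 * (5000 / 6561) ^ k" for k
  proof -
    have "prob (B k) \<le> (\<Sum>i<2 ^ k. prob (A k i))"
      unfolding B_def using A by (intro finite_measure_subadditive_finite) auto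
    also have "\<dots> \<le> (\<Sum>i<(2 ^ k :: nat). C * (T / 2 ^ k)\<^sup>2 / ((9 / 10) ^ k) ^ 4)"
      using PA by (intro sum_mono) auto
    also have "\<dots> = C * T\<^sup>2 * (2 ^ k / ((2 ^ k)\<^sup>2 * ((9 / 10) ^ k) ^ 4))" by (simp add: power_divide)
    also have "2 ^ k / ((2 ^ k)\<^sup>2 * ((9 / 10) ^ k) ^ 4) = (2 / (2\<^sup>2 * (9 / 10) ^ 4) :: real) ^ k"
      unfolding power_divide power_mult_distrib by (simp only: power_mult[symmetric] mult.commute)
    also have "2 / (2\<^sup>2 * (9 / 10) ^ 4) = (5000 / 6561 :: real)" by (simp add: power_divide)
    finally show ?thesis .
  qed
  have eq: "{u \<in> space M. \<not> dyadic_regular T k0 (\<lambda>t. V t u)} = (\<Union>k. B (k0 + k))"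
    unfolding dyadic_regular_def B_def A_def by (auto simp: not_le dest!: le_Suc_ex) (use le_add1 in blast)
  have "(\<Union>k. B (k0 + k)) \<in> sets M" using B by auto
  moreover have "{u \<in> space M. dyadic_regular T k0 (\<lambda>t. V t u)} = space M - (\<Union>k. B (k0 + k))"
    using eq by blast
  ultimately show "{u \<in> space M. dyadic_regular T k0 (\<lambda>t. V t u)} \<in> sets M" by auto
  \<comment> \<open>The geometric tail from \<open>k0\<close> on contributes the factor
    \<open>1 / (1 - 5000 / 6561) = 6561 / 1561\<close>.\<close>
  have sums: "(\<lambda>k. C * T\<^sup>2 * (5000 / 6561) ^ k0 * (5000 / 6561) ^ k) sums (C * T\<^sup>2 * (5000 / 6561) ^ k0 * (1 / (1 - 5000 / 6561)))"
    by (intro sums_mult geometric_sums) auto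
  have le: "prob (B (k0 + k)) \<le> C * T\<^sup>2 * (5000 / 6561) ^ k0 * (5000 / 6561) ^ k" for k
    using PB[of "k0 + k"] by (simp add: power_add mult.assoc)
  have summ: "summable (\<lambda>k. prob (B (k0 + k)))"
    by (rule summable_comparison_test'[OF sums_summable[OF sums], of 0]) (use le in auto)
  have "prob (\<Union>k. B (k0 + k)) \<le> (\<Sum>k. prob (B (k0 + k)))"
    using B summ by (intro finite_measure_subadditive_countably) auto
  also have "\<dots> \<le> C * T\<^sup>2 * (5000 / 6561) ^ k0 * (1 / (1 - 5000 / 6561))"
    using suminf_le[OF le summ sums_summable[OF sums]] sums_unique[OF sums] by simp
  also have "\<dots> = C * T\<^sup>2 * (6561 / 1561) * (5000 / 6561) ^ k0" by simp
  finally show "prob {u \<in> space M. \<not> dyadic_regular T k0 (\<lambda>t. V t u)} \<le> C * T\<^sup>2 * (6561 / 1561) * (5000 / 6561) ^ k0"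
    unfolding eq .
qed

lemma geometric_bound_small:
  fixes C :: real
  assumes "0 < e"
  shows "\<exists>k0. C * (5000 / 6561) ^ k0 < e"
proof -
  have "(\<lambda>k0. C * (5000 / 6561 :: real) ^ k0) \<longlonglongrightarrow> 0"
    using tendsto_mult_left[OF LIMSEQ_realpow_zero[of "5000 / 6561 :: real"], of C] by simp
  from order_tendstoD(2)[OF this assms] show ?thesis by (auto simp: eventually_sequentially)
qed

subsection \<open>Representing measures\<close>

lemma path_probs_distr:
  assumes "prob_space N" "f \<in> measurable N (path_borel T)"
  shows "distr N (path_borel T) f \<in> path_probs T"
  using prob_space.prob_space_distr[OF assms] by (simp add: path_probs_def)

lemma Lip_measurable: "0 < T \<Longrightarrow> X \<in> Lip T \<Longrightarrow> X \<in> borel_measurable (path_borel T)"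
  by (erule Lip_lipschitz, assumption) (rule path_lipschitz_measurable)

text \<open>Since \<open>f\<close> may identify indices, one coordinate may be counted up to
  \<open>card A\<close> times; this factor enters the Lipschitz constant.\<close>

lemma cyl_reindex:
  assumes "finite A" "X \<in> cyl A"
  shows "(\<lambda>\<omega>. X (\<lambda>t. \<omega> (f t))) \<in> cyl (f ` A)"
proof -
  obtain K C where KC: "\<And>\<omega>. \<bar>X \<omega>\<bar> \<le> K" "\<And>\<omega> \<omega>'. \<bar>X \<omega> - X \<omega>'\<bar> \<le> C * (\<Sum>a\<in>A. \<bar>\<omega> a - \<omega>' a\<bar>)" "0 < K" "0 < C"
    using assms(2) by (rule cylE) (rule that)
  show ?thesis
  proof (rule cylI[OF KC(1)])
    fix \<omega> \<omega>' :: "'b \<Rightarrow> real"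
    have "(\<Sum>a\<in>A. \<bar>\<omega> (f a) - \<omega>' (f a)\<bar>) \<le> (\<Sum>a\<in>A. \<Sum>b\<in>f ` A. \<bar>\<omega> b - \<omega>' b\<bar>)"
      using assms(1) by (intro sum_mono member_le_sum[of "f _" "f ` A" "\<lambda>b. \<bar>\<omega> b - \<omega>' b\<bar>"]) auto
    then have "C * (\<Sum>a\<in>A. \<bar>\<omega> (f a) - \<omega>' (f a)\<bar>) \<le> C * (\<Sum>a\<in>A. \<Sum>b\<in>f ` A. \<bar>\<omega> b - \<omega>' b\<bar>)"
      using KC by simp
    then show "\<bar>X (\<lambda>t. \<omega> (f t)) - X (\<lambda>t. \<omega>' (f t))\<bar> \<le> C * real (card A) * (\<Sum>a\<in>f ` A. \<bar>\<omega> a - \<omega>' a\<bar>)"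
      using KC(2)[of "\<lambda>t. \<omega> (f t)" "\<lambda>t. \<omega>' (f t)"] by (simp add: mult.assoc)
  qed
qed

text \<open>The image of the finitely additive law under the map that reads off the values at the
  indices \<open>d n\<close>.\<close>

lemma functional_reindex:
  assumes "positive_functional L"
  shows "positive_functional (\<lambda>X :: ('b \<Rightarrow> real) \<Rightarrow> real. L (\<lambda>\<omega> :: 'a \<Rightarrow> real. X (\<lambda>n. \<omega> (d n))))"
proof -
  interpret positive_functional L by fact
  have b: "(\<lambda>\<omega>. X (\<lambda>n. \<omega> (d n))) \<in> bounded_funs" if "X \<in> bounded_funs" for X :: "('b \<Rightarrow> real) \<Rightarrow> real"
    using that by (auto simp: bounded_funs_def)
  show ?thesis
    by unfold_locales (use b in \<open>auto intro: L_add L_scale L_nonneg L_one\<close>)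
qed

context lip_expectation
begin

abbreviation "\<P> \<equiv> Lip_dominated T E"

text \<open>Markov's inequality for the fourth power truncated at \<open>R\<close>, which is a
  cylinder function and so within reach of the bound on \<open>E\<close>.\<close>

lemma functional_tight:
  assumes L: "positive_functional L" and LE: "\<And>X. X \<in> Lip T \<Longrightarrow> L X \<le> E X"
    and t: "t \<in> {0..T}" and e: "0 < e"
  shows "\<exists>R>0. L (indicator {\<omega>. R \<le> \<bar>\<omega> t\<bar>}) < e"
proof -
  interpret positive_functional L by fact
  have T0: "0 \<le> T" using T_pos by simp
  \<comment> \<open>\<open>R \<ge> 1\<close> gives \<open>R \<le> R ^ 4\<close>, so a choice that
    beats the bound linearly in \<open>R\<close> suffices.\<close>
  define R where "R = max 1 (M * T\<^sup>2 / e + 1)"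
  have R: "1 \<le> R" "M * T\<^sup>2 / e < R" by (auto simp: R_def)
  have mem: "(\<lambda>\<omega>. min \<bar>\<omega> t\<bar> R ^ 4) \<in> cyl {t}" by (rule cyl_min_power4) (use R in auto)
  then have Lip: "(\<lambda>\<omega>. min \<bar>\<omega> t\<bar> R ^ 4) \<in> Lip T" by (rule cyl_subset_Lip[rotated 3]) (use t T0 in auto)
  have "R ^ 4 * L (indicator {\<omega>. R \<le> \<bar>\<omega> t\<bar>}) = L (\<lambda>\<omega>. R ^ 4 * indicator {\<omega>. R \<le> \<bar>\<omega> t\<bar>} \<omega>)"
    by (rule L_scale[symmetric]) (rule bounded_funsI[of _ 1], simp add: indicator_def)
  also have "\<dots> \<le> L (\<lambda>\<omega>. min \<bar>\<omega> t\<bar> R ^ 4)"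
  proof (rule L_mono)
    show "(\<lambda>\<omega>. min \<bar>\<omega> t\<bar> R ^ 4) \<in> bounded_funs" using mem cyl_subset_bounded_funs by blast
    show "(\<lambda>\<omega>. R ^ 4 * indicator {\<omega>. R \<le> \<bar>\<omega> t\<bar>} \<omega>) \<in> bounded_funs"
      by (rule bounded_funs_scale) (rule bounded_funsI[of _ 1], simp add: indicator_def)
    show "R ^ 4 * indicator {\<omega>. R \<le> \<bar>\<omega> t\<bar>} \<omega> \<le> min \<bar>\<omega> t\<bar> R ^ 4" for \<omega>
      using R by (auto simp: indicator_def min_def)
  qed
  also have "\<dots> \<le> M * t\<^sup>2" using LE[OF Lip] E_coord[OF t, of R] R by simp
  also have "\<dots> \<le> M * T\<^sup>2" using t M_nonneg by (intro mult_left_mono power_mono) auto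
  also have "\<dots> < e * R" using R e by (simp add: field_simps)
  also have "\<dots> \<le> e * R ^ 4" using R e by (intro mult_left_mono self_le_power) auto
  finally show ?thesis using R by (intro exI[of _ R]) (auto simp: mult.commute)
qed

text \<open>Enumerating the countable set of dyadic times turns the law on paths into one on
  sequences, to which \<open>functional_realised\<close> applies.\<close>

lemma dyadic_process:
  assumes L: "positive_functional L" and LE: "\<And>X. X \<in> Lip T \<Longrightarrow> L X \<le> E X"
  obtains V :: "real \<Rightarrow> real \<Rightarrow> real" where "\<And>t. V t \<in> borel_measurable unit_interval"
    "\<And>A X. finite A \<Longrightarrow> A \<subseteq> dyadic_times T \<Longrightarrow> X \<in> cyl A \<Longrightarrow> (\<integral>u. X (\<lambda>t. V t u) \<partial>unit_interval) = L X"
proof -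
  define d where "d = from_nat_into (dyadic_times T)"
  define idx where "idx = to_nat_on (dyadic_times T)"
  have dm: "d n \<in> dyadic_times T" for n unfolding d_def using zero_mem_dyadic_times by (intro from_nat_into) auto
  have di: "d (idx t) = t" if "t \<in> dyadic_times T" for t
    unfolding d_def idx_def using countable_dyadic_times that by simp
  have inj: "inj_on idx (dyadic_times T)" unfolding idx_def by (rule inj_on_to_nat_on) (rule countable_dyadic_times)
  have tight: "\<exists>R>0. L (\<lambda>\<omega>. indicator {\<omega>. R \<le> \<bar>\<omega> i\<bar>} (\<lambda>n. \<omega> (d n))) < e" if "0 < e" for i e
  proof -
    have "(\<lambda>\<omega> :: real \<Rightarrow> real. indicator {\<omega>. R \<le> \<bar>\<omega> i\<bar>} (\<lambda>n. \<omega> (d n)) :: real) = indicator {\<omega>. R \<le> \<bar>\<omega> (d i)\<bar>}" for R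
      by (auto simp: indicator_def)
    moreover have "d i \<in> {0..T}" using dm dyadic_times_subset[OF T_pos] by blast
    ultimately show ?thesis using functional_tight[OF L LE _ that] by simp
  qed
  obtain V where V: "\<And>i. V i \<in> borel_measurable unit_interval"
    "\<And>k X. X \<in> cyl {..<k} \<Longrightarrow> (\<integral>u. X (\<lambda>i. V i u) \<partial>unit_interval) = L (\<lambda>\<omega>. X (\<lambda>n. \<omega> (d n)))"
    using functional_realised[OF functional_reindex[OF L, of d] tight] by blast
  show thesis
  proof (rule that[of "\<lambda>t. V (idx t)"])
    show "V (idx t) \<in> borel_measurable unit_interval" for t by (rule V)
    fix A and X :: "(real \<Rightarrow> real) \<Rightarrow> real" assume A: "finite A" "A \<subseteq> dyadic_times T" "X \<in> cyl A"
    obtain K C where KC: "\<And>\<omega>. \<bar>X \<omega>\<bar> \<le> K" "\<And>\<omega> \<omega>'. \<bar>X \<omega> - X \<omega>'\<bar> \<le> C * (\<Sum>a\<in>A. \<bar>\<omega> a - \<omega>' a\<bar>)" "0 < K" "0 < C"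
      using A(3) by (rule cylE) (rule that)
    obtain k where k: "idx ` A \<subseteq> {..<k}" using A(1) finite_nat_iff_bounded[of "idx ` A"] by blast
    have "(\<lambda>x. X (\<lambda>t. x (idx t))) \<in> cyl {..<k}"
    proof (rule cylI[OF KC(1)])
      fix x y :: "nat \<Rightarrow> real"
      have "(\<Sum>a\<in>A. \<bar>x (idx a) - y (idx a)\<bar>) = (\<Sum>i\<in>idx ` A. \<bar>x i - y i\<bar>)"
        using inj_on_subset[OF inj A(2)] by (simp add: sum.reindex)
      also have "\<dots> \<le> (\<Sum>i<k. \<bar>x i - y i\<bar>)" using k by (intro sum_mono2) auto
      finally have "C * (\<Sum>a\<in>A. \<bar>x (idx a) - y (idx a)\<bar>) \<le> C * (\<Sum>i<k. \<bar>x i - y i\<bar>)"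
        using KC by simp
      then show "\<bar>X (\<lambda>t. x (idx t)) - X (\<lambda>t. y (idx t))\<bar> \<le> C * (\<Sum>i<k. \<bar>x i - y i\<bar>)"
        by (rule order_trans[OF KC(2)])
    qed
    from V(2)[OF this] have "(\<integral>u. X (\<lambda>t. V (idx t) u) \<partial>unit_interval) = L (\<lambda>\<omega>. X (\<lambda>t. \<omega> (d (idx t))))" .
    also have "(\<lambda>\<omega>. X (\<lambda>t. \<omega> (d (idx t)))) = X"
      by (intro ext cyl_cong[OF A(3)]) (use A(2) di in auto)
    finally show "(\<integral>u. X (\<lambda>t. V (idx t) u) \<partial>unit_interval) = L X" .
  qed
qed

text \<open>The realised process knows \<open>L\<close> only at dyadic times, and \<open>L\<close>
  has no continuity to pass to other times. The moment bound on increments replaces it: all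
  coordinates move by less than \<open>\<delta>\<close> except on a set whose mass is controlled by
  truncated fourth moments.\<close>

lemma functional_dyadic_approx:
  assumes L: "positive_functional L" and LE: "\<And>X. X \<in> Lip T \<Longrightarrow> L X \<le> E X"
    and A: "finite A" "A \<subseteq> {0..T}" and X: "X \<in> cyl A"
  shows "(\<lambda>k. L (\<lambda>\<omega>. X (\<lambda>t. \<omega> (dyadic_floor T k t)))) \<longlonglongrightarrow> L X"
proof (rule LIMSEQ_I)
  interpret positive_functional L by fact
  have T0: "0 \<le> T" using T_pos by simp
  fix r :: real assume r: "0 < r"
  obtain K C where KC: "\<And>\<omega>. \<bar>X \<omega>\<bar> \<le> K" "\<And>\<omega> \<omega>'. \<bar>X \<omega> - X \<omega>'\<bar> \<le> C * (\<Sum>a\<in>A. \<bar>\<omega> a - \<omega>' a\<bar>)" "0 < K" "0 < C"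
    using X by (rule cylE) (rule that)
  define n where "n = real (card A)"
  have n: "0 \<le> n" by (simp add: n_def)
  define \<delta> where "\<delta> = r / (2 * (C * n + 1))"
  have \<delta>: "0 < \<delta>" using r KC n by (auto simp: \<delta>_def intro!: divide_pos_pos add_nonneg_pos)
  have \<delta>2: "C * n * \<delta> < r / 2"
  proof -
    have "x * (r / (2 * (x + 1))) < r / 2" if "0 \<le> x" for x
      using that r by (simp add: field_simps)
    then show ?thesis unfolding \<delta>_def using KC n by simp
  qed
  \<comment> \<open>Chosen so that \<open>c * \<delta> ^ 4 = 2 * K\<close>, the trivial bound for a
    difference of two values of \<open>X\<close>. A single increment of size at least
    \<open>\<delta>\<close> is then already paid for by \<open>Z\<close>.\<close>
  define c where "c = 2 * K / \<delta> ^ 4"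
  have c0: "0 \<le> c" using KC \<delta> by (simp add: c_def)
  define B where "B = c * (n * (M * T\<^sup>2))"
  have "(\<lambda>k. B * (1 / 4) ^ k) \<longlonglongrightarrow> B * 0"
    by (intro tendsto_intros LIMSEQ_realpow_zero) auto
  then have "\<forall>\<^sub>F k in sequentially. B * (1 / 4) ^ k < r / 2"
    using r by (intro order_tendstoD(2)) auto
  then obtain k0 where k0: "\<And>k. k \<ge> k0 \<Longrightarrow> B * (1 / 4) ^ k < r / 2" by (auto simp: eventually_sequentially)
  show "\<exists>no. \<forall>k\<ge>no. norm (L (\<lambda>\<omega>. X (\<lambda>t. \<omega> (dyadic_floor T k t))) - L X) < r"
  proof (intro exI allI impI)
    fix k assume k: "k \<ge> k0"
    let ?f = "dyadic_floor T k"
    let ?Xk = "\<lambda>\<omega>. X (\<lambda>t. \<omega> (?f t))"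
    let ?m = "\<lambda>a (\<omega> :: real \<Rightarrow> real). min \<bar>\<omega> a - \<omega> (?f a)\<bar> \<delta> ^ 4"
    have fa: "?f a \<in> {0..T}" if "a \<in> A" for a using dyadic_floor_mem[OF T_pos] dyadic_times_subset[OF T_pos] A that by blast
    have b: "X \<in> bounded_funs" "?Xk \<in> bounded_funs" using KC(1) by (auto intro: bounded_funsI)
    have mc: "?m a \<in> cyl {?f a, a}" for a by (rule cyl_min_power4) (use \<delta> in auto)
    have mb: "?m a \<in> bounded_funs" for a using mc cyl_subset_bounded_funs by blast
    have Lm: "L (?m a) \<le> M * (T\<^sup>2 * (1 / 4) ^ k)" if a: "a \<in> A" for a
    proof -
      have "?m a \<in> Lip T" by (rule cyl_subset_Lip[OF _ _ T0 mc]) (use fa[OF a] a A in auto)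
      then have "L (?m a) \<le> M * (a - ?f a)\<^sup>2"
        using LE E_incr[of "?f a" a \<delta>] fa[OF a] a A \<delta> by fastforce
      also have "\<dots> \<le> M * (T / 2 ^ k)\<^sup>2"
        using dyadic_floor_close[OF T_pos, of a k] a A M_nonneg T0
        by (intro mult_left_mono) (auto simp: abs_le_square_iff[symmetric])
      also have "(T / 2 ^ k)\<^sup>2 = T\<^sup>2 * (1 / 4) ^ k"
        by (simp add: power_divide power_mult[symmetric] mult.commute[of _ 2]) (simp add: power_mult)
      finally show ?thesis .
    qed
    define Z where "Z = (\<lambda>\<omega>. \<Sum>a\<in>A. c * ?m a \<omega>)"
    have Z: "Z \<in> bounded_funs" "L Z = (\<Sum>a\<in>A. c * L (?m a))"
      unfolding Z_def using L_sum[OF A(1), of "\<lambda>a \<omega>. c * ?m a \<omega>"] mb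
      by (auto simp: bounded_funs_scale L_scale)
    have m0: "0 \<le> c * ?m a \<omega>" for a \<omega> using c0 \<delta> by simp
    have pt: "\<bar>?Xk \<omega> - X \<omega>\<bar> \<le> C * n * \<delta> + Z \<omega>" for \<omega>
    proof (cases "\<forall>a\<in>A. \<bar>\<omega> a - \<omega> (?f a)\<bar> < \<delta>")
      case True
      have "\<bar>?Xk \<omega> - X \<omega>\<bar> \<le> C * (\<Sum>a\<in>A. \<bar>\<omega> (?f a) - \<omega> a\<bar>)" by (rule KC)
      also have "\<dots> \<le> C * (\<Sum>a\<in>A. \<delta>)"
        using True KC by (intro mult_left_mono sum_mono) (auto simp: abs_minus_commute less_imp_le)
      also have "\<dots> \<le> C * n * \<delta> + Z \<omega>" unfolding Z_def n_def using sum_nonneg[of A, OF m0] by simp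
      finally show ?thesis .
    next
      case False
      then obtain a where a: "a \<in> A" "\<delta> \<le> \<bar>\<omega> a - \<omega> (?f a)\<bar>" by auto
      have "\<bar>?Xk \<omega> - X \<omega>\<bar> \<le> 2 * K" using KC(1)[of "\<lambda>t. \<omega> (?f t)"] KC(1)[of \<omega>] by linarith
      also have "\<dots> = c * ?m a \<omega>" using a \<delta> by (simp add: min_absorb2 c_def)
      also have "\<dots> \<le> Z \<omega>" unfolding Z_def using a A m0 by (intro member_le_sum) auto
      also have "\<dots> \<le> C * n * \<delta> + Z \<omega>" using KC n \<delta> by simp
      finally show ?thesis .
    qed
    have Db: "(\<lambda>\<omega>. ?Xk \<omega> - X \<omega>) \<in> bounded_funs"
      using bounded_funs_add[OF b(2) bounded_funs_scale[OF b(1), of "-1"]] by simp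
    have cb: "(\<lambda>_ :: real \<Rightarrow> real. c) \<in> bounded_funs" for c by (rule bounded_funsI[of _ "\<bar>c\<bar>"]) simp
    have "\<bar>L ?Xk - L X\<bar> = \<bar>L (\<lambda>\<omega>. ?Xk \<omega> - X \<omega>)\<bar>" using L_diff[OF b(2,1)] by simp
    also have "\<dots> \<le> L (\<lambda>\<omega>. \<bar>?Xk \<omega> - X \<omega>\<bar>)" by (rule L_abs[OF Db])
    also have "\<dots> \<le> L (\<lambda>\<omega>. C * n * \<delta> + Z \<omega>)"
      using Db pt Z cb by (intro L_mono bounded_funs_add) (auto simp: bounded_funs_def)
    also have "\<dots> = C * n * \<delta> + (\<Sum>a\<in>A. c * L (?m a))"
      using L_add[OF cb Z(1)] L_const Z(2) by simp
    also have "\<dots> \<le> C * n * \<delta> + (\<Sum>a\<in>A. c * (M * (T\<^sup>2 * (1 / 4) ^ k)))"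
      using Lm c0 by (intro add_left_mono sum_mono mult_left_mono) auto
    also have "\<dots> = C * n * \<delta> + B * (1 / 4) ^ k" by (simp add: B_def n_def)
    also have "\<dots> < r / 2 + r / 2" using \<delta>2 k0[OF k] by (rule add_strict_mono)
    finally show "norm (L ?Xk - L X) < r" by simp
  qed
qed

text \<open>Kolmogorov's argument makes the dyadic process regular almost surely, so its limits
  along dyadic floors are continuous paths. Their law agrees with \<open>L\<close> because both
  sides are limits of the same values at dyadic times: by dominated convergence on one side, by
  \<open>functional_dyadic_approx\<close> on the other.\<close>

theorem functional_represented:
  assumes L: "positive_functional L" and LE: "\<And>X. X \<in> Lip T \<Longrightarrow> L X \<le> E X"
  obtains P where "P \<in> path_probs T" "\<And>X. X \<in> Lip T \<Longrightarrow> (integral\<^sup>L P X) = L X"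
proof -
  have T0: "0 \<le> T" using T_pos by simp
  interpret U: prob_space unit_interval by (rule prob_space_unit_interval)
  obtain V :: "real \<Rightarrow> real \<Rightarrow> real" where V: "\<And>t. V t \<in> borel_measurable unit_interval"
    "\<And>A X. finite A \<Longrightarrow> A \<subseteq> dyadic_times T \<Longrightarrow> X \<in> cyl A \<Longrightarrow> (\<integral>u. X (\<lambda>t. V t u) \<partial>unit_interval) = L X"
    using dyadic_process[OF L LE] by blast
  have mom: "(\<integral>u. min \<bar>V t u - V s u\<bar> k ^ 4 \<partial>unit_interval) \<le> M * (t - s)\<^sup>2"
    if st: "s \<in> dyadic_times T" "t \<in> dyadic_times T" and k: "0 \<le> k" for s t k
  proof -
    have c: "(\<lambda>\<omega>. min \<bar>\<omega> t - \<omega> s\<bar> k ^ 4) \<in> cyl {s, t}" by (rule cyl_min_power4) (rule k)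
    have st': "{s, t} \<subseteq> {0..T}" using st dyadic_times_subset[OF T_pos] by blast
    have "(\<integral>u. min \<bar>V t u - V s u\<bar> k ^ 4 \<partial>unit_interval) = L (\<lambda>\<omega>. min \<bar>\<omega> t - \<omega> s\<bar> k ^ 4)"
      using V(2)[OF _ _ c] st by simp
    also have "\<dots> \<le> E (\<lambda>\<omega>. min \<bar>\<omega> t - \<omega> s\<bar> k ^ 4)"
      by (rule LE[OF cyl_subset_Lip[OF _ st' T0 c]]) simp
    finally show ?thesis using E_incr[of s t k] st' k by simp
  qed
  define G where "G = (\<lambda>u. \<exists>k0. dyadic_regular T k0 (\<lambda>t. V t u))"
  note irr = U.prob_dyadic_irregular[OF T_pos M_nonneg V(1) mom]
  have Gm: "{u \<in> space unit_interval. G u} \<in> sets unit_interval"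
    unfolding G_def by (intro sets.sets_Collect_countable_Ex irr(1))
  have AE_G: "AE u in unit_interval. G u"
  proof -
    let ?N = "{u \<in> space unit_interval. \<not> G u}"
    have N: "?N \<in> sets unit_interval" using sets.sets_Collect_neg[OF Gm] .
    have "U.prob ?N \<le> e" if "0 < e" for e
    proof -
      obtain k0 where k0: "M * T\<^sup>2 * (6561 / 1561) * (5000 / 6561) ^ k0 < e"
        using geometric_bound_small[OF \<open>0 < e\<close>] by blast
      have "U.prob ?N \<le> U.prob {u \<in> space unit_interval. \<not> dyadic_regular T k0 (\<lambda>t. V t u)}"
        using irr(1)[of k0] by (intro U.finite_measure_mono sets.sets_Collect_neg) (auto simp: G_def)
      then show ?thesis using irr(2)[of k0] k0 by linarith
    qed
    then have "U.prob ?N \<le> 0" by (rule field_le_epsilon[where y = 0, simplified])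
    then have "U.prob ?N = 0" using measure_nonneg[of unit_interval ?N] by linarith
    then show ?thesis using N by (intro AE_I[of _ _ ?N]) (auto simp: U.emeasure_eq_measure)
  qed
  \<comment> \<open>The zero path on the exceptional set keeps every value in the path space, and
    \<open>undefined\<close> outside \<open>{0..T}\<close> makes it extensional.\<close>
  define x where "x = (\<lambda>u t. if t \<in> {0..T} then (if G u then lim (\<lambda>k. V (dyadic_floor T k t) u) else 0) else undefined)"
  have lim: "(\<lambda>k. V (dyadic_floor T k t) u) \<longlonglongrightarrow> x u t" if "G u" "t \<in> {0..T}" for u t
  proof -
    obtain k0 where "dyadic_regular T k0 (\<lambda>t. V t u)" using \<open>G u\<close> G_def by blast
    from dyadic_regular_convergent[OF T_pos this that(2)] show ?thesis
      using that by (simp add: x_def convergent_LIMSEQ_iff)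
  qed
  have xp: "x u \<in> path_space T" for u
  proof -
    have "continuous_on {0..T} (x u)"
    proof (cases "G u")
      case True
      then obtain k0 where "dyadic_regular T k0 (\<lambda>t. V t u)" using G_def by blast
      from dyadic_limit_modulus[OF T_pos this _ lim[OF True]] show ?thesis
        by (rule path_modulus_continuous[OF T_pos])
    next
      case False
      then have "continuous_on {0..T} (x u) \<longleftrightarrow> continuous_on {0..T} (\<lambda>_. 0 :: real)"
        by (intro continuous_on_cong) (auto simp: x_def)
      then show ?thesis by simp
    qed
    then show ?thesis by (auto simp: path_space_iff x_def extensional_def)
  qed
  have xm: "x \<in> measurable unit_interval (path_borel T)"
  proof (rule path_measurableI[OF T_pos xp])
    fix t assume t: "t \<in> {0..T}"
    have "(\<lambda>u. if G u then lim (\<lambda>k. V (dyadic_floor T k t) u) else 0) \<in> borel_measurable unit_interval"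
      using Gm by (intro measurable_If borel_measurable_lim_metric V(1)) auto
    then show "(\<lambda>u. x u t) \<in> borel_measurable unit_interval" using t by (simp add: x_def)
  qed
  show thesis
  proof (rule that[of "distr unit_interval (path_borel T) x"])
    show "distr unit_interval (path_borel T) x \<in> path_probs T"
      by (rule path_probs_distr[OF prob_space_unit_interval xm])
    fix X assume X: "X \<in> Lip T"
    obtain A where A: "finite A" "A \<subseteq> {0..T}" "X \<in> cyl A" using Lip_subset_cyl[OF X] by blast
    obtain K where K: "\<And>\<omega>. \<bar>X \<omega>\<bar> \<le> K" using A(3) by (auto simp: cyl_def)
    let ?Xk = "\<lambda>k \<omega>. X (\<lambda>t. \<omega> (dyadic_floor T k t))"
    have ck: "?Xk k \<in> cyl (dyadic_floor T k ` A)" for k by (rule cyl_reindex[OF A(1,3)])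
    have Ik: "(\<integral>u. ?Xk k (\<lambda>t. V t u) \<partial>unit_interval) = L (?Xk k)" for k
      using dyadic_floor_mem[OF T_pos] A by (intro V(2)[OF _ _ ck]) auto
    have Xx: "(\<lambda>u. X (x u)) \<in> borel_measurable unit_interval"
      by (rule measurable_compose[OF xm Lip_measurable[OF T_pos X]])
    have "(\<lambda>k. \<integral>u. ?Xk k (\<lambda>t. V t u) \<partial>unit_interval) \<longlonglongrightarrow> (\<integral>u. X (x u) \<partial>unit_interval)"
    proof (rule integral_dominated_convergence[OF Xx, where w = "\<lambda>_. K"])
      show "AE u in unit_interval. (\<lambda>k. ?Xk k (\<lambda>t. V t u)) \<longlonglongrightarrow> X (x u)"
        using AE_G by eventually_elim (rule cyl_tendsto[OF A(3)], rule lim, use A in auto)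
      fix k
      \<comment> \<open>Times do not form a countable type, so the finitely many that matter are
        renumbered by natural numbers before \<open>cyl_measurable_compose\<close> is
        applied.\<close>
      define V' where "V' = (\<lambda>n. V (from_nat_into (dyadic_floor T k ` A) n))"
      show "(\<lambda>u. ?Xk k (\<lambda>t. V t u)) \<in> borel_measurable unit_interval"
      proof -
        have "(\<lambda>x :: nat \<Rightarrow> real. ?Xk k (\<lambda>t. x (to_nat_on (dyadic_floor T k ` A) t)))
            \<in> cyl (to_nat_on (dyadic_floor T k ` A) ` dyadic_floor T k ` A)"
          using A by (intro cyl_reindex[OF _ ck]) auto
        from cyl_measurable_compose[OF this, of V'] V(1)
        have "(\<lambda>u. ?Xk k (\<lambda>t. V' (to_nat_on (dyadic_floor T k ` A) t) u)) \<in> borel_measurable unit_interval"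
          by (simp add: V'_def)
        also have "(\<lambda>u. ?Xk k (\<lambda>t. V' (to_nat_on (dyadic_floor T k ` A) t) u)) = (\<lambda>u. ?Xk k (\<lambda>t. V t u))"
          using A by (intro ext cyl_cong[OF ck]) (simp add: V'_def countable_finite)
        finally show ?thesis .
      qed
    qed (use K in auto)
    moreover have "(\<lambda>k. \<integral>u. ?Xk k (\<lambda>t. V t u) \<partial>unit_interval) \<longlonglongrightarrow> L X"
      unfolding Ik by (rule functional_dyadic_approx[OF L LE A])
    ultimately have "(\<integral>u. X (x u) \<partial>unit_interval) = L X" by (rule LIMSEQ_unique)
    then show "(\<integral>\<omega>. X \<omega> \<partial>distr unit_interval (path_borel T) x) = L X"
      using integral_distr[OF xm Lip_measurable[OF T_pos X]] by simp
  qed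
qed

text \<open>The functional below \<open>E\<close> is chosen to touch it at \<open>X\<close>, so its
  representing measure attains the upper bound.\<close>

theorem Lip_expectation_attained:
  assumes "X \<in> Lip T"
  obtains P where "P \<in> \<P>" "(integral\<^sup>L P X) = E X"
proof -
  obtain L where L: "positive_functional L" "\<And>X. X \<in> Lip T \<Longrightarrow> L X \<le> E X" "L X = E X"
    using functional_below[OF assms] by blast
  obtain P where "P \<in> path_probs T" "\<And>X. X \<in> Lip T \<Longrightarrow> (integral\<^sup>L P X) = L X"
    using functional_represented[OF L(1,2)] by blast
  then show thesis using that[of P] L assms by (simp add: Lip_dominated_def)
qed

end

subsection \<open>The bounded Lipschitz metric\<close>

lemma BL_norm_le_1D:
  assumes "BL_norm T f \<le> 1" "\<omega> \<in> path_space T"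
  shows "\<bar>f \<omega>\<bar> \<le> 1"
    and "\<omega>' \<in> path_space T \<Longrightarrow> \<bar>f \<omega> - f \<omega>'\<bar> \<le> mdist (path_metric T) \<omega> \<omega>'"
proof -
  let ?a = "SUP \<omega>\<in>path_space T. ennreal \<bar>f \<omega>\<bar>"
  let ?S = "{(\<omega>, \<omega>'). \<omega> \<in> path_space T \<and> \<omega>' \<in> path_space T \<and> \<omega> \<noteq> \<omega>'}"
  let ?b = "SUP (\<omega>, \<omega>')\<in>?S. ennreal (\<bar>f \<omega> - f \<omega>'\<bar> / mdist (path_metric T) \<omega> \<omega>')"
  have ab: "?a + ?b \<le> 1" using assms(1) by (simp add: BL_norm_def)
  have "?a \<le> ?a + ?b" by simp
  then have "?a \<le> 1" using ab by (rule order_trans)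
  moreover have "ennreal \<bar>f \<omega>\<bar> \<le> ?a" by (rule SUP_upper[OF assms(2)])
  ultimately have "ennreal \<bar>f \<omega>\<bar> \<le> 1" by (meson order_trans)
  then show "\<bar>f \<omega>\<bar> \<le> 1" by (simp add: ennreal_le_1)
  show "\<bar>f \<omega> - f \<omega>'\<bar> \<le> mdist (path_metric T) \<omega> \<omega>'" if w': "\<omega>' \<in> path_space T"
  proof (cases "\<omega> = \<omega>'")
    case False
    interpret P: Metric_space "path_space T" "mdist (path_metric T)" by (rule Metric_space_mspace_mdist)
    have pos: "0 < mdist (path_metric T) \<omega> \<omega>'" using False assms(2) w' by (simp add: P.mdist_pos_less)
    have "?b \<le> ?a + ?b" by simp
    then have "?b \<le> 1" using ab by (rule order_trans)
    moreover have "ennreal (\<bar>f \<omega> - f \<omega>'\<bar> / mdist (path_metric T) \<omega> \<omega>') \<le> ?b"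
      by (rule SUP_upper2[of "(\<omega>, \<omega>')"]) (use assms(2) w' False in auto)
    ultimately have "ennreal (\<bar>f \<omega> - f \<omega>'\<bar> / mdist (path_metric T) \<omega> \<omega>') \<le> 1" by (meson order_trans)
    then have "\<bar>f \<omega> - f \<omega>'\<bar> / mdist (path_metric T) \<omega> \<omega>' \<le> 1" by (simp add: ennreal_le_1)
    then show ?thesis using pos by (simp add: field_simps)
  qed simp
qed

lemma BL_norm_le_1I:
  assumes "0 \<le> a" "0 \<le> b" "a + b \<le> 1" "\<And>\<omega>. \<omega> \<in> path_space T \<Longrightarrow> \<bar>f \<omega>\<bar> \<le> a"
    and "\<And>\<omega> \<omega>'. \<omega> \<in> path_space T \<Longrightarrow> \<omega>' \<in> path_space T \<Longrightarrow> \<bar>f \<omega> - f \<omega>'\<bar> \<le> b * mdist (path_metric T) \<omega> \<omega>'"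
  shows "BL_norm T f \<le> 1"
proof -
  interpret P: Metric_space "path_space T" "mdist (path_metric T)" by (rule Metric_space_mspace_mdist)
  have "BL_norm T f \<le> ennreal a + ennreal b"
    unfolding BL_norm_def
  proof (intro add_mono SUP_least)
    show "ennreal \<bar>f \<omega>\<bar> \<le> ennreal a" if "\<omega> \<in> path_space T" for \<omega> using assms that by (intro ennreal_leI) auto
    fix p assume "p \<in> {(\<omega>, \<omega>'). \<omega> \<in> path_space T \<and> \<omega>' \<in> path_space T \<and> \<omega> \<noteq> \<omega>'}"
    then obtain \<omega> \<omega>' where p: "p = (\<omega>, \<omega>')" "\<omega> \<in> path_space T" "\<omega>' \<in> path_space T" "\<omega> \<noteq> \<omega>'" by auto
    have "0 < mdist (path_metric T) \<omega> \<omega>'" using p by (simp add: P.mdist_pos_less)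
    then show "(case p of (\<omega>, \<omega>') \<Rightarrow> ennreal (\<bar>f \<omega> - f \<omega>'\<bar> / mdist (path_metric T) \<omega> \<omega>')) \<le> ennreal b"
      using assms(5)[OF p(2,3)] by (simp add: p(1) ennreal_leI pos_divide_le_eq)
  qed
  also have "\<dots> = ennreal (a + b)" using assms by simp
  also have "\<dots> \<le> ennreal 1" using assms by (intro ennreal_leI)
  finally show ?thesis by simp
qed

lemma path_probsD:
  assumes "P \<in> path_probs T"
  shows "prob_space P" "sets P = sets (path_borel T)" "space P = path_space T"
    "measurable P N = measurable (path_borel T) N"
  using assms sets_eq_imp_space_eq[of P "path_borel T"] measurable_cong_sets[of P "path_borel T" N N]
  by (auto simp: path_probs_def)

lemma path_probs_bounded_integrable:
  fixes f :: "(real \<Rightarrow> real) \<Rightarrow> real"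
  assumes "P \<in> path_probs T" "f \<in> borel_measurable (path_borel T)"
    and "\<And>\<omega>. \<omega> \<in> path_space T \<Longrightarrow> \<bar>f \<omega>\<bar> \<le> K"
  shows "integrable P f"
proof -
  interpret prob_space P using path_probsD(1)[OF assms(1)] .
  show ?thesis using assms path_probsD[OF assms(1)] by (intro integrable_const_bound[of _ K]) auto
qed

lemma BL_integrable:
  assumes "P \<in> path_probs T" "BL_norm T f \<le> 1"
  shows "integrable P f" "\<bar>\<integral>\<omega>. f \<omega> \<partial>P\<bar> \<le> 1"
proof -
  interpret prob_space P using path_probsD(1)[OF assms(1)] .
  have m: "f \<in> borel_measurable (path_borel T)"
    by (rule path_lipschitz_measurable[where K = 1]) (use BL_norm_le_1D[OF assms(2)] in auto)
  show i: "integrable P f"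
    by (rule path_probs_bounded_integrable[OF assms(1) m BL_norm_le_1D(1)[OF assms(2)]])
  have f1: "\<bar>f \<omega>\<bar> \<le> 1" if "\<omega> \<in> space P" for \<omega>
    using BL_norm_le_1D(1)[OF assms(2)] that path_probsD(3)[OF assms(1)] by simp
  have "\<bar>\<integral>\<omega>. f \<omega> \<partial>P\<bar> \<le> (\<integral>\<omega>. \<bar>f \<omega>\<bar> \<partial>P)" by (rule integral_abs_bound)
  also have "\<dots> \<le> (\<integral>\<omega>. 1 \<partial>P)" using i f1 by (intro integral_mono integrable_abs) auto
  finally show "\<bar>\<integral>\<omega>. f \<omega> \<partial>P\<bar> \<le> 1" by (simp add: prob_space)
qed

lemma BL_norm_zero: "BL_norm T (\<lambda>_. 0) \<le> 1"
  by (rule BL_norm_le_1I[of 0 0]) auto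

lemma BL_norm_uminus: "BL_norm T (\<lambda>\<omega>. - f \<omega>) = BL_norm T f"
  by (simp add: BL_norm_def abs_minus_commute)

lemma BL_dist_ge:
  assumes "P \<in> path_probs T" "Q \<in> path_probs T" "BL_norm T f \<le> 1"
  shows "(integral\<^sup>L P f) - (integral\<^sup>L Q f) \<le> BL_dist T P Q"
proof -
  have "bdd_above ((\<lambda>f. (integral\<^sup>L P f) - (integral\<^sup>L Q f)) ` {f. BL_norm T f \<le> 1})"
    using BL_integrable(2)[OF assms(1)] BL_integrable(2)[OF assms(2)]
    by (intro bdd_aboveI2[where M = 2]) (fastforce simp: abs_le_iff)
  from cSUP_upper[OF _ this, of f] show ?thesis using assms by (simp add: BL_dist_def)
qed

lemma BL_dist_le:
  assumes "P \<in> path_probs T" "Q \<in> path_probs T"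
    and "\<And>f. BL_norm T f \<le> 1 \<Longrightarrow> (integral\<^sup>L P f) - (integral\<^sup>L Q f) \<le> c"
  shows "BL_dist T P Q \<le> c"
  unfolding BL_dist_def using assms BL_norm_zero by (auto intro!: cSUP_least)

lemma BL_dist_abs_ge:
  assumes "P \<in> path_probs T" "Q \<in> path_probs T" "BL_norm T f \<le> 1"
  shows "\<bar>(integral\<^sup>L P f) - (integral\<^sup>L Q f)\<bar> \<le> BL_dist T P Q"
  using BL_dist_ge[OF assms] BL_dist_ge[OF assms(1,2), of "\<lambda>\<omega>. - f \<omega>"] assms(3)
  by (simp add: BL_norm_uminus)

text \<open>Dividing by \<open>2 * K\<close> leaves one half of the unit norm for the supremum and
  one half for the Lipschitz constant.\<close>

lemma BL_dist_lipschitz: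
  assumes PQ: "P \<in> path_probs T" "Q \<in> path_probs T" and K: "0 < K"
    and f: "\<And>\<omega>. \<omega> \<in> path_space T \<Longrightarrow> \<bar>f \<omega>\<bar> \<le> K"
    and lip: "\<And>\<omega> \<omega>'. \<omega> \<in> path_space T \<Longrightarrow> \<omega>' \<in> path_space T \<Longrightarrow> \<bar>f \<omega> - f \<omega>'\<bar> \<le> K * mdist (path_metric T) \<omega> \<omega>'"
  shows "\<bar>(integral\<^sup>L P f) - (integral\<^sup>L Q f)\<bar> \<le> 2 * K * BL_dist T P Q"
proof -
  have "BL_norm T (\<lambda>\<omega>. f \<omega> / (2 * K)) \<le> 1"
  proof (rule BL_norm_le_1I[of "1 / 2" "1 / 2"])
    show "\<bar>f \<omega> / (2 * K)\<bar> \<le> 1 / 2" if "\<omega> \<in> path_space T" for \<omega>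
      using f[OF that] K by (simp add: field_simps)
    show "\<bar>f \<omega> / (2 * K) - f \<omega>' / (2 * K)\<bar> \<le> 1 / 2 * mdist (path_metric T) \<omega> \<omega>'"
      if "\<omega> \<in> path_space T" "\<omega>' \<in> path_space T" for \<omega> \<omega>'
      using lip[OF that] K by (simp add: diff_divide_distrib[symmetric] abs_divide field_simps)
  qed auto
  from BL_dist_abs_ge[OF PQ this] show ?thesis
    using K by (simp add: diff_divide_distrib[symmetric] abs_divide field_simps)
qed

text \<open>\<open>g\<close> is the distance to the complement of \<open>U\<close>; that
  \<open>U\<close> is not the whole space keeps the infimum over a nonempty set.\<close>

lemma open_indicator_lipschitz_approx:
  assumes U: "openin (mtopology_of (path_metric T)) U" "U \<noteq> path_space T"
  obtains g where "\<And>\<omega>. \<omega> \<in> path_space T \<Longrightarrow> 0 \<le> g \<omega>"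
    "\<And>\<omega>. \<omega> \<in> path_space T \<Longrightarrow> g \<omega> = 0 \<longleftrightarrow> \<omega> \<notin> U"
    "\<And>\<omega> \<omega>'. \<omega> \<in> path_space T \<Longrightarrow> \<omega>' \<in> path_space T \<Longrightarrow> \<bar>g \<omega> - g \<omega>'\<bar> \<le> mdist (path_metric T) \<omega> \<omega>'"
proof
  interpret P: Metric_space "path_space T" "mdist (path_metric T)" by (rule Metric_space_mspace_mdist)
  let ?d = "mdist (path_metric T)"
  have open_U: "openin P.mtopology U" using U(1) by (simp add: mtopology_of_def)
  then have ne: "path_space T - U \<noteq> {}" using U(2) openin_subset by fastforce
  define g where "g = (\<lambda>\<omega>. INF y\<in>path_space T - U. ?d \<omega> y)"
  have bdd: "bdd_below (?d \<omega> ` (path_space T - U))" for \<omega> by (rule bdd_belowI2[of _ 0]) simp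
  show g0: "0 \<le> g \<omega>" if "\<omega> \<in> path_space T" for \<omega>
    unfolding g_def using ne by (intro cINF_greatest) auto
  have tri: "g \<omega> \<le> g \<omega>' + ?d \<omega> \<omega>'" if "\<omega> \<in> path_space T" "\<omega>' \<in> path_space T" for \<omega> \<omega>'
  proof -
    have "g \<omega> - ?d \<omega> \<omega>' \<le> ?d \<omega>' y" if y: "y \<in> path_space T - U" for y
    proof -
      have "g \<omega> \<le> ?d \<omega> y" unfolding g_def by (rule cINF_lower[OF bdd y])
      also have "\<dots> \<le> ?d \<omega> \<omega>' + ?d \<omega>' y" using y \<open>\<omega> \<in> _\<close> \<open>\<omega>' \<in> _\<close> by (intro P.triangle) auto
      finally show ?thesis by simp
    qed
    then have "g \<omega> - ?d \<omega> \<omega>' \<le> g \<omega>'" unfolding g_def by (intro cINF_greatest ne) (auto simp: g_def)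
    then show ?thesis by simp
  qed
  show "\<bar>g \<omega> - g \<omega>'\<bar> \<le> ?d \<omega> \<omega>'" if "\<omega> \<in> path_space T" "\<omega>' \<in> path_space T" for \<omega> \<omega>'
    using tri[OF that] tri[OF that(2,1)] P.commute[of \<omega> \<omega>'] by linarith
  show "g \<omega> = 0 \<longleftrightarrow> \<omega> \<notin> U" if w: "\<omega> \<in> path_space T" for \<omega>
  proof
    assume "\<omega> \<notin> U"
    then have "g \<omega> \<le> ?d \<omega> \<omega>" unfolding g_def using w by (intro cINF_lower bdd) auto
    then show "g \<omega> = 0" using g0[OF w] w by simp
  next
    assume 0: "g \<omega> = 0"
    show "\<omega> \<notin> U"
    proof
      assume "\<omega> \<in> U"
      then obtain r where r: "r > 0" "P.mball \<omega> r \<subseteq> U" using open_U P.openin_mtopology by blast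
      have "r \<le> ?d \<omega> y" if "y \<in> path_space T - U" for y
        using r(2) that w by (force simp: not_less[symmetric])
      then have "r \<le> g \<omega>" unfolding g_def by (intro cINF_greatest ne)
      then show False using 0 r(1) by simp
    qed
  qed
qed

text \<open>The Lipschitz functions \<open>min 1 (n * g)\<close> converge to the indicator of an
  open set, so the two measures agree on open sets. These are stable under intersection and generate
  the Borel sets.\<close>

lemma BL_dist_eq_0_imp_eq:
  assumes PQ: "P \<in> path_probs T" "Q \<in> path_probs T" and 0: "BL_dist T P Q = 0"
  shows "P = Q"
proof -
  interpret P: prob_space P using path_probsD(1)[OF PQ(1)] .
  interpret Q: prob_space Q using path_probsD(1)[OF PQ(2)] .
  let ?O = "{U. openin (mtopology_of (path_metric T)) U}"
  have open_eq: "emeasure P U = emeasure Q U" if U: "openin (mtopology_of (path_metric T)) U" for U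
  proof (cases "U = path_space T")
    case True
    then show ?thesis using P.emeasure_space_1 Q.emeasure_space_1 path_probsD(3)[OF PQ(1)] path_probsD(3)[OF PQ(2)] by simp
  next
    case False
    obtain g where g: "\<And>\<omega>. \<omega> \<in> path_space T \<Longrightarrow> 0 \<le> g \<omega>"
      "\<And>\<omega>. \<omega> \<in> path_space T \<Longrightarrow> g \<omega> = 0 \<longleftrightarrow> \<omega> \<notin> U"
      "\<And>\<omega> \<omega>'. \<omega> \<in> path_space T \<Longrightarrow> \<omega>' \<in> path_space T \<Longrightarrow> \<bar>g \<omega> - g \<omega>'\<bar> \<le> mdist (path_metric T) \<omega> \<omega>'"
      using open_indicator_lipschitz_approx[OF U False] by blast
    define f where "f = (\<lambda>n :: nat. \<lambda>\<omega>. min 1 (real n * g \<omega>))"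
    have lip: "\<bar>f n \<omega> - f n \<omega>'\<bar> \<le> (real n + 1) * mdist (path_metric T) \<omega> \<omega>'"
      if "\<omega> \<in> path_space T" "\<omega>' \<in> path_space T" for n \<omega> \<omega>'
    proof -
      have "\<bar>f n \<omega> - f n \<omega>'\<bar> \<le> \<bar>real n * g \<omega> - real n * g \<omega>'\<bar>" by (simp add: f_def min_def)
      also have "\<dots> = real n * \<bar>g \<omega> - g \<omega>'\<bar>" by (simp add: right_diff_distrib[symmetric] abs_mult)
      also have "\<dots> \<le> (real n + 1) * mdist (path_metric T) \<omega> \<omega>'" using g(3)[OF that] by (intro mult_mono) auto
      finally show ?thesis .
    qed
    have b: "\<bar>f n \<omega>\<bar> \<le> 1" if "\<omega> \<in> path_space T" for n \<omega> using g(1)[OF that] by (auto simp: f_def min_def)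
    have eq: "(integral\<^sup>L P (f n)) = (integral\<^sup>L Q (f n))" for n
    proof -
      have "\<bar>f n \<omega>\<bar> \<le> real n + 1" if "\<omega> \<in> path_space T" for \<omega> using b[OF that, of n] by linarith
      then have "\<bar>(integral\<^sup>L P (f n)) - (integral\<^sup>L Q (f n))\<bar> \<le> 2 * (real n + 1) * BL_dist T P Q"
        by (intro BL_dist_lipschitz PQ lip) auto
      then show ?thesis using 0 by simp
    qed
    have fm: "f n \<in> borel_measurable (path_borel T)" for n
      by (rule path_lipschitz_measurable[OF lip])
    have lim: "(\<lambda>n. f n \<omega>) \<longlonglongrightarrow> indicator U \<omega>" if w: "\<omega> \<in> path_space T" for \<omega>
    proof (cases "\<omega> \<in> U")
      case True
      then have pos: "0 < g \<omega>" using g(1,2)[OF w] by (auto simp: less_le)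
      obtain N :: nat where N: "1 / g \<omega> < real N" using reals_Archimedean2 by blast
      have "f n \<omega> = 1" if "N \<le> n" for n
      proof -
        have "1 \<le> real N * g \<omega>" using N pos by (simp add: field_simps)
        also have "\<dots> \<le> real n * g \<omega>" using that pos by simp
        finally show ?thesis by (simp add: f_def)
      qed
      then have "\<forall>\<^sub>F n in sequentially. f n \<omega> = 1" by (auto simp: eventually_sequentially)
      then show ?thesis using True by (simp add: tendsto_eventually)
    next
      case False
      then show ?thesis using g(2)[OF w] by (simp add: f_def)
    qed
    have Um: "U \<in> sets (path_borel T)" by (rule sets_path_borel_open[OF U])
    have conv: "(\<lambda>n. \<integral>\<omega>. f n \<omega> \<partial>R) \<longlonglongrightarrow> measure R U" if R: "R \<in> path_probs T" for R
    proof -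
      interpret R: prob_space R using path_probsD(1)[OF R] .
      have "U \<inter> space R = U" using sets.sets_into_space[OF Um] path_probsD(3)[OF R] by auto
      moreover have "(\<lambda>n. \<integral>\<omega>. f n \<omega> \<partial>R) \<longlonglongrightarrow> (\<integral>\<omega>. indicator U \<omega> \<partial>R)"
        by (rule integral_dominated_convergence[where w = "\<lambda>_. 1"])
          (use fm Um b lim path_probsD[OF R] in auto)
      ultimately show ?thesis by simp
    qed
    have "measure P U = measure Q U"
      using LIMSEQ_unique[OF conv[OF PQ(1)]] conv[OF PQ(2)] eq by simp
    then show ?thesis by (simp add: P.emeasure_eq_measure Q.emeasure_eq_measure)
  qed
  have sets: "sets (path_borel T) = sigma_sets (path_space T) ?O"
    unfolding path_borel_def by (rule sets_measure_of) (use openin_subset in fastforce)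
  show ?thesis
  proof (rule measure_eqI_generator_eq[where E = ?O and \<Omega> = "path_space T" and A = "\<lambda>_. path_space T"])
    show "Int_stable ?O" by (auto simp: Int_stable_def)
    show "?O \<subseteq> Pow (path_space T)" using openin_subset by fastforce
    show "emeasure P X = emeasure Q X" if "X \<in> ?O" for X using open_eq that by simp
    show "sets P = sigma_sets (path_space T) ?O" "sets Q = sigma_sets (path_space T) ?O"
      using path_probsD(2)[OF PQ(1)] path_probsD(2)[OF PQ(2)] sets by auto
    show "range (\<lambda>_. path_space T) \<subseteq> ?O" using openin_topspace[of "mtopology_of (path_metric T)"] by simp
  qed auto
qed

lemma BL_dist_Metric_space:
  assumes "S \<subseteq> path_probs T"
  shows "Metric_space S (BL_dist T)"
proof
  show nonneg: "0 \<le> BL_dist T P Q" for P Q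
  proof (cases "P \<in> path_probs T \<and> Q \<in> path_probs T")
    case True
    then show ?thesis using BL_dist_ge[OF _ _ BL_norm_zero, of P T Q] by simp
  next
    case False
    have "BL_dist T P Q = 0" unfolding BL_dist_def by (rule if_not_P[OF False])
    then show ?thesis by simp
  qed
  have le: "BL_dist T P Q \<le> BL_dist T Q P" if "P \<in> path_probs T" "Q \<in> path_probs T" for P Q
  proof (rule BL_dist_le[OF that])
    fix f assume "BL_norm T f \<le> 1"
    then show "(integral\<^sup>L P f) - (integral\<^sup>L Q f) \<le> BL_dist T Q P"
      using BL_dist_abs_ge[OF that(2,1)] by (simp add: abs_le_iff)
  qed
  show "BL_dist T P Q = BL_dist T Q P" for P Q
  proof (cases "P \<in> path_probs T \<and> Q \<in> path_probs T")
    case True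
    then show ?thesis using le by (intro antisym) auto
  next
    case False
    then show ?thesis unfolding BL_dist_def by auto
  qed
  show "BL_dist T P Q = 0 \<longleftrightarrow> P = Q" if "P \<in> S" "Q \<in> S" for P Q
  proof
    assume "P = Q"
    then show "BL_dist T P Q = 0" using nonneg[of P Q] that assms by (intro antisym BL_dist_le) auto
  qed (use BL_dist_eq_0_imp_eq that assms in blast)
  show "BL_dist T P R \<le> BL_dist T P Q + BL_dist T Q R" if "P \<in> S" "Q \<in> S" "R \<in> S" for P Q R
  proof (rule BL_dist_le)
    fix f assume f: "BL_norm T f \<le> 1"
    have "(integral\<^sup>L P f) - (integral\<^sup>L Q f) \<le> BL_dist T P Q" "(integral\<^sup>L Q f) - (integral\<^sup>L R f) \<le> BL_dist T Q R"
      using that assms f by (auto intro!: BL_dist_ge)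
    then show "(integral\<^sup>L P f) - (integral\<^sup>L R f) \<le> BL_dist T P Q + BL_dist T Q R" by linarith
  qed (use that assms in auto)
qed

subsection \<open>Compactness\<close>

lemma Lip_dominated_path_probs: "P \<in> Lip_dominated T E \<Longrightarrow> P \<in> path_probs T"
  by (simp add: Lip_dominated_def)

lemma Lip_integrable:
  assumes "0 < T" "P \<in> path_probs T" "X \<in> Lip T"
  shows "integrable P X"
proof -
  obtain K where "\<And>\<omega>. \<bar>X \<omega>\<bar> \<le> K" using Lip_lipschitz[OF assms(1,3)] by metis
  then show ?thesis by (intro path_probs_bounded_integrable[OF assms(2) Lip_measurable] assms)
qed

lemma dyadic_regular_path_modulus:
  assumes "0 < T" "\<omega> \<in> path_space T" "dyadic_regular T k0 \<omega>" "k0 \<le> m"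
  shows "path_modulus T (2 ^ m) (19 * (9 / 10) ^ m) \<omega>"
  using dyadic_limit_modulus[OF assms(1,3,4)] path_dyadic_tendsto[OF assms(1,2)] by blast

lemma dyadic_regular_bound:
  assumes "dyadic_regular T k0 \<omega>" "k0 \<le> m" "\<bar>\<omega> 0\<bar> \<le> 1"
  shows "i \<le> 2 ^ m \<Longrightarrow> \<bar>\<omega> (grid_pt T (2 ^ m) i)\<bar> \<le> 1 + real i"
proof (induction i)
  case 0
  then show ?case using assms(3) by (simp add: grid_pt_def)
next
  case (Suc i)
  have "\<bar>\<omega> (grid_pt T (2 ^ m) (Suc i)) - \<omega> (grid_pt T (2 ^ m) i)\<bar> \<le> (9 / 10) ^ m"
    using assms(1,2) Suc.prems by (auto simp: dyadic_regular_def)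
  also have "\<dots> \<le> 1" by (rule power_le_one) auto
  finally show ?case using Suc by simp
qed

lemma finite_path_codes:
  assumes c: "0 < c" and b: "\<And>\<omega> i. \<omega> \<in> K \<Longrightarrow> i \<le> N \<Longrightarrow> \<bar>\<omega> (grid_pt T N i)\<bar> \<le> R"
  shows "finite (path_code T N c ` K)"
proof (rule finite_subset)
  show "path_code T N c ` K \<subseteq> {xs. set xs \<subseteq> {\<lfloor>- R / c\<rfloor>..\<lfloor>R / c\<rfloor>} \<and> length xs = Suc N}"
  proof
    fix xs assume "xs \<in> path_code T N c ` K"
    then obtain \<omega> where w: "\<omega> \<in> K" "xs = path_code T N c \<omega>" by blast
    have "\<lfloor>\<omega> (grid_pt T N i) / c\<rfloor> \<in> {\<lfloor>- R / c\<rfloor>..\<lfloor>R / c\<rfloor>}" if "i < Suc N" for i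
    proof -
      have "- R \<le> \<omega> (grid_pt T N i)" "\<omega> (grid_pt T N i) \<le> R" using b[OF w(1), of i] that by auto
      then have "- R / c \<le> \<omega> (grid_pt T N i) / c" "\<omega> (grid_pt T N i) / c \<le> R / c"
        using c by (intro divide_right_mono; simp)+
      then show ?thesis unfolding atLeastAtMost_iff by (intro conjI floor_mono)
    qed
    then show "xs \<in> {xs. set xs \<subseteq> {\<lfloor>- R / c\<rfloor>..\<lfloor>R / c\<rfloor>} \<and> length xs = Suc N}"
      unfolding w(2) path_code_def by (auto simp del: upt_Suc)
  qed
qed (rule finite_lists_length_eq, simp)

text \<open>McShane's Lipschitz extension from the net \<open>Y\<close>, with the path distance replaced by a sum over
  grid times so that it becomes a cylinder function.\<close>

definition net_fun :: "real \<Rightarrow> nat \<Rightarrow> (real \<Rightarrow> real) set \<Rightarrow> ((real \<Rightarrow> real) \<Rightarrow> real) \<Rightarrow> (real \<Rightarrow> real) \<Rightarrow> real" where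
  "net_fun T N Y a \<omega> = max (- 1) (min 1
     (Min ((\<lambda>y. a y + (\<Sum>i\<le>N. \<bar>\<omega> (grid_pt T N i) - y (grid_pt T N i)\<bar>)) ` Y)))"

text \<open>A minimum of finitely many functions that are 1-Lipschitz in the grid values for the sum
  norm is again such, and truncation to \<open>[-1, 1]\<close> preserves this.\<close>

lemma net_fun_Lip:
  assumes T: "0 < T" and Y: "finite Y" "Y \<noteq> {}"
  shows "net_fun T N Y a \<in> Lip T"
proof -
  let ?t = "grid_pt T N"
  define X where "X = (\<lambda>x :: nat \<Rightarrow> real. max (- 1) (min 1
     (Min ((\<lambda>y. a y + (\<Sum>i\<le>N. \<bar>x i - y (?t i)\<bar>)) ` Y))))"
  have "X \<in> cyl {..N}"
  proof (rule cylI[of _ 1 1])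
    show "\<bar>X x\<bar> \<le> 1" for x by (auto simp: X_def)
    have le: "Min ((\<lambda>y. a y + (\<Sum>i\<le>N. \<bar>x i - y (?t i)\<bar>)) ` Y) \<le>
        Min ((\<lambda>y. a y + (\<Sum>i\<le>N. \<bar>x' i - y (?t i)\<bar>)) ` Y) + (\<Sum>i\<le>N. \<bar>x i - x' i\<bar>)" for x x' :: "nat \<Rightarrow> real"
    proof -
      have "Min ((\<lambda>y. a y + (\<Sum>i\<le>N. \<bar>x' i - y (?t i)\<bar>)) ` Y) \<in> (\<lambda>y. a y + (\<Sum>i\<le>N. \<bar>x' i - y (?t i)\<bar>)) ` Y"
        using Y by (intro Min_in) auto
      then obtain y where y: "y \<in> Y" "Min ((\<lambda>y. a y + (\<Sum>i\<le>N. \<bar>x' i - y (?t i)\<bar>)) ` Y) = a y + (\<Sum>i\<le>N. \<bar>x' i - y (?t i)\<bar>)"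
        by auto
      have "Min ((\<lambda>y. a y + (\<Sum>i\<le>N. \<bar>x i - y (?t i)\<bar>)) ` Y) \<le> a y + (\<Sum>i\<le>N. \<bar>x i - y (?t i)\<bar>)"
        using Y y(1) by (intro Min_le) auto
      also have "(\<Sum>i\<le>N. \<bar>x i - y (?t i)\<bar>) \<le> (\<Sum>i\<le>N. \<bar>x' i - y (?t i)\<bar> + \<bar>x i - x' i\<bar>)"
        by (intro sum_mono) auto
      finally show ?thesis unfolding y(2) by (simp add: sum.distrib)
    qed
    show "\<bar>X x - X x'\<bar> \<le> 1 * (\<Sum>i\<le>N. \<bar>x i - x' i\<bar>)" for x x'
    proof -
      have "(\<Sum>i\<le>N. \<bar>x' i - x i\<bar>) = (\<Sum>i\<le>N. \<bar>x i - x' i\<bar>)" by (simp add: abs_minus_commute)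
      moreover have "\<bar>max (- 1) (min 1 p) - max (- 1) (min 1 q)\<bar> \<le> s" if "p \<le> q + s" "q \<le> p + s" for p q s :: real
        using that by (auto simp: max_def min_def)
      ultimately show ?thesis using le[of x x'] le[of x' x] by (simp add: X_def)
    qed
  qed
  from cyl_reindex[OF _ this, of ?t] have "(\<lambda>\<omega>. X (\<lambda>i. \<omega> (?t i))) \<in> cyl (?t ` {..N})" by simp
  then show ?thesis
    using grid_pt_mem[OF T] T by (intro cyl_subset_Lip[of "?t ` {..N}"]) (auto simp: X_def net_fun_def[abs_def])
qed

text \<open>Upper bound: \<open>f \<omega>\<close> and \<open>f y\<close> differ by at most
  \<open>3 * e\<close>, two from the moduli and one from the code, and the penalty sum at
  \<open>y\<close> is at most \<open>e\<close> because the code cells have width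
  \<open>e / (N + 1)\<close>. Lower bound: each candidate \<open>y'\<close> pays in its penalty for
  the grid distance, which leaves the moduli and the rounding of \<open>a\<close>. Truncation is
  harmless as \<open>f\<close> is bounded by 1.\<close>

lemma net_fun_approx:
  assumes T: "0 < T" "0 < N" and e: "0 < e" and Y: "finite Y"
    and mod: "\<And>y. y \<in> insert \<omega> Y \<Longrightarrow> y \<in> path_space T \<and> path_modulus T N e y"
    and f: "BL_norm T f \<le> 1"
    and a: "\<And>y. y \<in> Y \<Longrightarrow> a y \<le> f y \<and> f y \<le> a y + e"
    and y: "y \<in> Y" "path_code T N (e / real (Suc N)) \<omega> = path_code T N (e / real (Suc N)) y"
  shows "\<bar>f \<omega> - net_fun T N Y a \<omega>\<bar> \<le> 4 * e"
proof -
  let ?S = "\<lambda>y. \<Sum>i\<le>N. \<bar>\<omega> (grid_pt T N i) - y (grid_pt T N i)\<bar>"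
  let ?m = "Min ((\<lambda>y. a y + ?S y) ` Y)"
  have w: "\<omega> \<in> path_space T" "path_modulus T N e \<omega>" using mod by auto
  have "0 < e / real (Suc N)" using e by simp
  from path_code_eq_imp_le[OF y(2) _ this]
  have cl: "\<bar>\<omega> (grid_pt T N i) - y (grid_pt T N i)\<bar> \<le> e / real (Suc N)" if "i \<le> N" for i using that .
  have "?S y \<le> (\<Sum>i\<le>N. e / real (Suc N))" using cl by (intro sum_mono) auto
  also have "\<dots> = e" by simp
  finally have S: "?S y \<le> e" .
  have "e / real (Suc N) \<le> e / 1" using e by (intro divide_left_mono) auto
  then have "mdist (path_metric T) \<omega> y \<le> 2 * e + e"
    using mod[of y] y(1) w e cl by (intro path_dist_le_grid[OF T w(2)]) (auto intro: order_trans)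
  then have "\<bar>f \<omega> - f y\<bar> \<le> 3 * e" using BL_norm_le_1D(2)[OF f w(1), of y] mod[of y] y(1) by simp
  moreover have "?m \<le> a y + ?S y" using Y y(1) by (intro Min_le) auto
  ultimately have up: "?m \<le> f \<omega> + 4 * e" using S a[OF y(1)] by linarith
  have "f \<omega> - 4 * e \<le> ?m"
  proof (rule Min.boundedI)
    fix z assume "z \<in> (\<lambda>y. a y + ?S y) ` Y"
    then obtain y' where y': "y' \<in> Y" "z = a y' + ?S y'" by blast
    have "mdist (path_metric T) \<omega> y' \<le> 2 * e + ?S y'"
    proof (rule path_dist_le_grid[OF T w(2)])
      show "\<bar>\<omega> (grid_pt T N i) - y' (grid_pt T N i)\<bar> \<le> ?S y'" if "i \<le> N" for i
        by (rule member_le_sum[where f = "\<lambda>i. \<bar>\<omega> (grid_pt T N i) - y' (grid_pt T N i)\<bar>"]) (use that in auto)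
    qed (use mod[of y'] y' e in \<open>auto intro: sum_nonneg\<close>)
    then have "\<bar>f \<omega> - f y'\<bar> \<le> 2 * e + ?S y'"
      using BL_norm_le_1D(2)[OF f w(1), of y'] mod[of y'] y'(1) by simp
    then show "f \<omega> - 4 * e \<le> z" using a[OF y'(1)] e unfolding y'(2) by linarith
  qed (use Y y in auto)
  moreover have "\<bar>f \<omega>\<bar> \<le> 1" using BL_norm_le_1D(1)[OF f w(1)] .
  ultimately show ?thesis using up e unfolding net_fun_def by (auto simp: max_def min_def)
qed

context lip_expectation
begin

lemma dominated_integral_le: "P \<in> \<P> \<Longrightarrow> X \<in> Lip T \<Longrightarrow> (integral\<^sup>L P X) \<le> E X"
  by (simp add: Lip_dominated_def)

text \<open>Under a dominated measure the coordinate process itself satisfies the moment bound of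
  Kolmogorov's argument, with a constant that does not depend on the measure.\<close>

lemma dominated_tight:
  fixes k0 :: nat
  assumes P: "P \<in> \<P>"
  defines "K \<equiv> {\<omega> \<in> path_space T. dyadic_regular T k0 \<omega> \<and> \<bar>\<omega> 0\<bar> \<le> 1}"
  shows "K \<in> sets (path_borel T)"
    and "measure P (path_space T - K) \<le> M * T\<^sup>2 * (6561 / 1561) * (5000 / 6561) ^ k0"
proof -
  have PP: "P \<in> path_probs T" by (rule Lip_dominated_path_probs[OF P])
  interpret prob_space P using path_probsD(1)[OF PP] .
  have T0: "0 \<le> T" "0 \<in> {0..T}" using T_pos by auto
  note [simp] = path_probsD(2-4)[OF PP]
  have ev: "(\<lambda>\<omega>. \<omega> t) \<in> borel_measurable (path_borel T)" if "t \<in> {0..T}" for t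
    by (rule path_eval_measurable[OF that])
  have dsub: "t \<in> {0..T}" if "t \<in> dyadic_times T" for t using dyadic_times_subset[OF T_pos] that by blast
  have meas: "(\<lambda>\<omega>. \<omega> t) \<in> borel_measurable P" if "t \<in> dyadic_times T" for t using ev[OF dsub[OF that]] by simp
  have mom: "(\<integral>\<omega>. min \<bar>\<omega> t - \<omega> s\<bar> k ^ 4 \<partial>P) \<le> M * (t - s)\<^sup>2"
    if st: "s \<in> dyadic_times T" "t \<in> dyadic_times T" and k: "0 \<le> k" for s t k
  proof -
    have st': "s \<in> {0..T}" "t \<in> {0..T}" using st dsub by auto
    have "(\<lambda>\<omega>. min \<bar>\<omega> t - \<omega> s\<bar> k ^ 4) \<in> Lip T"
      by (rule cyl_subset_Lip[OF _ _ T0(1) cyl_min_power4(1)[OF k]]) (use st' in auto)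
    from dominated_integral_le[OF P this] show ?thesis using E_incr[OF st' k] by linarith
  qed
  note irr = prob_dyadic_irregular[of T M "\<lambda>t \<omega>. \<omega> t" k0, OF T_pos M_nonneg meas mom, simplified]
  have c0: "(\<lambda>\<omega>. min \<bar>\<omega> 0\<bar> 1 ^ 4) \<in> Lip T"
    by (rule cyl_subset_Lip[OF _ _ T0(1) cyl_min_power4(2)]) (use T0 in auto)
  \<comment> \<open>At time 0 the moment bound is 0, so the condition on \<open>\<omega> 0\<close>
    fails with probability 0 and does not enter the final estimate.\<close>
  have m0: "prob {\<omega> \<in> space P. 1 < \<bar>\<omega> 0\<bar>} \<le> 0 / 1 ^ 4"
    using dominated_integral_le[OF P c0] E_coord[OF T0(2), of 1] ev[OF T0(2)]
    by (intro prob_greater_le_fourth_moment) auto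
  have s0: "{\<omega> \<in> path_space T. 1 < \<bar>\<omega> 0\<bar>} \<in> sets P"
    using ev[OF T0(2)] borel_measurable_less[of "\<lambda>_. 1" P "\<lambda>\<omega>. \<bar>\<omega> 0\<bar>"] by simp
  have s1: "{\<omega> \<in> path_space T. \<not> dyadic_regular T k0 \<omega>} \<in> sets P"
    using sets.sets_Collect_neg[of P "\<lambda>\<omega>. dyadic_regular T k0 \<omega>"] irr(1) by simp
  have eq: "path_space T - K = {\<omega> \<in> path_space T. \<not> dyadic_regular T k0 \<omega>} \<union> {\<omega> \<in> path_space T. 1 < \<bar>\<omega> 0\<bar>}"
    by (auto simp: K_def)
  have "K = path_space T - (path_space T - K)" by (auto simp: K_def)
  also have "\<dots> \<in> sets P" unfolding eq using s0 s1 sets.compl_sets[of _ P] by auto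
  finally show "K \<in> sets (path_borel T)" by simp
  have "prob (path_space T - K) \<le> prob {\<omega> \<in> path_space T. \<not> dyadic_regular T k0 \<omega>} + prob {\<omega> \<in> path_space T. 1 < \<bar>\<omega> 0\<bar>}"
    unfolding eq by (rule measure_Un_le[OF s1 s0])
  then show "prob (path_space T - K) \<le> M * T\<^sup>2 * (6561 / 1561) * (5000 / 6561) ^ k0"
    using irr(2) m0 by simp
qed

text \<open>Uniform tightness reduces to equicontinuous paths, on which the bounded Lipschitz ball is
  totally bounded.\<close>

lemma BL_dist_controlled:
  assumes \<epsilon>: "0 < \<epsilon>"
  obtains F \<delta> where "finite F" "F \<subseteq> Lip T" "0 < \<delta>"
    "\<And>P Q. P \<in> \<P> \<Longrightarrow> Q \<in> \<P> \<Longrightarrow>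
       (\<And>X. X \<in> F \<Longrightarrow> \<bar>(integral\<^sup>L P X) - (integral\<^sup>L Q X)\<bar> < \<delta>) \<Longrightarrow> BL_dist T P Q \<le> \<epsilon>"
proof -
  \<comment> \<open>13 = 2 * 6 + 1: replacing \<open>f\<close> by the net function costs
    \<open>4 * e\<close> on \<open>K\<close> and \<open>2 * e\<close> off \<open>K\<close> under
    each of the two measures, and the test on the net function costs \<open>e\<close>.\<close>
  define e where "e = \<epsilon> / 13"
  have e: "0 < e" using \<epsilon> by (simp add: e_def)
  obtain k0 where k0: "M * T\<^sup>2 * (6561 / 1561) * (5000 / 6561) ^ k0 < e" using geometric_bound_small[OF e] by blast
  obtain m where m: "m \<ge> k0" "19 * (9 / 10 :: real) ^ m < e" using power_9_10_small[OF e] by blast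
  define N :: nat where "N = 2 ^ m"
  have N: "0 < N" by (simp add: N_def)
  define c where "c = e / real (Suc N)"
  have c: "0 < c" using e by (simp add: c_def)
  define K where "K = {\<omega> \<in> path_space T. dyadic_regular T k0 \<omega> \<and> \<bar>\<omega> 0\<bar> \<le> 1}"
  have Kmod: "\<omega> \<in> path_space T \<and> path_modulus T N e \<omega>" if "\<omega> \<in> K" for \<omega>
    using dyadic_regular_path_modulus[OF T_pos, of \<omega> k0 m] that m by (fastforce simp: K_def N_def path_modulus_def)
  define code where "code = path_code T N c"
  have fin: "finite (code ` K)" unfolding code_def
  proof (rule finite_path_codes[OF c, where R = "1 + real N"])
    fix \<omega> i assume "\<omega> \<in> K" "i \<le> N"
    then have "\<bar>\<omega> (grid_pt T N i)\<bar> \<le> 1 + real i"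
      using dyadic_regular_bound[of T k0 \<omega> m i] m(1) by (simp add: K_def N_def)
    then show "\<bar>\<omega> (grid_pt T N i)\<bar> \<le> 1 + real N" using \<open>i \<le> N\<close> by simp
  qed
  \<comment> \<open>The zero path shows that \<open>K\<close>, and hence the net, is nonempty, as
    the minimum in \<open>net_fun\<close> requires.\<close>
  define y0 :: "real \<Rightarrow> real" where "y0 = restrict (\<lambda>_. 0) {0..T}"
  have y0: "y0 \<in> K"
  proof -
    have "continuous_on {0..T} y0 \<longleftrightarrow> continuous_on {0..T} (\<lambda>_. 0 :: real)"
      by (intro continuous_on_cong) (auto simp: y0_def)
    moreover have "y0 t = 0" if "t \<in> {0..T}" for t using that by (simp add: y0_def)
    moreover have "dyadic_regular T k0 y0"
      unfolding dyadic_regular_def using grid_pt_mem[OF T_pos] by (simp add: y0_def Suc_le_eq)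
    ultimately show ?thesis using T_pos by (auto simp: K_def path_space_iff y0_def)
  qed
  \<comment> \<open>One representative in \<open>K\<close> for each of the finitely many
    codes.\<close>
  define Y where "Y = inv_into K code ` code ` K"
  have Y: "finite Y" "Y \<subseteq> K" "Y \<noteq> {}" using fin y0 by (auto simp: Y_def inv_into_into)
  have rep: "\<exists>y\<in>Y. code \<omega> = code y" if "\<omega> \<in> K" for \<omega>
    using that f_inv_into_f[of "code \<omega>" code K] by (intro bexI[of _ "inv_into K code (code \<omega>)"]) (auto simp: Y_def)
  \<comment> \<open>The values of \<open>f\<close> on the net are rounded down to multiples of
    \<open>e\<close>. As \<open>f\<close> is bounded by 1, the multiples from \<open>- n\<close> to
    \<open>n\<close> suffice, and only finitely many rounded functions \<open>a\<close>
    remain.\<close>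
  define n where "n = \<lceil>1 / e\<rceil> + 1"
  define A where "A = (Y \<rightarrow>\<^sub>E (\<lambda>j. e * real_of_int j) ` {- n..n})"
  have A: "finite A" unfolding A_def using Y(1) by (intro finite_PiE) auto
  show thesis
  proof (rule that[of "net_fun T N Y ` A" e])
    show "finite (net_fun T N Y ` A)" using A by simp
    show "net_fun T N Y ` A \<subseteq> Lip T" using net_fun_Lip[OF T_pos Y(1,3)] by blast
    fix P Q assume PQ: "P \<in> \<P>" "Q \<in> \<P>"
      and close: "\<And>X. X \<in> net_fun T N Y ` A \<Longrightarrow> \<bar>(integral\<^sup>L P X) - (integral\<^sup>L Q X)\<bar> < e"
    have PP: "P \<in> path_probs T" "Q \<in> path_probs T" using PQ Lip_dominated_path_probs by auto
    show "BL_dist T P Q \<le> \<epsilon>"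
    proof (rule BL_dist_le[OF PP])
      fix f assume f: "BL_norm T f \<le> 1"
      define a where "a = restrict (\<lambda>y. e * real_of_int \<lfloor>f y / e\<rfloor>) Y"
      have aA: "a \<in> A" unfolding A_def
      proof (intro PiE_I)
        fix y assume y: "y \<in> Y"
        then have "\<bar>f y\<bar> \<le> 1" using BL_norm_le_1D(1)[OF f] Y(2) Kmod by blast
        then have "\<bar>f y / e\<bar> \<le> 1 / e" using e by (simp add: abs_divide divide_right_mono)
        then have "\<lfloor>f y / e\<rfloor> \<in> {- n..n}" unfolding n_def by (simp, linarith)
        then show "a y \<in> (\<lambda>j. e * real_of_int j) ` {- n..n}" using y by (auto simp: a_def)
      qed (simp add: a_def)
      have a: "a y \<le> f y \<and> f y \<le> a y + e" if "y \<in> Y" for y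
      proof -
        have "real_of_int \<lfloor>f y / e\<rfloor> \<le> f y / e" "f y / e \<le> real_of_int \<lfloor>f y / e\<rfloor> + 1" by linarith+
        then have "real_of_int \<lfloor>f y / e\<rfloor> * e \<le> f y" "f y \<le> (real_of_int \<lfloor>f y / e\<rfloor> + 1) * e"
          using e by (simp_all only: pos_le_divide_eq pos_divide_le_eq)
        then show ?thesis using that by (simp add: a_def algebra_simps)
      qed
      let ?g = "net_fun T N Y a"
      have gL: "?g \<in> Lip T" by (rule net_fun_Lip[OF T_pos Y(1,3)])
      have approx: "\<bar>f \<omega> - ?g \<omega>\<bar> \<le> 4 * e" if w: "\<omega> \<in> K" for \<omega>
      proof -
        obtain y where y: "y \<in> Y" "code \<omega> = code y" using rep[OF w] by blast
        show ?thesis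
          by (rule net_fun_approx[OF T_pos N e Y(1) _ f a y(1)])
            (use Kmod w Y(2) y(2) in \<open>auto simp: code_def c_def\<close>)
      qed
      have g1: "\<bar>?g \<omega>\<bar> \<le> 1" for \<omega> by (auto simp: net_fun_def)
      have diff: "\<bar>(integral\<^sup>L R f) - (integral\<^sup>L R ?g)\<bar> \<le> 6 * e" if R: "R \<in> \<P>" for R
      proof -
        have RR: "R \<in> path_probs T" by (rule Lip_dominated_path_probs[OF R])
        interpret R: prob_space R using path_probsD(1)[OF RR] .
        note [simp] = path_probsD(2-4)[OF RR]
        have Km: "K \<in> sets R" using dominated_tight(1)[OF R, of k0] by (simp add: K_def)
        have Bm: "path_space T - K \<in> sets R" using sets.compl_sets[OF Km] by simp
        have i: "integrable R f" "integrable R ?g"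
          using BL_integrable(1)[OF RR f] Lip_integrable[OF T_pos RR gL] by auto
        have iB: "integrable R (\<lambda>\<omega>. 4 * e + 2 * indicator (path_space T - K) \<omega>)"
          using Bm by (intro Bochner_Integration.integrable_add integrable_mult_right integrable_real_indicator)
            (auto simp: R.emeasure_eq_measure)
        have "\<bar>(integral\<^sup>L R f) - (integral\<^sup>L R ?g)\<bar> = \<bar>\<integral>\<omega>. f \<omega> - ?g \<omega> \<partial>R\<bar>" using i by simp
        also have "\<dots> \<le> (\<integral>\<omega>. \<bar>f \<omega> - ?g \<omega>\<bar> \<partial>R)" by (rule integral_abs_bound)
        also have "\<dots> \<le> (\<integral>\<omega>. 4 * e + 2 * indicator (path_space T - K) \<omega> \<partial>R)"
        proof (rule integral_mono)
          fix \<omega> assume "\<omega> \<in> space R"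
          then have w: "\<omega> \<in> path_space T" by simp
          show "\<bar>f \<omega> - ?g \<omega>\<bar> \<le> 4 * e + 2 * indicator (path_space T - K) \<omega>"
          proof (cases "\<omega> \<in> K")
            case False
            have "\<bar>f \<omega> - ?g \<omega>\<bar> \<le> 2" using BL_norm_le_1D(1)[OF f w] g1[of \<omega>] by linarith
            then show ?thesis using False w e by simp
          qed (use approx in auto)
        qed (use i iB in auto)
        also have "\<dots> = 4 * e + 2 * R.prob (path_space T - K)"
          using Bm by (subst Bochner_Integration.integral_add)
            (auto simp: R.prob_space[simplified] R.emeasure_eq_measure Int_absorb2 intro!: integrable_mult_right integrable_real_indicator)
        also have "\<dots> \<le> 6 * e" using dominated_tight(2)[OF R, of k0] k0 by (simp add: K_def)
        finally show ?thesis .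
      qed
      have "\<bar>(integral\<^sup>L P ?g) - (integral\<^sup>L Q ?g)\<bar> < e" using close aA by blast
      then have "(integral\<^sup>L P f) - (integral\<^sup>L Q f) \<le> 13 * e" using diff[OF PQ(1)] diff[OF PQ(2)] by linarith
      then show "(integral\<^sup>L P f) - (integral\<^sup>L Q f) \<le> \<epsilon>" by (simp add: e_def)
    qed
  qed (rule e)
qed

text \<open>A linear functional below \<open>E\<close> satisfies the axioms of the locale with the
  same \<open>M\<close>, so the extension and representation theorems apply with it in the place of
  \<open>E\<close>. The extension lies below it on cylinder functions and, tested on
  \<open>- X\<close>, also above.\<close>

lemma linear_dominated_represented:
  assumes L: "\<And>X Y. X \<in> Lip T \<Longrightarrow> Y \<in> Lip T \<Longrightarrow> L (\<lambda>\<omega>. X \<omega> + Y \<omega>) = L X + L Y"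
    "\<And>X c. X \<in> Lip T \<Longrightarrow> L (\<lambda>\<omega>. c * X \<omega>) = c * L X" "\<And>X. X \<in> Lip T \<Longrightarrow> L X \<le> E X"
  shows "\<exists>P\<in>\<P>. \<forall>X\<in>Lip T. (integral\<^sup>L P X) = L X"
proof -
  have T0: "0 \<le> T" using T_pos by simp
  have sc: "(\<lambda>\<omega>. c * X \<omega>) \<in> Lip T" if "X \<in> Lip T" for c X by (rule Lip_comp2[OF T0 that that loc_lip2_scale])
  have c: "L (\<lambda>_. c) \<le> c" for c using L(3)[OF Lip_const[OF T0, of c]] E_const by simp
  have "L (\<lambda>_. -1 * c) = -1 * L (\<lambda>_. c)" for c by (rule L(2)[OF Lip_const[OF T0]])
  then have const: "L (\<lambda>_. c) = c" for c using c[of c] c[of "-c"] by (metis add.inverse_inverse minus_le_iff mult_minus1 order_antisym)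
  interpret L: lip_expectation T M L
  proof
    fix X Y assume XY: "X \<in> Lip T" "Y \<in> Lip T" "\<And>\<omega>. X \<omega> \<le> Y \<omega>"
    have d: "(\<lambda>\<omega>. X \<omega> + -1 * Y \<omega>) \<in> Lip T" by (rule Lip_comp2[OF T0 XY(1) sc[OF XY(2)] loc_lip2_add])
    have "L X - L Y = L (\<lambda>\<omega>. X \<omega> + -1 * Y \<omega>)" using L(1)[OF XY(1) sc[OF XY(2)], of "-1"] L(2)[OF XY(2), of "-1"] by simp
    also have "\<dots> \<le> E (\<lambda>\<omega>. X \<omega> + -1 * Y \<omega>)" by (rule L(3)[OF d])
    also have "\<dots> \<le> E (\<lambda>_. 0)" using XY(3) by (intro E_mono d Lip_const T0) auto
    finally show "L X \<le> L Y" by (simp add: E_const)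
  next
    fix s t k :: real assume st: "s \<in> {0..T}" "t \<in> {0..T}" and k: "0 \<le> k"
    have "(\<lambda>\<omega>. min \<bar>\<omega> t - \<omega> s\<bar> k ^ 4) \<in> Lip T"
      by (rule cyl_subset_Lip[OF _ _ T0 cyl_min_power4(1)[OF k]]) (use st in auto)
    then show "L (\<lambda>\<omega>. min \<bar>\<omega> t - \<omega> s\<bar> k ^ 4) \<le> M * (t - s)\<^sup>2" using L(3) E_incr[OF st k] order_trans by blast
  next
    fix t k :: real assume t: "t \<in> {0..T}" and k: "0 \<le> k"
    have "(\<lambda>\<omega>. min \<bar>\<omega> t\<bar> k ^ 4) \<in> Lip T"
      by (rule cyl_subset_Lip[OF _ _ T0 cyl_min_power4(2)[OF k]]) (use t in auto)
    then show "L (\<lambda>\<omega>. min \<bar>\<omega> t\<bar> k ^ 4) \<le> M * t\<^sup>2" using L(3) E_coord[OF t k] order_trans by blast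
  qed (use L const T_pos M_nonneg in auto)
  obtain L' where L': "positive_functional L'" "\<And>X. X \<in> Lip T \<Longrightarrow> L' X \<le> L X"
    using L.functional_below[OF Lip_const[OF T0, of 0]] by blast
  interpret L': positive_functional L' by fact
  have eq: "L' X = L X" if X: "X \<in> Lip T" for X
    using L'(2)[OF X] L'(2)[OF sc[OF X, of "-1"]] L(2)[OF X, of "-1"] L'.L_scale[of X "-1"]
      Lip_subset_bounded_funs X by fastforce
  obtain P where P: "P \<in> path_probs T" "\<And>X. X \<in> Lip T \<Longrightarrow> (integral\<^sup>L P X) = L' X"
    using L.functional_represented[OF L'] by blast
  then show ?thesis using eq L(3) by (intro bexI[of _ P]) (auto simp: Lip_dominated_def)
qed

text \<open>Linear functionals below \<open>E\<close> form a closed subset of a product of compact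
  intervals. The map to representing measures is continuous because finitely many coordinates
  control the metric, and onto because a measure and the one chosen for its functional have the same
  integrals of cylinder functions, hence distance 0.\<close>

theorem Lip_dominated_compact:
  "compactin (Metric_space.mtopology (\<P>) (BL_dist T)) (\<P>)"
proof -
  let ?PP = "\<P>"
  have T0: "0 \<le> T" using T_pos by simp
  have PPsub: "?PP \<subseteq> path_probs T" by (auto simp: Lip_dominated_def)
  interpret B: Metric_space ?PP "BL_dist T" by (rule BL_dist_Metric_space[OF PPsub])
  let ?prod = "product_topology (\<lambda>_. euclideanreal) (Lip T)"
  have sc: "(\<lambda>\<omega>. c * X \<omega>) \<in> Lip T" if "X \<in> Lip T" for c X by (rule Lip_comp2[OF T0 that that loc_lip2_scale])
  have ad: "(\<lambda>\<omega>. X \<omega> + Y \<omega>) \<in> Lip T" if "X \<in> Lip T" "Y \<in> Lip T" for X Y by (rule Lip_comp2[OF T0 that loc_lip2_add])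
  \<comment> \<open>The lower end comes from \<open>L (- X) \<le> E (- X)\<close> and
    linearity.\<close>
  define box where "box = (\<Pi>\<^sub>E X\<in>Lip T. {- E (\<lambda>\<omega>. -1 * X \<omega>)..E X})"
  \<comment> \<open>Each instance of linearity is the preimage of the closed set \<open>{0}\<close>
    under a continuous function of finitely many coordinates.\<close>
  define addS where "addS = (\<lambda>(X, Y). {L \<in> topspace ?prod. L (\<lambda>\<omega>. X \<omega> + Y \<omega>) - (L X + L Y) \<in> {0 :: real}})"
  define scS where "scS = (\<lambda>(c :: real, X). {L \<in> topspace ?prod. L (\<lambda>\<omega>. c * X \<omega>) - c * L X \<in> {0 :: real}})"
  define \<Lambda> where "\<Lambda> = (box \<inter> \<Inter> (addS ` (Lip T \<times> Lip T))) \<inter> \<Inter> (scS ` (UNIV \<times> Lip T))"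
  have proj: "continuous_map ?prod euclideanreal (\<lambda>L. L X)" if "X \<in> Lip T" for X
    using continuous_map_product_projection[OF that, of "\<lambda>_. euclideanreal"] by simp
  have boxc: "compactin ?prod box"
    unfolding box_def by (subst compactin_PiE) (auto simp: compactin_euclidean_iff)
  have L0: "(\<lambda>_. 0) \<in> Lip T" by (rule Lip_const[OF T0])
  have "closedin ?prod (addS (X, Y))" if "X \<in> Lip T" "Y \<in> Lip T" for X Y
    unfolding addS_def prod.case using that
    by (intro closedin_continuous_map_preimage[of _ euclideanreal] continuous_map_diff continuous_map_add proj ad) auto
  then have ca: "closedin ?prod (\<Inter> (addS ` (Lip T \<times> Lip T)))"
    using L0 by (intro closedin_Inter) auto
  have "closedin ?prod (scS (c, X))" if "X \<in> Lip T" for c X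
    unfolding scS_def prod.case using that
    by (intro closedin_continuous_map_preimage[of _ euclideanreal] continuous_map_diff continuous_map_real_mult_left proj sc) auto
  then have cs: "closedin ?prod (\<Inter> (scS ` (UNIV \<times> Lip T)))"
    using L0 by (intro closedin_Inter) auto
  have \<Lambda>c: "compactin ?prod \<Lambda>"
    unfolding \<Lambda>_def by (intro compact_Int_closedin boxc ca cs)
  have \<Lambda>D: "\<exists>P\<in>?PP. \<forall>X\<in>Lip T. (integral\<^sup>L P X) = L X" if L: "L \<in> \<Lambda>" for L
  proof (rule linear_dominated_represented)
    show "L (\<lambda>\<omega>. X \<omega> + Y \<omega>) = L X + L Y" if "X \<in> Lip T" "Y \<in> Lip T" for X Y
      using L that by (auto simp: \<Lambda>_def addS_def)
    show "L (\<lambda>\<omega>. c * X \<omega>) = c * L X" if "X \<in> Lip T" for c X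
      using L that by (auto simp: \<Lambda>_def scS_def)
    show "L X \<le> E X" if "X \<in> Lip T" for X
      using L PiE_mem[of L "Lip T" _ X] that by (auto simp: \<Lambda>_def box_def)
  qed
  define \<Phi> where "\<Phi> = (\<lambda>L. SOME P. P \<in> ?PP \<and> (\<forall>X\<in>Lip T. (integral\<^sup>L P X) = L X))"
  have \<Phi>: "\<Phi> L \<in> ?PP \<and> (\<forall>X\<in>Lip T. (integral\<^sup>L (\<Phi> L) X) = L X)" if "L \<in> \<Lambda>" for L
    unfolding \<Phi>_def by (rule someI_ex) (use \<Lambda>D[OF that] in blast)
  have cont: "continuous_map (subtopology ?prod \<Lambda>) B.mtopology \<Phi>"
    unfolding B.continuous_map_to_metric
  proof (intro ballI allI impI)
    fix L \<epsilon> assume "L \<in> topspace (subtopology ?prod \<Lambda>)" and \<epsilon>: "0 < (\<epsilon> :: real)"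
    then have L: "L \<in> \<Lambda>" "L \<in> topspace ?prod" by auto
    obtain F \<delta> where F: "finite F" "F \<subseteq> Lip T" "0 < \<delta>"
      "\<And>P Q. P \<in> ?PP \<Longrightarrow> Q \<in> ?PP \<Longrightarrow> (\<And>X. X \<in> F \<Longrightarrow> \<bar>(integral\<^sup>L P X) - (integral\<^sup>L Q X)\<bar> < \<delta>) \<Longrightarrow> BL_dist T P Q \<le> \<epsilon> / 2"
      using BL_dist_controlled[of "\<epsilon> / 2"] \<epsilon> by auto
    \<comment> \<open>The intersection with the whole space covers the case of empty
      \<open>F\<close>.\<close>
    define W where "W = topspace ?prod \<inter> \<Inter> ((\<lambda>X. {L' \<in> topspace ?prod. L' X \<in> {L X - \<delta><..<L X + \<delta>}}) ` F)"
    have "openin ?prod W" unfolding W_def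
    proof (cases "F = {}")
      case False
      have "openin ?prod (\<Inter> ((\<lambda>X. {L' \<in> topspace ?prod. L' X \<in> {L X - \<delta><..<L X + \<delta>}}) ` F))"
      proof (intro openin_Inter ballI)
        fix S assume "S \<in> (\<lambda>X. {L' \<in> topspace ?prod. L' X \<in> {L X - \<delta><..<L X + \<delta>}}) ` F"
        then obtain X where X: "X \<in> F" "S = {L' \<in> topspace ?prod. L' X \<in> {L X - \<delta><..<L X + \<delta>}}" by blast
        show "openin ?prod S" unfolding X(2) using X(1) F(2)
          by (intro openin_continuous_map_preimage[OF proj]) (auto simp del: greaterThanLessThan_iff)
      qed (use F(1) False in auto)
      then show "openin ?prod (topspace ?prod \<inter> \<Inter> ((\<lambda>X. {L' \<in> topspace ?prod. L' X \<in> {L X - \<delta><..<L X + \<delta>}}) ` F))"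
        by (intro openin_Int openin_topspace)
    next
      case True
      then show "openin ?prod (topspace ?prod \<inter> \<Inter> ((\<lambda>X. {L' \<in> topspace ?prod. L' X \<in> {L X - \<delta><..<L X + \<delta>}}) ` F))"
        using openin_topspace[of ?prod] by simp
    qed
    then have "openin (subtopology ?prod \<Lambda>) (W \<inter> \<Lambda>)" by (rule openin_subtopology_Int)
    moreover have "L \<in> W \<inter> \<Lambda>" using L F(3) by (auto simp: W_def)
    moreover have "\<Phi> L' \<in> B.mball (\<Phi> L) \<epsilon>" if L': "L' \<in> W \<inter> \<Lambda>" for L'
    proof -
      have "BL_dist T (\<Phi> L) (\<Phi> L') \<le> \<epsilon> / 2"
      proof (rule F(4))
        fix X assume X: "X \<in> F"
        then have "L' X \<in> {L X - \<delta><..<L X + \<delta>}" using L' by (auto simp: W_def)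
        then show "\<bar>(integral\<^sup>L (\<Phi> L) X) - (integral\<^sup>L (\<Phi> L') X)\<bar> < \<delta>"
          using \<Phi>[OF L(1)] \<Phi>[of L'] L' X F(2) by (auto simp: abs_less_iff)
      qed (use \<Phi> L L' in auto)
      then show ?thesis using \<Phi>[OF L(1)] \<Phi>[of L'] L' \<epsilon> by auto
    qed
    ultimately show "\<exists>U. openin (subtopology ?prod \<Lambda>) U \<and> L \<in> U \<and> (\<forall>y\<in>U. \<Phi> y \<in> B.mball (\<Phi> L) \<epsilon>)" by blast
  qed
  have "\<Phi> ` \<Lambda> = ?PP"
  proof (intro equalityI subsetI)
    fix P assume P: "P \<in> ?PP"
    define L where "L = restrict (\<lambda>X. \<integral>\<omega>. X \<omega> \<partial>P) (Lip T)"
    have int: "integrable P X" if "X \<in> Lip T" for X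
      by (rule Lip_integrable[OF T_pos Lip_dominated_path_probs[OF P] that])
    have low: "- E (\<lambda>\<omega>. -1 * X \<omega>) \<le> (integral\<^sup>L P X)" if "X \<in> Lip T" for X
      using dominated_integral_le[OF P sc[OF that, of "-1"]] by simp
    have "L \<in> \<Lambda>" unfolding \<Lambda>_def box_def addS_def scS_def L_def
      using sc ad int low dominated_integral_le[OF P] by auto
    moreover from this have "BL_dist T P (\<Phi> L) \<le> \<epsilon>" if "0 < \<epsilon>" for \<epsilon>
    proof -
      obtain F \<delta> where F: "F \<subseteq> Lip T" "0 < (\<delta> :: real)"
        "\<And>P Q. P \<in> ?PP \<Longrightarrow> Q \<in> ?PP \<Longrightarrow> (\<And>X. X \<in> F \<Longrightarrow> \<bar>(integral\<^sup>L P X) - (integral\<^sup>L Q X)\<bar> < \<delta>) \<Longrightarrow> BL_dist T P Q \<le> \<epsilon>"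
        using BL_dist_controlled[OF \<open>0 < \<epsilon>\<close>] by metis
      show ?thesis
        by (rule F(3)) (use P \<Phi>[OF \<open>L \<in> \<Lambda>\<close>] F(1,2) in \<open>auto simp: L_def subset_iff\<close>)
    qed
    then have "BL_dist T P (\<Phi> L) \<le> 0" by (rule field_le_epsilon[where y = 0, simplified])
    then have "P = \<Phi> L" using P \<Phi>[OF \<open>L \<in> \<Lambda>\<close>] B.nonneg[of P "\<Phi> L"] B.zero[of P "\<Phi> L"] by auto
    ultimately show "P \<in> \<Phi> ` \<Lambda>" by blast
  qed (use \<Phi> in auto)
  moreover have "compactin (subtopology ?prod \<Lambda>) \<Lambda>" using \<Lambda>c by (simp add: compactin_subtopology)
  ultimately show ?thesis using image_compactin[OF _ cont] by metis
qed

end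

subsection \<open>The spaces LG\<close>

lemma power_abs_add_le: "\<bar>a + b\<bar> ^ p \<le> 2 ^ p * (\<bar>a\<bar> ^ p + \<bar>b\<bar> ^ p)" for a b :: real
proof -
  define m where "m = max \<bar>a\<bar> \<bar>b\<bar>"
  have "\<bar>a + b\<bar> ^ p \<le> (2 * m) ^ p" by (rule power_mono) (auto simp: m_def)
  also have "\<dots> = 2 ^ p * m ^ p" by (simp add: power_mult_distrib)
  also have "\<dots> \<le> 2 ^ p * (\<bar>a\<bar> ^ p + \<bar>b\<bar> ^ p)" by (intro mult_left_mono) (auto simp: m_def max_def)
  finally show ?thesis .
qed

text \<open>Takes the place of the Cauchy--Schwarz inequality in passing from second to first
  moments.\<close>

lemma abs_le_add_square: "0 < \<delta> \<Longrightarrow> \<bar>z\<bar> \<le> \<delta> + z\<^sup>2 / \<delta>" for z \<delta> :: real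
proof (cases "\<bar>z\<bar> \<le> \<delta>")
  case False
  assume \<delta>: "0 < \<delta>"
  then have "\<bar>z\<bar> * \<delta> \<le> \<bar>z\<bar> * \<bar>z\<bar>" using False by (intro mult_left_mono) auto
  then have "\<bar>z\<bar> \<le> z\<^sup>2 / \<delta>" using \<delta> by (simp add: pos_le_divide_eq power2_eq_square)
  then show ?thesis using \<delta> by simp
qed (simp add: add_increasing2)

lemma square_add_le: "(a + b)\<^sup>2 \<le> 2 * a\<^sup>2 + 2 * b\<^sup>2" for a b :: real
  using zero_le_power2[of "a - b"] by (simp add: power2_eq_square algebra_simps)

lemma square_diff_le: "(a - b)\<^sup>2 \<le> 2 * a\<^sup>2 + 2 * b\<^sup>2" for a b :: real
  using square_add_le[of a "- b"] by simp

context lip_expectation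
begin

text \<open>Uniformity over the measures replaces the Cauchy condition of \<open>LG_approx\<close>, since \<open>E\<close> is a
  maximum over them.\<close>

definition unif_approx :: "nat \<Rightarrow> (nat \<Rightarrow> (real \<Rightarrow> real) \<Rightarrow> real) \<Rightarrow> ((real \<Rightarrow> real) \<Rightarrow> real) \<Rightarrow> bool" where
  "unif_approx p Y X \<longleftrightarrow> X \<in> borel_measurable (path_borel T) \<and> (\<forall>n. Y n \<in> Lip T) \<and>
     (\<forall>\<epsilon>>0. \<exists>N. \<forall>n\<ge>N. \<forall>P\<in>\<P>.
        integrable P (\<lambda>\<omega>. \<bar>Y n \<omega> - X \<omega>\<bar> ^ p) \<and> (\<integral>\<omega>. \<bar>Y n \<omega> - X \<omega>\<bar> ^ p \<partial>P) \<le> \<epsilon>)"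

lemma unif_approxE:
  assumes "unif_approx p Y X" "0 < \<epsilon>"
  obtains N where "\<And>n P. n \<ge> N \<Longrightarrow> P \<in> \<P> \<Longrightarrow> integrable P (\<lambda>\<omega>. \<bar>Y n \<omega> - X \<omega>\<bar> ^ p)"
    "\<And>n P. n \<ge> N \<Longrightarrow> P \<in> \<P> \<Longrightarrow> (\<integral>\<omega>. \<bar>Y n \<omega> - X \<omega>\<bar> ^ p \<partial>P) \<le> \<epsilon>"
proof -
  from assms have "\<exists>N. \<forall>n\<ge>N. \<forall>P\<in>\<P>.
      integrable P (\<lambda>\<omega>. \<bar>Y n \<omega> - X \<omega>\<bar> ^ p) \<and> (\<integral>\<omega>. \<bar>Y n \<omega> - X \<omega>\<bar> ^ p \<partial>P) \<le> \<epsilon>"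
    by (simp add: unif_approx_def)
  then show thesis by (elim exE) (rule that, auto)
qed

lemma T_nonneg: "0 \<le> T" using T_pos by simp

lemma Lip_diff: "X \<in> Lip T \<Longrightarrow> Y \<in> Lip T \<Longrightarrow> (\<lambda>\<omega>. X \<omega> - Y \<omega>) \<in> Lip T"
  by (rule Lip_comp2[OF T_nonneg _ _ loc_lip2_diff])

lemma dominated_integrable: "P \<in> \<P> \<Longrightarrow> X \<in> Lip T \<Longrightarrow> integrable P X"
  by (rule Lip_integrable[OF T_pos Lip_dominated_path_probs])

lemma dominated_measurable:
  "P \<in> \<P> \<Longrightarrow> X \<in> borel_measurable (path_borel T) \<Longrightarrow> X \<in> borel_measurable P"
  using path_probsD(4)[OF Lip_dominated_path_probs] by blast

lemma integrable_power_diff: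
  assumes P: "P \<in> \<P>" and Y: "Y \<in> Lip T" "Y' \<in> Lip T"
    and X: "X \<in> borel_measurable (path_borel T)" and i: "integrable P (\<lambda>\<omega>. \<bar>Y' \<omega> - X \<omega>\<bar> ^ p)"
  shows "integrable P (\<lambda>\<omega>. \<bar>Y \<omega> - X \<omega>\<bar> ^ p)"
    and "(\<integral>\<omega>. \<bar>Y \<omega> - X \<omega>\<bar> ^ p \<partial>P) \<le> 2 ^ p * ((\<integral>\<omega>. \<bar>Y \<omega> - Y' \<omega>\<bar> ^ p \<partial>P) + (\<integral>\<omega>. \<bar>Y' \<omega> - X \<omega>\<bar> ^ p \<partial>P))"
proof -
  have i2: "integrable P (\<lambda>\<omega>. \<bar>Y \<omega> - Y' \<omega>\<bar> ^ p)"
    by (rule dominated_integrable[OF P Lip_abs_power[OF T_nonneg Lip_diff[OF Y]]])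
  have le: "\<bar>Y \<omega> - X \<omega>\<bar> ^ p \<le> 2 ^ p * (\<bar>Y \<omega> - Y' \<omega>\<bar> ^ p + \<bar>Y' \<omega> - X \<omega>\<bar> ^ p)" for \<omega>
    using power_abs_add_le[of "Y \<omega> - Y' \<omega>" "Y' \<omega> - X \<omega>" p] by simp
  have m: "X \<in> borel_measurable P" "Y \<in> borel_measurable P"
    using dominated_measurable[OF P] X Lip_measurable[OF T_pos Y(1)] by auto
  have ib: "integrable P (\<lambda>\<omega>. 2 ^ p * (\<bar>Y \<omega> - Y' \<omega>\<bar> ^ p + \<bar>Y' \<omega> - X \<omega>\<bar> ^ p))" using i i2 by auto
  show i3: "integrable P (\<lambda>\<omega>. \<bar>Y \<omega> - X \<omega>\<bar> ^ p)"
    by (rule Bochner_Integration.integrable_bound[OF ib]) (use m le in \<open>auto intro!: AE_I2\<close>)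
  have "(\<integral>\<omega>. \<bar>Y \<omega> - X \<omega>\<bar> ^ p \<partial>P) \<le> (\<integral>\<omega>. 2 ^ p * (\<bar>Y \<omega> - Y' \<omega>\<bar> ^ p + \<bar>Y' \<omega> - X \<omega>\<bar> ^ p) \<partial>P)"
    by (rule integral_mono[OF i3 ib le])
  then show "(\<integral>\<omega>. \<bar>Y \<omega> - X \<omega>\<bar> ^ p \<partial>P) \<le> 2 ^ p * ((\<integral>\<omega>. \<bar>Y \<omega> - Y' \<omega>\<bar> ^ p \<partial>P) + (\<integral>\<omega>. \<bar>Y' \<omega> - X \<omega>\<bar> ^ p \<partial>P))"
    using i i2 by simp
qed

text \<open>The convergence assumed for each measure is not uniform, but the Cauchy condition is,
  since \<open>E\<close> dominates every integral. So \<open>Y n\<close> is compared with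
  \<open>X\<close> through some \<open>Y m\<close> far enough out for the measure at hand.\<close>

lemma LG_approx_imp_unif_approx:
  assumes p: "0 < p" and A: "LG_approx T E p T Y X" and X: "X \<in> borel_measurable (path_borel T)"
  shows "unif_approx p Y X"
  unfolding unif_approx_def
proof (intro conjI X allI impI)
  show Y: "Y n \<in> Lip T" for n using A by (simp add: LG_approx_def)
  fix \<epsilon> :: real assume \<epsilon>: "0 < \<epsilon>"
  define e where "e = \<epsilon> / (2 * 2 ^ p)"
  have e: "0 < e" using \<epsilon> by (simp add: e_def)
  then have "0 < root p e" using p by simp
  then obtain N where N: "\<And>m n. m \<ge> N \<Longrightarrow> n \<ge> N \<Longrightarrow> root p (E (\<lambda>\<omega>. \<bar>Y m \<omega> - Y n \<omega>\<bar> ^ p)) < root p e"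
    using A unfolding LG_approx_def LG_norm_def by blast
  show "\<exists>N. \<forall>n\<ge>N. \<forall>P\<in>\<P>. integrable P (\<lambda>\<omega>. \<bar>Y n \<omega> - X \<omega>\<bar> ^ p) \<and> (\<integral>\<omega>. \<bar>Y n \<omega> - X \<omega>\<bar> ^ p \<partial>P) \<le> \<epsilon>"
  proof (intro exI allI impI ballI)
    fix n P assume n: "N \<le> n" and P: "P \<in> \<P>"
    have "(\<lambda>n. \<integral>\<^sup>+\<omega>. ennreal (\<bar>Y n \<omega> - X \<omega>\<bar> ^ p) \<partial>P) \<longlonglongrightarrow> 0" using A P by (simp add: LG_approx_def)
    from order_tendstoD(2)[OF this, of "ennreal e"] e
    have "\<forall>\<^sub>F n in sequentially. (\<integral>\<^sup>+\<omega>. ennreal (\<bar>Y n \<omega> - X \<omega>\<bar> ^ p) \<partial>P) < ennreal e" by simp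
    then obtain k where k: "\<And>m. k \<le> m \<Longrightarrow> (\<integral>\<^sup>+\<omega>. ennreal (\<bar>Y m \<omega> - X \<omega>\<bar> ^ p) \<partial>P) < ennreal e"
      by (auto simp: eventually_sequentially)
    \<comment> \<open>\<open>m\<close> depends on \<open>P\<close>; the threshold \<open>N\<close>
      for \<open>n\<close> does not.\<close>
    define m where "m = max N k"
    have m: "N \<le> m" "(\<integral>\<^sup>+\<omega>. ennreal (\<bar>Y m \<omega> - X \<omega>\<bar> ^ p) \<partial>P) < ennreal e"
      using k[of m] by (auto simp: m_def)
    have mm: "(\<lambda>\<omega>. \<bar>Y m \<omega> - X \<omega>\<bar> ^ p) \<in> borel_measurable P"
      using dominated_measurable[OF P X] dominated_measurable[OF P Lip_measurable[OF T_pos Y[of m]]] by measurable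
    have im: "integrable P (\<lambda>\<omega>. \<bar>Y m \<omega> - X \<omega>\<bar> ^ p)"
      using mm m(2) by (intro integrableI_nonneg) (auto intro: order.strict_trans)
    then have "ennreal (\<integral>\<omega>. \<bar>Y m \<omega> - X \<omega>\<bar> ^ p \<partial>P) < ennreal e"
      using m(2) by (subst (asm) nn_integral_eq_integral) auto
    then have mle: "(\<integral>\<omega>. \<bar>Y m \<omega> - X \<omega>\<bar> ^ p \<partial>P) \<le> e"
      by (simp add: ennreal_less_iff)
    have "E (\<lambda>\<omega>. \<bar>Y n \<omega> - Y m \<omega>\<bar> ^ p) < e" using N[OF n m(1)] p by simp
    then have nle: "(\<integral>\<omega>. \<bar>Y n \<omega> - Y m \<omega>\<bar> ^ p \<partial>P) \<le> e"
      using dominated_integral_le[OF P Lip_abs_power[OF T_nonneg Lip_diff[OF Y Y]], of n m p] by linarith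
    note d = integrable_power_diff[OF P Y[of n] Y[of m] X im]
    have "(\<integral>\<omega>. \<bar>Y n \<omega> - X \<omega>\<bar> ^ p \<partial>P) \<le> 2 ^ p * (e + e)"
      by (rule order_trans[OF d(2)]) (use mle nle in \<open>intro mult_left_mono add_mono, auto\<close>)
    also have "\<dots> = \<epsilon>" by (simp add: e_def)
    finally show "integrable P (\<lambda>\<omega>. \<bar>Y n \<omega> - X \<omega>\<bar> ^ p) \<and> (\<integral>\<omega>. \<bar>Y n \<omega> - X \<omega>\<bar> ^ p \<partial>P) \<le> \<epsilon>"
      using d(1) by simp
  qed
qed

text \<open>The Cauchy condition is recovered because \<open>E\<close> of
  \<open>\<bar>Y m - Y n\<bar> ^ p\<close> is attained at some measure, where the uniform bound
  applies.\<close>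

lemma unif_approx_imp_LG_approx:
  assumes p: "0 < p" and A: "unif_approx p Y X"
  shows "LG_approx T E p T Y X"
  unfolding LG_approx_def
proof (intro conjI allI impI ballI)
  have X: "X \<in> borel_measurable (path_borel T)" using A by (simp add: unif_approx_def)
  show Y: "Y n \<in> Lip T" for n using A by (simp add: unif_approx_def)
  {
    fix \<epsilon> :: real assume \<epsilon>: "0 < \<epsilon>"
    \<comment> \<open>The factor 4 leaves \<open>\<epsilon> ^ p / 2\<close> after the estimate, and
      so the strict inequality.\<close>
    define e where "e = \<epsilon> ^ p / (4 * 2 ^ p)"
    have e: "0 < e" using \<epsilon> by (simp add: e_def)
    obtain N where N: "\<And>n P. n \<ge> N \<Longrightarrow> P \<in> \<P> \<Longrightarrow> integrable P (\<lambda>\<omega>. \<bar>Y n \<omega> - X \<omega>\<bar> ^ p)"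
      "\<And>n P. n \<ge> N \<Longrightarrow> P \<in> \<P> \<Longrightarrow> (\<integral>\<omega>. \<bar>Y n \<omega> - X \<omega>\<bar> ^ p \<partial>P) \<le> e"
      by (rule unif_approxE[OF A e]) (rule that)
    have "LG_norm E p (\<lambda>\<omega>. Y m \<omega> - Y n \<omega>) < \<epsilon>" if mn: "N \<le> m" "N \<le> n" for m n
    proof -
      let ?Z = "\<lambda>\<omega>. \<bar>Y m \<omega> - Y n \<omega>\<bar> ^ p"
      have Z: "?Z \<in> Lip T" by (rule Lip_abs_power[OF T_nonneg Lip_diff[OF Y Y]])
      obtain P where P: "P \<in> \<P>" "(integral\<^sup>L P ?Z) = E ?Z"
        using Lip_expectation_attained[OF Z] by blast
      have i: "integrable P (\<lambda>\<omega>. \<bar>Y m \<omega> - X \<omega>\<bar> ^ p)" "integrable P (\<lambda>\<omega>. \<bar>Y n \<omega> - X \<omega>\<bar> ^ p)"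
        using N mn P(1) by auto
      have le: "?Z \<omega> \<le> 2 ^ p * (\<bar>Y m \<omega> - X \<omega>\<bar> ^ p + \<bar>Y n \<omega> - X \<omega>\<bar> ^ p)" for \<omega>
        using power_abs_add_le[of "Y m \<omega> - X \<omega>" "X \<omega> - Y n \<omega>" p] by (simp add: abs_minus_commute)
      have "(integral\<^sup>L P ?Z) \<le> (\<integral>\<omega>. 2 ^ p * (\<bar>Y m \<omega> - X \<omega>\<bar> ^ p + \<bar>Y n \<omega> - X \<omega>\<bar> ^ p) \<partial>P)"
        using i by (intro integral_mono le dominated_integrable[OF P(1) Z]) auto
      also have "\<dots> = 2 ^ p * ((\<integral>\<omega>. \<bar>Y m \<omega> - X \<omega>\<bar> ^ p \<partial>P) + (\<integral>\<omega>. \<bar>Y n \<omega> - X \<omega>\<bar> ^ p \<partial>P))" using i by simp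
      also have "\<dots> \<le> 2 ^ p * (e + e)" using N mn P(1) by (intro mult_left_mono add_mono) auto
      also have "\<dots> = \<epsilon> ^ p / 2" by (simp add: e_def)
      also have "\<dots> < \<epsilon> ^ p" using \<epsilon> by simp
      finally have "E ?Z < \<epsilon> ^ p" using P(2) by simp
      then have "root p (E ?Z) < root p (\<epsilon> ^ p)" using p by simp
      then show ?thesis using p \<epsilon> by (simp add: LG_norm_def real_root_power_cancel)
    qed
    then show "\<exists>N. \<forall>m\<ge>N. \<forall>n\<ge>N. LG_norm E p (\<lambda>\<omega>. Y m \<omega> - Y n \<omega>) < \<epsilon>" by blast
  }
  fix P assume P: "P \<in> \<P>"
  have ev: "\<forall>\<^sub>F n in sequentially. integrable P (\<lambda>\<omega>. \<bar>Y n \<omega> - X \<omega>\<bar> ^ p) \<and> (\<integral>\<omega>. \<bar>Y n \<omega> - X \<omega>\<bar> ^ p \<partial>P) \<le> \<epsilon>"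
    if "0 < \<epsilon>" for \<epsilon>
    using A P that unfolding unif_approx_def eventually_sequentially by meson
  have "(\<lambda>n. \<integral>\<omega>. \<bar>Y n \<omega> - X \<omega>\<bar> ^ p \<partial>P) \<longlonglongrightarrow> 0"
  proof (rule order_tendstoI)
    fix a :: real assume "0 < a"
    then have "0 < a / 2" by simp
    from ev[OF this] show "\<forall>\<^sub>F n in sequentially. (\<integral>\<omega>. \<bar>Y n \<omega> - X \<omega>\<bar> ^ p \<partial>P) < a"
      by eventually_elim (use \<open>0 < a\<close> in linarith)
  next
    fix a :: real assume "a < 0"
    then show "\<forall>\<^sub>F n in sequentially. a < (\<integral>\<omega>. \<bar>Y n \<omega> - X \<omega>\<bar> ^ p \<partial>P)"
      by (intro always_eventually allI) (auto intro: less_le_trans)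
  qed
  then have "(\<lambda>n. ennreal (\<integral>\<omega>. \<bar>Y n \<omega> - X \<omega>\<bar> ^ p \<partial>P)) \<longlonglongrightarrow> ennreal 0" by (rule tendsto_ennrealI)
  moreover have "\<forall>\<^sub>F n in sequentially. ennreal (\<integral>\<omega>. \<bar>Y n \<omega> - X \<omega>\<bar> ^ p \<partial>P) = (\<integral>\<^sup>+\<omega>. ennreal (\<bar>Y n \<omega> - X \<omega>\<bar> ^ p) \<partial>P)"
    using ev[of 1] by (auto elim!: eventually_mono intro: nn_integral_eq_integral[symmetric])
  ultimately show "(\<lambda>n. \<integral>\<^sup>+\<omega>. ennreal (\<bar>Y n \<omega> - X \<omega>\<bar> ^ p) \<partial>P) \<longlonglongrightarrow> 0"
    using Lim_transform_eventually by fastforce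
qed

lemma LG_iff_unif_approx:
  assumes p: "0 < p"
  shows "X \<in> LG T E p T \<longleftrightarrow> (\<exists>Y. unif_approx p Y X)"
proof -
  have "X \<in> borel_measurable (path_borel T)" if "unif_approx p Y X" for Y
    using that by (simp add: unif_approx_def)
  then have "unif_approx p Y X \<longleftrightarrow> X \<in> borel_measurable (path_borel T) \<and> LG_approx T E p T Y X" for Y
    using LG_approx_imp_unif_approx[OF p] unif_approx_imp_LG_approx[OF p] by blast
  then show ?thesis by (simp add: LG_def)
qed

lemma unif_approx_borel: "unif_approx p Y X \<Longrightarrow> X \<in> borel_measurable (path_borel T)"
  by (simp add: unif_approx_def)

lemma unif_approx_mem: "unif_approx p Y X \<Longrightarrow> Y n \<in> Lip T"
  by (simp add: unif_approx_def)

lemma unif_approx_measurable: "unif_approx p Y X \<Longrightarrow> P \<in> \<P> \<Longrightarrow> X \<in> borel_measurable P"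
  by (simp add: unif_approx_def dominated_measurable)

lemma unif_approx1:
  assumes "unif_approx 1 Y X" "0 < \<epsilon>"
  obtains N where "\<And>n P. n \<ge> N \<Longrightarrow> P \<in> \<P> \<Longrightarrow> \<bar>(integral\<^sup>L P (Y n)) - (integral\<^sup>L P X)\<bar> \<le> \<epsilon>"
    "\<And>P. P \<in> \<P> \<Longrightarrow> integrable P X"
proof -
  obtain N where "\<And>n P. n \<ge> N \<Longrightarrow> P \<in> \<P> \<Longrightarrow> integrable P (\<lambda>\<omega>. \<bar>Y n \<omega> - X \<omega>\<bar> ^ 1)"
    "\<And>n P. n \<ge> N \<Longrightarrow> P \<in> \<P> \<Longrightarrow> (\<integral>\<omega>. \<bar>Y n \<omega> - X \<omega>\<bar> ^ 1 \<partial>P) \<le> \<epsilon>"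
    by (rule unif_approxE[OF assms]) (rule that)
  note N = this[unfolded power_one_right]
  note Y = unif_approx_mem[OF assms(1)]
  show thesis
  proof (rule that)
    fix P assume P: "P \<in> \<P>"
    have d: "integrable P (\<lambda>\<omega>. Y n \<omega> - X \<omega>)" if "n \<ge> N" for n
      using N(1)[OF that P] unif_approx_measurable[OF assms(1) P] dominated_measurable[OF P Lip_measurable[OF T_pos Y]]
      by (subst (asm) integrable_abs_iff) auto
    have "integrable P (\<lambda>\<omega>. Y N \<omega> - (Y N \<omega> - X \<omega>))"
      by (intro Bochner_Integration.integrable_diff d dominated_integrable[OF P Y]) simp
    then show iX: "integrable P X" by simp
    fix n assume n: "N \<le> n"
    have "\<bar>(integral\<^sup>L P (Y n)) - (integral\<^sup>L P X)\<bar> = \<bar>\<integral>\<omega>. Y n \<omega> - X \<omega> \<partial>P\<bar>"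
      using iX dominated_integrable[OF P Y] by simp
    also have "\<dots> \<le> (\<integral>\<omega>. \<bar>Y n \<omega> - X \<omega>\<bar> \<partial>P)" by (rule integral_abs_bound)
    finally show "\<bar>(integral\<^sup>L P (Y n)) - (integral\<^sup>L P X)\<bar> \<le> \<epsilon>" using N(2)[OF n P] by linarith
  qed
qed

text \<open>Each \<open>E (Y n)\<close> is a maximum of integrals over \<P>, and these integrals
  converge uniformly, so their maxima converge to the supremum.\<close>

lemma Ehat_limit:
  assumes A: "unif_approx 1 Y X"
  shows "(\<lambda>n. E (Y n)) \<longlonglongrightarrow> (SUP P\<in>\<P>. \<integral>\<omega>. X \<omega> \<partial>P)"
    and "bdd_above ((\<lambda>P. \<integral>\<omega>. X \<omega> \<partial>P) ` \<P>)"
proof -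
  note Y = unif_approx_mem[OF A]
  let ?I = "\<lambda>P. \<integral>\<omega>. X \<omega> \<partial>P"
  obtain N where N: "\<And>n P. n \<ge> N \<Longrightarrow> P \<in> \<P> \<Longrightarrow> \<bar>(integral\<^sup>L P (Y n)) - ?I P\<bar> \<le> 1"
    using unif_approx1[OF A, of 1] by force
  have "?I P \<le> E (Y N) + 1" if P: "P \<in> \<P>" for P
    using N[OF order_refl P] dominated_integral_le[OF P Y[of N]] by linarith
  then show bdd: "bdd_above (?I ` \<P>)" by (rule bdd_aboveI2)
  have ne: "\<P> \<noteq> {}" using Lip_expectation_attained[OF Y[of 0]] by blast
  show "(\<lambda>n. E (Y n)) \<longlonglongrightarrow> (SUP P\<in>\<P>. ?I P)"
  proof (rule LIMSEQ_I)
    fix r :: real assume r: "0 < r"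
    obtain N where N: "\<And>n P. n \<ge> N \<Longrightarrow> P \<in> \<P> \<Longrightarrow> \<bar>(integral\<^sup>L P (Y n)) - ?I P\<bar> \<le> r / 2"
      using unif_approx1[OF A, of "r / 2"] r by force
    have "norm (E (Y n) - (SUP P\<in>\<P>. ?I P)) < r" if n: "N \<le> n" for n
    proof -
      obtain P where P: "P \<in> \<P>" "(integral\<^sup>L P (Y n)) = E (Y n)"
        using Lip_expectation_attained[OF Y[of n]] by blast
      have "?I P \<le> (SUP P\<in>\<P>. ?I P)" by (rule cSUP_upper[OF P(1) bdd])
      then have "E (Y n) \<le> (SUP P\<in>\<P>. ?I P) + r / 2" using N[OF n P(1)] P(2) by linarith
      moreover have "(SUP P\<in>\<P>. ?I P) \<le> E (Y n) + r / 2"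
      proof (rule cSUP_least[OF ne])
        fix Q assume Q: "Q \<in> \<P>"
        show "?I Q \<le> E (Y n) + r / 2" using N[OF n Q] dominated_integral_le[OF Q Y[of n]] by linarith
      qed
      ultimately show ?thesis using r by simp
    qed
    then show "\<exists>no. \<forall>n\<ge>no. norm (E (Y n) - (SUP P\<in>\<P>. ?I P)) < r" by blast
  qed
qed

text \<open>The limit depends on \<open>X\<close> alone and not on the approximating sequence, so
  the definite description in \<open>Ehat\<close> is meaningful.\<close>

lemma Ehat_eq_SUP:
  assumes "X \<in> LG T E 1 T"
  shows "Ehat T E X = (SUP P\<in>\<P>. \<integral>\<omega>. X \<omega> \<partial>P)"
  unfolding Ehat_def
proof (rule the_equality)
  have X: "X \<in> borel_measurable (path_borel T)" using assms by (simp add: LG_def)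
  obtain Y where Y: "unif_approx 1 Y X" using assms LG_iff_unif_approx[of 1 X] by auto
  show "\<exists>Y. LG_approx T E 1 T Y X \<and> (\<lambda>n. E (Y n)) \<longlonglongrightarrow> (SUP P\<in>\<P>. \<integral>\<omega>. X \<omega> \<partial>P)"
    using unif_approx_imp_LG_approx[OF _ Y] Ehat_limit(1)[OF Y] by auto
  fix l assume "\<exists>Y. LG_approx T E 1 T Y X \<and> (\<lambda>n. E (Y n)) \<longlonglongrightarrow> l"
  then obtain Y where "LG_approx T E 1 T Y X" "(\<lambda>n. E (Y n)) \<longlonglongrightarrow> l" by blast
  then show "l = (SUP P\<in>\<P>. \<integral>\<omega>. X \<omega> \<partial>P)"
    using Ehat_limit(1)[OF LG_approx_imp_unif_approx[OF _ _ X]] LIMSEQ_unique by force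
qed

lemma Ehat_upper: "X \<in> LG T E 1 T \<Longrightarrow> P \<in> \<P> \<Longrightarrow> (integral\<^sup>L P X) \<le> Ehat T E X"
  using Ehat_limit(2) LG_iff_unif_approx[of 1 X] by (auto simp: Ehat_eq_SUP intro!: cSUP_upper)

lemma LG1_integrable: "X \<in> LG T E 1 T \<Longrightarrow> P \<in> \<P> \<Longrightarrow> integrable P X"
  using LG_iff_unif_approx[of 1 X] unif_approx1[of _ X 1] by (metis zero_less_one)

lemma Lip_subset_LG1: "X \<in> Lip T \<Longrightarrow> X \<in> LG T E 1 T"
  using LG_iff_unif_approx[of 1 X] Lip_measurable[OF T_pos, of X]
  by (auto simp: unif_approx_def intro!: exI[of _ "\<lambda>_. X"])

text \<open>\<open>Ehat\<close> extends \<open>E\<close> and is a supremum over the measures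
  dominated on cylinder functions, so domination on these already implies domination on all of
  \<open>LG\<close>.\<close>

lemma rep_measures_eq: "rep_measures T E = \<P>"
proof (intro equalityI subsetI)
  fix P assume P: "P \<in> rep_measures T E"
  have "(integral\<^sup>L P X) \<le> E X" if X: "X \<in> Lip T" for X
  proof -
    have A: "unif_approx 1 (\<lambda>_. X) X" using X Lip_measurable[OF T_pos X] by (auto simp: unif_approx_def)
    have "E X = Ehat T E X"
      using LIMSEQ_unique[OF Ehat_limit(1)[OF A] tendsto_const] Ehat_eq_SUP[OF Lip_subset_LG1[OF X]] by simp
    then show ?thesis using P Lip_subset_LG1[OF X] by (simp add: rep_measures_def)
  qed
  then show "P \<in> \<P>" using P by (simp add: Lip_dominated_def rep_measures_def)
next
  fix P assume "P \<in> \<P>"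
  then show "P \<in> rep_measures T E"
    using Ehat_upper Lip_dominated_path_probs by (auto simp: rep_measures_def)
qed

text \<open>One cylinder function approximates \<open>X\<close> within \<open>e / 4\<close> under
  all measures at once, and its integral is Lipschitz for the metric; the budget is
  \<open>e / 4 + e / 2 + e / 4\<close>.\<close>

lemma LG1_uniformly_continuous:
  assumes X: "X \<in> LG T E 1 T" and e: "0 < e"
  obtains \<delta> where "0 < \<delta>" "\<And>P Q. P \<in> \<P> \<Longrightarrow> Q \<in> \<P> \<Longrightarrow>
    BL_dist T P Q < \<delta> \<Longrightarrow> \<bar>(integral\<^sup>L P X) - (integral\<^sup>L Q X)\<bar> < e"
proof -
  obtain Y where A: "unif_approx 1 Y X" using X LG_iff_unif_approx[of 1 X] by auto
  obtain N where N: "\<And>n P. n \<ge> N \<Longrightarrow> P \<in> \<P> \<Longrightarrow> \<bar>(integral\<^sup>L P (Y n)) - (integral\<^sup>L P X)\<bar> \<le> e / 4"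
    using unif_approx1[OF A, of "e / 4"] e by force
  obtain K where K: "0 < K" "\<And>\<omega>. \<bar>Y N \<omega>\<bar> \<le> K"
    "\<And>\<omega> \<omega>'. \<omega> \<in> path_space T \<Longrightarrow> \<omega>' \<in> path_space T \<Longrightarrow> \<bar>Y N \<omega> - Y N \<omega>'\<bar> \<le> K * mdist (path_metric T) \<omega> \<omega>'"
    using Lip_lipschitz[OF T_pos unif_approx_mem[OF A, of N]] by metis
  show thesis
  proof (rule that[of "e / (4 * K)"])
    show "0 < e / (4 * K)" using e K by simp
    fix P Q assume PQ: "P \<in> \<P>" "Q \<in> \<P>" and d: "BL_dist T P Q < e / (4 * K)"
    have "\<bar>(integral\<^sup>L P (Y N)) - (integral\<^sup>L Q (Y N))\<bar> \<le> 2 * K * BL_dist T P Q"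
      using PQ by (intro BL_dist_lipschitz Lip_dominated_path_probs K)
    also have "\<dots> < 2 * K * (e / (4 * K))" using d K by (intro mult_strict_left_mono) auto
    also have "\<dots> = e / 2" using K by simp
    finally show "\<bar>(integral\<^sup>L P X) - (integral\<^sup>L Q X)\<bar> < e"
      using N[OF order_refl PQ(1)] N[OF order_refl PQ(2)] by linarith
  qed
qed

section \<open>Stability of \<open>unif_approx\<close> under differences, sums and squares\<close>

lemma unif_approxI:
  assumes X: "X \<in> borel_measurable (path_borel T)" and Y: "\<And>n. Y n \<in> Lip T"
    and B: "\<And>\<epsilon>. 0 < \<epsilon> \<Longrightarrow> \<exists>N. \<forall>n\<ge>N. \<forall>P\<in>\<P>.
      \<exists>Z. integrable P Z \<and> (\<forall>\<omega>. \<bar>Y n \<omega> - X \<omega>\<bar> ^ p \<le> Z \<omega>) \<and> (integral\<^sup>L P Z) \<le> \<epsilon>"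
  shows "unif_approx p Y X"
proof -
  have "integrable P (\<lambda>\<omega>. \<bar>Y n \<omega> - X \<omega>\<bar> ^ p) \<and> (\<integral>\<omega>. \<bar>Y n \<omega> - X \<omega>\<bar> ^ p \<partial>P) \<le> \<epsilon>"
    if P: "P \<in> \<P>" and Z: "integrable P Z" "\<forall>\<omega>. \<bar>Y n \<omega> - X \<omega>\<bar> ^ p \<le> Z \<omega>" "(integral\<^sup>L P Z) \<le> \<epsilon>" for P n Z \<epsilon>
  proof
    have "(\<lambda>\<omega>. \<bar>Y n \<omega> - X \<omega>\<bar> ^ p) \<in> borel_measurable P"
      using dominated_measurable[OF P X] dominated_measurable[OF P Lip_measurable[OF T_pos Y[of n]]] by measurable
    then show i: "integrable P (\<lambda>\<omega>. \<bar>Y n \<omega> - X \<omega>\<bar> ^ p)"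
    proof (rule Bochner_Integration.integrable_bound[OF Z(1)])
      show "AE \<omega> in P. norm (\<bar>Y n \<omega> - X \<omega>\<bar> ^ p) \<le> norm (Z \<omega>)"
        using Z(2) by (intro AE_I2) (auto intro: order_trans)
    qed
    have "(\<integral>\<omega>. \<bar>Y n \<omega> - X \<omega>\<bar> ^ p \<partial>P) \<le> (integral\<^sup>L P Z)" using Z i by (intro integral_mono) auto
    then show "(\<integral>\<omega>. \<bar>Y n \<omega> - X \<omega>\<bar> ^ p \<partial>P) \<le> \<epsilon>" using Z(3) by linarith
  qed
  then show ?thesis unfolding unif_approx_def using X Y B by meson
qed

lemma unif_approx_2_imp_1:
  assumes A: "unif_approx 2 Y X"
  shows "unif_approx 1 Y X"
proof (rule unif_approxI)
  show "X \<in> borel_measurable (path_borel T)" using A by (simp add: unif_approx_def)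
  show "Y n \<in> Lip T" for n by (rule unif_approx_mem[OF A])
  fix \<epsilon> :: real assume \<epsilon>: "0 < \<epsilon>"
  obtain N where N: "\<And>n P. n \<ge> N \<Longrightarrow> P \<in> \<P> \<Longrightarrow> integrable P (\<lambda>\<omega>. \<bar>Y n \<omega> - X \<omega>\<bar> ^ 2)"
    "\<And>n P. n \<ge> N \<Longrightarrow> P \<in> \<P> \<Longrightarrow> (\<integral>\<omega>. \<bar>Y n \<omega> - X \<omega>\<bar> ^ 2 \<partial>P) \<le> (\<epsilon> / 2)\<^sup>2"
    by (rule unif_approxE[OF A, of "(\<epsilon> / 2)\<^sup>2"]) (use \<epsilon> in simp, rule that)
  show "\<exists>N. \<forall>n\<ge>N. \<forall>P\<in>\<P>. \<exists>Z. integrable P Z \<and> (\<forall>\<omega>. \<bar>Y n \<omega> - X \<omega>\<bar> ^ 1 \<le> Z \<omega>) \<and> (integral\<^sup>L P Z) \<le> \<epsilon>"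
  proof (intro exI[of _ N] allI impI ballI)
    fix n P assume n: "N \<le> n" and P: "P \<in> \<P>"
    interpret prob_space P using path_probsD(1)[OF Lip_dominated_path_probs[OF P]] .
    let ?Z = "\<lambda>\<omega>. \<epsilon> / 2 + \<bar>Y n \<omega> - X \<omega>\<bar>\<^sup>2 / (\<epsilon> / 2)"
    have "(integral\<^sup>L P ?Z) = \<epsilon> / 2 + (\<integral>\<omega>. \<bar>Y n \<omega> - X \<omega>\<bar>\<^sup>2 \<partial>P) / (\<epsilon> / 2)"
      using N(1)[OF n P] by (subst Bochner_Integration.integral_add) (auto simp: prob_space)
    also have "\<dots> \<le> \<epsilon> / 2 + (\<epsilon> / 2)\<^sup>2 / (\<epsilon> / 2)" using N(2)[OF n P] \<epsilon> by (intro add_left_mono divide_right_mono) auto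
    also have "\<dots> = \<epsilon>" using \<epsilon> by (simp add: power2_eq_square)
    finally show "\<exists>Z. integrable P Z \<and> (\<forall>\<omega>. \<bar>Y n \<omega> - X \<omega>\<bar> ^ 1 \<le> Z \<omega>) \<and> (integral\<^sup>L P Z) \<le> \<epsilon>"
      using N(1)[OF n P] abs_le_add_square[of "\<epsilon> / 2"] \<epsilon> by (intro exI[of _ ?Z]) auto
  qed
qed

lemma LG2_subset_LG1: "X \<in> LG T E 2 T \<Longrightarrow> X \<in> LG T E 1 T"
  using LG_iff_unif_approx[of 1 X] LG_iff_unif_approx[of 2 X] unif_approx_2_imp_1 by auto

lemma unif_approx_diff2:
  assumes A: "unif_approx 2 Y X" "unif_approx 2 Y' X'"
  shows "unif_approx 2 (\<lambda>n \<omega>. Y n \<omega> - Y' n \<omega>) (\<lambda>\<omega>. X \<omega> - X' \<omega>)"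
proof (rule unif_approxI)
  show "(\<lambda>\<omega>. X \<omega> - X' \<omega>) \<in> borel_measurable (path_borel T)"
    by (intro borel_measurable_diff unif_approx_borel[OF A(1)] unif_approx_borel[OF A(2)])
  show "(\<lambda>\<omega>. Y n \<omega> - Y' n \<omega>) \<in> Lip T" for n using A by (intro Lip_diff unif_approx_mem)
  fix \<epsilon> :: real assume \<epsilon>: "0 < \<epsilon>"
  then have e: "0 < \<epsilon> / 4" by simp
  obtain N where N: "\<And>n P. n \<ge> N \<Longrightarrow> P \<in> \<P> \<Longrightarrow> integrable P (\<lambda>\<omega>. \<bar>Y n \<omega> - X \<omega>\<bar> ^ 2)"
    "\<And>n P. n \<ge> N \<Longrightarrow> P \<in> \<P> \<Longrightarrow> (\<integral>\<omega>. \<bar>Y n \<omega> - X \<omega>\<bar> ^ 2 \<partial>P) \<le> \<epsilon> / 4"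
    by (rule unif_approxE[OF A(1) e]) (rule that)
  obtain N' where N': "\<And>n P. n \<ge> N' \<Longrightarrow> P \<in> \<P> \<Longrightarrow> integrable P (\<lambda>\<omega>. \<bar>Y' n \<omega> - X' \<omega>\<bar> ^ 2)"
    "\<And>n P. n \<ge> N' \<Longrightarrow> P \<in> \<P> \<Longrightarrow> (\<integral>\<omega>. \<bar>Y' n \<omega> - X' \<omega>\<bar> ^ 2 \<partial>P) \<le> \<epsilon> / 4"
    by (rule unif_approxE[OF A(2) e]) (rule that)
  show "\<exists>N. \<forall>n\<ge>N. \<forall>P\<in>\<P>. \<exists>Z. integrable P Z \<and>
      (\<forall>\<omega>. \<bar>Y n \<omega> - Y' n \<omega> - (X \<omega> - X' \<omega>)\<bar> ^ 2 \<le> Z \<omega>) \<and> (integral\<^sup>L P Z) \<le> \<epsilon>"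
  proof (intro exI[of _ "max N N'"] allI impI ballI)
    fix n P assume "max N N' \<le> n" and P: "P \<in> \<P>"
    then have n: "N \<le> n" "N' \<le> n" by auto
    let ?Z = "\<lambda>\<omega>. 2 * \<bar>Y n \<omega> - X \<omega>\<bar>\<^sup>2 + 2 * \<bar>Y' n \<omega> - X' \<omega>\<bar>\<^sup>2"
    have "(integral\<^sup>L P ?Z) \<le> \<epsilon>" using N[OF n(1) P] N'[OF n(2) P] by simp
    moreover have "\<bar>Y n \<omega> - Y' n \<omega> - (X \<omega> - X' \<omega>)\<bar>\<^sup>2 \<le> ?Z \<omega>" for \<omega>
      using square_diff_le[of "Y n \<omega> - X \<omega>" "Y' n \<omega> - X' \<omega>"] by (simp add: algebra_simps)
    ultimately show "\<exists>Z. integrable P Z \<and>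
      (\<forall>\<omega>. \<bar>Y n \<omega> - Y' n \<omega> - (X \<omega> - X' \<omega>)\<bar> ^ 2 \<le> Z \<omega>) \<and> (integral\<^sup>L P Z) \<le> \<epsilon>"
      using N(1)[OF n(1) P] N'(1)[OF n(2) P] by (intro exI[of _ ?Z]) auto
  qed
qed

lemma unif_approx_add1:
  assumes A: "unif_approx 1 Y X" "unif_approx 1 Y' X'"
  shows "unif_approx 1 (\<lambda>n \<omega>. Y n \<omega> + Y' n \<omega>) (\<lambda>\<omega>. X \<omega> + X' \<omega>)"
proof (rule unif_approxI)
  show "(\<lambda>\<omega>. X \<omega> + X' \<omega>) \<in> borel_measurable (path_borel T)"
    by (intro borel_measurable_add unif_approx_borel[OF A(1)] unif_approx_borel[OF A(2)])
  show "(\<lambda>\<omega>. Y n \<omega> + Y' n \<omega>) \<in> Lip T" for n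
    using Lip_comp2[OF T_nonneg unif_approx_mem[OF A(1)] unif_approx_mem[OF A(2)] loc_lip2_add] .
  fix \<epsilon> :: real assume \<epsilon>: "0 < \<epsilon>"
  then have e: "0 < \<epsilon> / 2" by simp
  obtain N where N: "\<And>n P. n \<ge> N \<Longrightarrow> P \<in> \<P> \<Longrightarrow> integrable P (\<lambda>\<omega>. \<bar>Y n \<omega> - X \<omega>\<bar> ^ 1)"
    "\<And>n P. n \<ge> N \<Longrightarrow> P \<in> \<P> \<Longrightarrow> (\<integral>\<omega>. \<bar>Y n \<omega> - X \<omega>\<bar> ^ 1 \<partial>P) \<le> \<epsilon> / 2"
    by (rule unif_approxE[OF A(1) e]) (rule that)
  obtain N' where N': "\<And>n P. n \<ge> N' \<Longrightarrow> P \<in> \<P> \<Longrightarrow> integrable P (\<lambda>\<omega>. \<bar>Y' n \<omega> - X' \<omega>\<bar> ^ 1)"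
    "\<And>n P. n \<ge> N' \<Longrightarrow> P \<in> \<P> \<Longrightarrow> (\<integral>\<omega>. \<bar>Y' n \<omega> - X' \<omega>\<bar> ^ 1 \<partial>P) \<le> \<epsilon> / 2"
    by (rule unif_approxE[OF A(2) e]) (rule that)
  show "\<exists>N. \<forall>n\<ge>N. \<forall>P\<in>\<P>. \<exists>Z. integrable P Z \<and>
      (\<forall>\<omega>. \<bar>Y n \<omega> + Y' n \<omega> - (X \<omega> + X' \<omega>)\<bar> ^ 1 \<le> Z \<omega>) \<and> (integral\<^sup>L P Z) \<le> \<epsilon>"
  proof (intro exI[of _ "max N N'"] allI impI ballI)
    fix n P assume "max N N' \<le> n" and P: "P \<in> \<P>"
    then have n: "N \<le> n" "N' \<le> n" by auto
    let ?Z = "\<lambda>\<omega>. \<bar>Y n \<omega> - X \<omega>\<bar> ^ 1 + \<bar>Y' n \<omega> - X' \<omega>\<bar> ^ 1"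
    have "(integral\<^sup>L P ?Z) \<le> \<epsilon>"
      using N[OF n(1) P] N'[OF n(2) P] by (subst Bochner_Integration.integral_add) auto
    then show "\<exists>Z. integrable P Z \<and>
      (\<forall>\<omega>. \<bar>Y n \<omega> + Y' n \<omega> - (X \<omega> + X' \<omega>)\<bar> ^ 1 \<le> Z \<omega>) \<and> (integral\<^sup>L P Z) \<le> \<epsilon>"
      using Bochner_Integration.integrable_add[OF N(1)[OF n(1) P] N'(1)[OF n(2) P]] by (intro exI[of _ ?Z]) auto
  qed
qed

text \<open>\<open>\<bar>a\<^sup>2 - b\<^sup>2\<bar> = \<bar>a - b\<bar> * \<bar>a + b\<bar>\<close>
  is split by a weighted arithmetic-geometric inequality into a multiple of the error
  \<open>(a - b)\<^sup>2\<close> and a small multiple of \<open>b\<^sup>2\<close>, whose integral is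
  bounded uniformly over \<P>.\<close>

lemma unif_approx_square:
  assumes A: "unif_approx 2 Y X"
  shows "unif_approx 1 (\<lambda>n \<omega>. (Y n \<omega>)\<^sup>2) (\<lambda>\<omega>. (X \<omega>)\<^sup>2)"
proof (rule unif_approxI)
  show "(\<lambda>\<omega>. (X \<omega>)\<^sup>2) \<in> borel_measurable (path_borel T)"
    by (intro borel_measurable_power unif_approx_borel[OF A])
  note Y = unif_approx_mem[OF A]
  show "(\<lambda>\<omega>. (Y n \<omega>)\<^sup>2) \<in> Lip T" for n
    using Lip_abs_power[OF T_nonneg Y[of n], of 2] by simp
  obtain N0 where N0: "\<And>n P. n \<ge> N0 \<Longrightarrow> P \<in> \<P> \<Longrightarrow> integrable P (\<lambda>\<omega>. \<bar>Y n \<omega> - X \<omega>\<bar> ^ 2)"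
    "\<And>n P. n \<ge> N0 \<Longrightarrow> P \<in> \<P> \<Longrightarrow> (\<integral>\<omega>. \<bar>Y n \<omega> - X \<omega>\<bar> ^ 2 \<partial>P) \<le> 1"
    by (rule unif_approxE[OF A zero_less_one]) (rule that)
  obtain K where K: "0 < K" "\<And>\<omega>. \<bar>Y N0 \<omega>\<bar> \<le> K" using Lip_lipschitz[OF T_pos Y[of N0]] by metis
  \<comment> \<open>Bounds the second moment of \<open>X\<close> under every measure:
    \<open>X\<close> differs from \<open>Y N0\<close>, which \<open>K\<close> bounds, by an error of
    second moment at most 1.\<close>
  define B where "B = 2 + 2 * K\<^sup>2"
  have B: "0 < B" by (simp add: B_def add_pos_nonneg)
  have X2: "integrable P (\<lambda>\<omega>. (X \<omega>)\<^sup>2) \<and> (\<integral>\<omega>. (X \<omega>)\<^sup>2 \<partial>P) \<le> B" if P: "P \<in> \<P>" for P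
  proof
    interpret prob_space P using path_probsD(1)[OF Lip_dominated_path_probs[OF P]] .
    have le: "(X \<omega>)\<^sup>2 \<le> 2 * \<bar>Y N0 \<omega> - X \<omega>\<bar>\<^sup>2 + 2 * K\<^sup>2" for \<omega>
    proof -
      have "(X \<omega>)\<^sup>2 \<le> 2 * (Y N0 \<omega>)\<^sup>2 + 2 * (Y N0 \<omega> - X \<omega>)\<^sup>2"
        using square_diff_le[of "Y N0 \<omega>" "Y N0 \<omega> - X \<omega>"] by simp
      moreover have "(Y N0 \<omega>)\<^sup>2 \<le> K\<^sup>2" using K(2)[of \<omega>] K(1) by (simp add: abs_le_square_iff[symmetric])
      ultimately show ?thesis by simp
    qed
    have i: "integrable P (\<lambda>\<omega>. 2 * \<bar>Y N0 \<omega> - X \<omega>\<bar>\<^sup>2 + 2 * K\<^sup>2)" using N0(1)[OF order_refl P] by auto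
    show iX: "integrable P (\<lambda>\<omega>. (X \<omega>)\<^sup>2)"
      by (rule Bochner_Integration.integrable_bound[OF i])
        (use unif_approx_measurable[OF A P] le in \<open>auto intro!: AE_I2 order_trans[OF _ abs_ge_self]\<close>)
    have "(\<integral>\<omega>. (X \<omega>)\<^sup>2 \<partial>P) \<le> (\<integral>\<omega>. 2 * \<bar>Y N0 \<omega> - X \<omega>\<bar>\<^sup>2 + 2 * K\<^sup>2 \<partial>P)" by (rule integral_mono[OF iX i le])
    also have "\<dots> = 2 * (\<integral>\<omega>. \<bar>Y N0 \<omega> - X \<omega>\<bar>\<^sup>2 \<partial>P) + 2 * K\<^sup>2"
      using N0(1)[OF order_refl P] by (subst Bochner_Integration.integral_add) (auto simp: prob_space)
    also have "\<dots> \<le> B" using N0(2)[OF order_refl P] by (simp add: B_def)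
    finally show "(\<integral>\<omega>. (X \<omega>)\<^sup>2 \<partial>P) \<le> B" .
  qed
  fix \<epsilon> :: real assume \<epsilon>: "0 < \<epsilon>"
  \<comment> \<open>Makes the term \<open>8 * \<delta> * B\<close> equal to
    \<open>\<epsilon> / 2\<close>; the other half is left to the approximation error, weighted by
    \<open>c\<close>.\<close>
  define \<delta> where "\<delta> = \<epsilon> / (16 * B)"
  have \<delta>: "0 < \<delta>" using \<epsilon> B by (simp add: \<delta>_def)
  define c where "c = 1 / \<delta> + 2 * \<delta>"
  have c: "0 < c" using \<delta> by (simp add: c_def add_pos_pos)
  have ec: "0 < \<epsilon> / (2 * c)" using \<epsilon> c by simp
  obtain N where N: "\<And>n P. n \<ge> N \<Longrightarrow> P \<in> \<P> \<Longrightarrow> integrable P (\<lambda>\<omega>. \<bar>Y n \<omega> - X \<omega>\<bar> ^ 2)"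
    "\<And>n P. n \<ge> N \<Longrightarrow> P \<in> \<P> \<Longrightarrow> (\<integral>\<omega>. \<bar>Y n \<omega> - X \<omega>\<bar> ^ 2 \<partial>P) \<le> \<epsilon> / (2 * c)"
    by (rule unif_approxE[OF A ec]) (rule that)
  have pt: "\<bar>a\<^sup>2 - b\<^sup>2\<bar> \<le> c * (a - b)\<^sup>2 + 8 * \<delta> * b\<^sup>2" for a b :: real
  proof -
    have am: "\<bar>(a - b) * (a + b)\<bar> \<le> (a - b)\<^sup>2 / \<delta> + \<delta> * (a + b)\<^sup>2"
    proof -
      have "0 \<le> (\<bar>a - b\<bar> - \<delta> * \<bar>a + b\<bar>)\<^sup>2" by simp
      then have "2 * \<delta> * (\<bar>a - b\<bar> * \<bar>a + b\<bar>) \<le> (a - b)\<^sup>2 + \<delta>\<^sup>2 * (a + b)\<^sup>2"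
        by (simp add: power2_diff power_mult_distrib algebra_simps)
      moreover have "0 \<le> \<delta> * (\<bar>a - b\<bar> * \<bar>a + b\<bar>)" using \<delta> by simp
      ultimately have "\<delta> * (\<bar>a - b\<bar> * \<bar>a + b\<bar>) \<le> (a - b)\<^sup>2 + \<delta>\<^sup>2 * (a + b)\<^sup>2" by linarith
      also have "\<dots> = \<delta> * ((a - b)\<^sup>2 / \<delta> + \<delta> * (a + b)\<^sup>2)" using \<delta> by (simp add: field_simps power2_eq_square)
      finally show ?thesis using \<delta> by (simp add: abs_mult)
    qed
    have "(a + b)\<^sup>2 \<le> 2 * (a - b)\<^sup>2 + 8 * b\<^sup>2" using square_add_le[of "a - b" "2 * b"] by (simp add: power_mult_distrib add.commute)
    then have "\<delta> * (a + b)\<^sup>2 \<le> \<delta> * (2 * (a - b)\<^sup>2 + 8 * b\<^sup>2)" using \<delta> by simp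
    with am have "\<bar>(a - b) * (a + b)\<bar> \<le> (a - b)\<^sup>2 / \<delta> + \<delta> * (2 * (a - b)\<^sup>2 + 8 * b\<^sup>2)" by linarith
    moreover have "a\<^sup>2 - b\<^sup>2 = (a - b) * (a + b)" by (simp add: power2_eq_square algebra_simps)
    ultimately show ?thesis by (simp add: c_def algebra_simps)
  qed
  show "\<exists>N. \<forall>n\<ge>N. \<forall>P\<in>\<P>. \<exists>Z. integrable P Z \<and>
      (\<forall>\<omega>. \<bar>(Y n \<omega>)\<^sup>2 - (X \<omega>)\<^sup>2\<bar> ^ 1 \<le> Z \<omega>) \<and> (integral\<^sup>L P Z) \<le> \<epsilon>"
  proof (intro exI[of _ N] allI impI ballI)
    fix n P assume n: "N \<le> n" and P: "P \<in> \<P>"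
    let ?Z = "\<lambda>\<omega>. c * \<bar>Y n \<omega> - X \<omega>\<bar>\<^sup>2 + 8 * \<delta> * (X \<omega>)\<^sup>2"
    have iZ: "integrable P ?Z" using N(1)[OF n P] X2[OF P] by auto
    have "(integral\<^sup>L P ?Z) = c * (\<integral>\<omega>. \<bar>Y n \<omega> - X \<omega>\<bar>\<^sup>2 \<partial>P) + 8 * \<delta> * (\<integral>\<omega>. (X \<omega>)\<^sup>2 \<partial>P)"
      using N(1)[OF n P] X2[OF P] by (subst Bochner_Integration.integral_add) auto
    also have "\<dots> \<le> c * (\<epsilon> / (2 * c)) + 8 * \<delta> * B"
      using N(2)[OF n P] X2[OF P] c \<delta> by (intro add_mono mult_left_mono) auto
    also have "\<dots> = \<epsilon>" using c B by (simp add: \<delta>_def)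
    finally show "\<exists>Z. integrable P Z \<and>
      (\<forall>\<omega>. \<bar>(Y n \<omega>)\<^sup>2 - (X \<omega>)\<^sup>2\<bar> ^ 1 \<le> Z \<omega>) \<and> (integral\<^sup>L P Z) \<le> \<epsilon>"
      using iZ pt by (intro exI[of _ ?Z]) auto
  qed
qed

text \<open>A bound on \<open>Ehat\<close> controls integrals only for functions known to lie in
  \<open>LG T E 1 T\<close>; this membership is what makes the regularity hypothesis usable.\<close>

lemma LG2_square_sum_mem_LG1:
  assumes "X \<in> LG T E 2 T" "X' \<in> LG T E 2 T" "Z \<in> LG T E 2 T" "Z' \<in> LG T E 2 T"
  shows "(\<lambda>\<omega>. \<bar>X \<omega> - X' \<omega>\<bar>\<^sup>2 + \<bar>Z \<omega> - Z' \<omega>\<bar>\<^sup>2) \<in> LG T E 1 T"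
proof -
  obtain Y1 Y2 Y3 Y4 where "unif_approx 2 Y1 X" "unif_approx 2 Y2 X'" "unif_approx 2 Y3 Z" "unif_approx 2 Y4 Z'"
    using assms LG_iff_unif_approx[of 2] by auto
  then have "unif_approx 1 (\<lambda>n \<omega>. (Y1 n \<omega> - Y2 n \<omega>)\<^sup>2 + (Y3 n \<omega> - Y4 n \<omega>)\<^sup>2) (\<lambda>\<omega>. (X \<omega> - X' \<omega>)\<^sup>2 + (Z \<omega> - Z' \<omega>)\<^sup>2)"
    by (intro unif_approx_add1 unif_approx_square unif_approx_diff2)
  then show ?thesis using LG_iff_unif_approx[of 1] by auto
qed

text \<open>Pointwise \<open>\<bar>z\<bar> \<le> d + z\<^sup>2 / d\<close>, and the integral of the
  square is at most \<open>C * d\<^sup>2\<close>, uniformly in the measure.\<close>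

lemma LG2_integral_diff_le:
  assumes X: "X \<in> LG T E 2 T" "X' \<in> LG T E 2 T" and Z: "Z \<in> LG T E 2 T" "Z' \<in> LG T E 2 T"
    and bound: "Ehat T E (\<lambda>\<omega>. \<bar>X \<omega> - X' \<omega>\<bar>\<^sup>2 + \<bar>Z \<omega> - Z' \<omega>\<bar>\<^sup>2) \<le> C * d\<^sup>2" and d: "0 < d"
    and P: "P \<in> \<P>"
  shows "\<bar>(integral\<^sup>L P X) - (integral\<^sup>L P X')\<bar> \<le> (1 + C) * d"
    and "\<bar>(integral\<^sup>L P Z) - (integral\<^sup>L P Z')\<bar> \<le> (1 + C) * d"
proof -
  interpret prob_space P using path_probsD(1)[OF Lip_dominated_path_probs[OF P]] .
  let ?S = "\<lambda>\<omega>. \<bar>X \<omega> - X' \<omega>\<bar>\<^sup>2 + \<bar>Z \<omega> - Z' \<omega>\<bar>\<^sup>2"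
  have S: "?S \<in> LG T E 1 T" by (rule LG2_square_sum_mem_LG1[OF X Z])
  have iS: "integrable P ?S" by (rule LG1_integrable[OF S P])
  have Sle: "(integral\<^sup>L P ?S) \<le> C * d\<^sup>2" using Ehat_upper[OF S P] bound by linarith
  have gen: "\<bar>(integral\<^sup>L P U) - (integral\<^sup>L P U')\<bar> \<le> (1 + C) * d"
    if U: "U \<in> LG T E 2 T" "U' \<in> LG T E 2 T" and le: "\<And>\<omega>. (U \<omega> - U' \<omega>)\<^sup>2 \<le> ?S \<omega>" for U U'
  proof -
    have i: "integrable P U" "integrable P U'" using U by (auto intro: LG1_integrable[OF LG2_subset_LG1 P])
    have "\<bar>(integral\<^sup>L P U) - (integral\<^sup>L P U')\<bar> = \<bar>\<integral>\<omega>. U \<omega> - U' \<omega> \<partial>P\<bar>" using i by simp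
    also have "\<dots> \<le> (\<integral>\<omega>. \<bar>U \<omega> - U' \<omega>\<bar> \<partial>P)" by (rule integral_abs_bound)
    also have "\<dots> \<le> (\<integral>\<omega>. d + ?S \<omega> / d \<partial>P)"
    proof (rule integral_mono)
      show "\<bar>U \<omega> - U' \<omega>\<bar> \<le> d + ?S \<omega> / d" for \<omega>
        using abs_le_add_square[OF d, of "U \<omega> - U' \<omega>"] divide_right_mono[OF le[of \<omega>], of d] d by linarith
    qed (use i iS in auto)
    also have "\<dots> = d + (integral\<^sup>L P ?S) / d"
      using iS by (subst Bochner_Integration.integral_add) (auto simp: prob_space)
    also have "\<dots> \<le> d + C * d\<^sup>2 / d" using Sle d by (intro add_left_mono divide_right_mono) auto
    also have "\<dots> = (1 + C) * d" using d by (simp add: power2_eq_square algebra_simps)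
    finally show ?thesis .
  qed
  show "\<bar>(integral\<^sup>L P X) - (integral\<^sup>L P X')\<bar> \<le> (1 + C) * d" by (rule gen[OF X]) simp
  show "\<bar>(integral\<^sup>L P Z) - (integral\<^sup>L P Z')\<bar> \<le> (1 + C) * d" by (rule gen[OF Z]) simp
qed

end

subsection \<open>Iterated maximisation over a compact metric space\<close>

text \<open>Joint continuity in parameter and point is stated along sequences, the form in which
  compactness is used throughout.\<close>

locale compact_metric_family = Metric_space M d for M :: "'a set" and d +
  fixes I :: "real set" and \<phi> \<psi> :: "real \<Rightarrow> 'a \<Rightarrow> real"
  assumes compact: "compact_space mtopology" and nonempty: "M \<noteq> {}" and closed_I: "closed I"
    and cont_\<phi>: "\<And>s t \<sigma> x. (\<And>n. s n \<in> I) \<Longrightarrow> s \<longlonglongrightarrow> t \<Longrightarrow> t \<in> I \<Longrightarrow> (\<And>n. \<sigma> n \<in> M) \<Longrightarrow>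
      limitin mtopology \<sigma> x sequentially \<Longrightarrow> (\<lambda>n. \<phi> (s n) (\<sigma> n)) \<longlonglongrightarrow> \<phi> t x"
    and cont_\<psi>: "\<And>s t \<sigma> x. (\<And>n. s n \<in> I) \<Longrightarrow> s \<longlonglongrightarrow> t \<Longrightarrow> t \<in> I \<Longrightarrow> (\<And>n. \<sigma> n \<in> M) \<Longrightarrow>
      limitin mtopology \<sigma> x sequentially \<Longrightarrow> (\<lambda>n. \<psi> (s n) (\<sigma> n)) \<longlonglongrightarrow> \<psi> t x"
begin

definition argmax1 :: "real \<Rightarrow> 'a set" where
  "argmax1 t = {x \<in> M. \<forall>y\<in>M. \<phi> t y \<le> \<phi> t x}"

definition argmax2 :: "real \<Rightarrow> 'a set" where
  "argmax2 t = {x \<in> argmax1 t. \<forall>y\<in>argmax1 t. \<psi> t y \<le> \<psi> t x}"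

lemma convergent_subsequence:
  assumes K: "closedin mtopology K" and \<sigma>: "\<And>n :: nat. \<sigma> n \<in> K"
  obtains x r where "x \<in> K" "strict_mono r" "limitin mtopology (\<lambda>n. \<sigma> (r n)) x sequentially"
proof -
  have "range \<sigma> \<subseteq> M" using \<sigma> closedin_subset[OF K] by auto
  then obtain x r where xr: "strict_mono r" "limitin mtopology (\<sigma> \<circ> r) x sequentially"
    using compact unfolding compact_space_sequentially by blast
  moreover have "range (\<sigma> \<circ> r) \<subseteq> K" using \<sigma> by auto
  then have "x \<in> K" using K xr(2) unfolding metric_closedin_iff_sequentially_closed by blast
  ultimately show thesis using that[of x r] by (simp add: o_def)
qed

text \<open>Convergent subsequences are used twice: along points with values above \<open>n\<close>,
  to show boundedness, and along a maximising sequence.\<close>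

lemma attains_max:
  fixes f :: "'a \<Rightarrow> real"
  assumes K: "closedin mtopology K" "K \<noteq> {}"
    and f: "\<And>\<sigma> x. (\<And>n. \<sigma> n \<in> M) \<Longrightarrow> limitin mtopology \<sigma> x sequentially \<Longrightarrow> (\<lambda>n. f (\<sigma> n)) \<longlonglongrightarrow> f x"
  obtains x where "x \<in> K" "\<And>y. y \<in> K \<Longrightarrow> f y \<le> f x"
proof -
  have KM: "y \<in> M" if "y \<in> K" for y using closedin_subset[OF K(1)] that by auto
  have bdd: "bdd_above (f ` K)"
  proof (rule ccontr)
    assume "\<not> bdd_above (f ` K)"
    then have "\<exists>y\<in>K. real n < f y" for n by (auto simp: bdd_above_def not_le)
    then obtain \<sigma> where \<sigma>: "\<And>n. \<sigma> n \<in> K" "\<And>n. real n < f (\<sigma> n)" by metis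
    obtain x r where xr: "x \<in> K" "strict_mono r" "limitin mtopology (\<lambda>n. \<sigma> (r n)) x sequentially"
      by (rule convergent_subsequence[where \<sigma> = \<sigma>, OF K(1) \<sigma>(1)]) (rule that)
    have "(\<lambda>n. f (\<sigma> (r n))) \<longlonglongrightarrow> f x" by (rule f[OF KM[OF \<sigma>(1)] xr(3)])
    then have "Bseq (\<lambda>n. f (\<sigma> (r n)))" by (intro convergent_imp_Bseq convergentI)
    then obtain B where B: "\<forall>n. norm (f (\<sigma> (r n))) \<le> B" by (auto simp: Bseq_def)
    obtain n :: nat where "B < real n" using reals_Archimedean2 by blast
    also have "real n \<le> real (r n)" using seq_suble[OF xr(2)] by simp
    also have "\<dots> < f (\<sigma> (r n))" by (rule \<sigma>)
    finally show False using B[rule_format, of n] by simp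
  qed
  define S where "S = (SUP y\<in>K. f y)"
  have "\<exists>y\<in>K. S - 1 / real (Suc n) < f y" for n
    using less_cSUP_iff[OF K(2) bdd, of "S - 1 / real (Suc n)"] by (simp add: S_def)
  then obtain \<sigma> where \<sigma>: "\<And>n. \<sigma> n \<in> K" "\<And>n. S - 1 / real (Suc n) < f (\<sigma> n)" by metis
  obtain x r where xr: "x \<in> K" "strict_mono r" "limitin mtopology (\<lambda>n. \<sigma> (r n)) x sequentially"
    by (rule convergent_subsequence[where \<sigma> = \<sigma>, OF K(1) \<sigma>(1)]) (rule that)
  have lim: "(\<lambda>n. f (\<sigma> (r n))) \<longlonglongrightarrow> f x" by (rule f[OF KM[OF \<sigma>(1)] xr(3)])
  have "(\<lambda>n. S - inverse (real (Suc n))) \<longlonglongrightarrow> S - 0" by (intro tendsto_intros LIMSEQ_inverse_real_of_nat)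
  then have "(\<lambda>n. S - inverse (real (Suc (r n)))) \<longlonglongrightarrow> S"
    using LIMSEQ_subseq_LIMSEQ[OF _ xr(2)] by (fastforce simp: o_def)
  then have "S \<le> f x"
    by (rule LIMSEQ_le[OF _ lim]) (use \<sigma>(2) in \<open>auto simp: inverse_eq_divide intro: less_imp_le\<close>)
  moreover have "f y \<le> S" if "y \<in> K" for y unfolding S_def by (rule cSUP_upper[OF that bdd])
  ultimately show thesis using that[OF xr(1)] by (meson order_trans)
qed

lemma cont_at:
  assumes "t \<in> I" "\<And>n. \<sigma> n \<in> M" "limitin mtopology \<sigma> x sequentially"
  shows "(\<lambda>n. \<phi> t (\<sigma> n)) \<longlonglongrightarrow> \<phi> t x" "(\<lambda>n. \<psi> t (\<sigma> n)) \<longlonglongrightarrow> \<psi> t x"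
  using cont_\<phi>[of "\<lambda>_. t" t \<sigma> x] cont_\<psi>[of "\<lambda>_. t" t \<sigma> x] assms by auto

text \<open>The graph of the maximisers is closed: a competitor \<open>y\<close> stays fixed while
  time and maximiser converge, and the inequality passes to the limit. The second stage admits no
  such argument, because its competitors vary with time.\<close>

lemma argmax1_limit:
  assumes s: "\<And>n. s n \<in> I" "s \<longlonglongrightarrow> t" "t \<in> I" and \<sigma>: "\<And>n. \<sigma> n \<in> argmax1 (s n)"
    and x: "limitin mtopology \<sigma> x sequentially"
  shows "x \<in> argmax1 t"
proof -
  have \<sigma>M: "\<sigma> n \<in> M" for n using \<sigma>[of n] by (simp add: argmax1_def)
  have "\<phi> t y \<le> \<phi> t x" if y: "y \<in> M" for y
  proof (rule LIMSEQ_le[OF _ cont_\<phi>[OF s \<sigma>M x]])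
    show "(\<lambda>n. \<phi> (s n) y) \<longlonglongrightarrow> \<phi> t y" by (rule cont_\<phi>[OF s]) (use y in auto)
    show "\<exists>N. \<forall>n\<ge>N. \<phi> (s n) y \<le> \<phi> (s n) (\<sigma> n)" using \<sigma> y by (auto simp: argmax1_def)
  qed
  then show ?thesis using limitin_mspace[OF x] by (simp add: argmax1_def)
qed

lemma argmax1_closed:
  assumes t: "t \<in> I"
  shows "closedin mtopology (argmax1 t)"
  unfolding metric_closedin_iff_sequentially_closed
proof (intro conjI allI impI)
  show "argmax1 t \<subseteq> M" by (auto simp: argmax1_def)
  fix \<sigma> :: "nat \<Rightarrow> 'a" and x assume a: "range \<sigma> \<subseteq> argmax1 t \<and> limitin mtopology \<sigma> x sequentially"
  show "x \<in> argmax1 t" by (rule argmax1_limit[of "\<lambda>_. t"]) (use t a in auto)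
qed

lemma argmax1_nonempty:
  assumes t: "t \<in> I"
  shows "argmax1 t \<noteq> {}"
proof -
  have "closedin mtopology M" using closedin_topspace[of mtopology] by simp
  then obtain x where "x \<in> M" "\<And>y. y \<in> M \<Longrightarrow> \<phi> t y \<le> \<phi> t x"
    using attains_max[of M "\<phi> t"] nonempty cont_at(1)[OF t] by blast
  then show ?thesis by (auto simp: argmax1_def)
qed

lemma argmax2_nonempty: "t \<in> I \<Longrightarrow> argmax2 t \<noteq> {}"
proof -
  assume t: "t \<in> I"
  obtain x where "x \<in> argmax1 t" "\<And>y. y \<in> argmax1 t \<Longrightarrow> \<psi> t y \<le> \<psi> t x"
    using attains_max[OF argmax1_closed[OF t] argmax1_nonempty[OF t], of "\<psi> t"] cont_at(2)[OF t] by blast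
  then show ?thesis by (auto simp: argmax2_def)
qed

lemma argmax2_closed:
  assumes t: "t \<in> I"
  shows "closedin mtopology (argmax2 t)"
  unfolding metric_closedin_iff_sequentially_closed
proof (intro conjI allI impI)
  show "argmax2 t \<subseteq> M" by (auto simp: argmax2_def argmax1_def)
  fix \<sigma> :: "nat \<Rightarrow> 'a" and x assume a: "range \<sigma> \<subseteq> argmax2 t \<and> limitin mtopology \<sigma> x sequentially"
  then have \<sigma>: "\<sigma> n \<in> argmax2 t" for n by auto
  have "x \<in> argmax1 t"
    using argmax1_limit[of "\<lambda>_. t" t \<sigma> x] \<sigma> t a by (auto simp: argmax2_def)
  moreover have "\<psi> t y \<le> \<psi> t x" if "y \<in> argmax1 t" for y
  proof (rule LIMSEQ_le_const[of "\<lambda>n. \<psi> t (\<sigma> n)"])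
    show "(\<lambda>n. \<psi> t (\<sigma> n)) \<longlonglongrightarrow> \<psi> t x"
      using cont_at(2)[OF t, of \<sigma> x] \<sigma> a by (auto simp: argmax2_def argmax1_def)
    show "\<exists>N. \<forall>n\<ge>N. \<psi> t y \<le> \<psi> t (\<sigma> n)" using \<sigma> that by (auto simp: argmax2_def)
  qed
  ultimately show "x \<in> argmax2 t" by (simp add: argmax2_def)
qed

text \<open>
  The sets \<open>level K a\<close> are projections of compact sets, hence closed; comparing them for \<open>K\<close> and
  for the whole space at rational levels decides whether \<open>argmax2 t\<close> meets \<open>K\<close>.
\<close>

definition level :: "'a set \<Rightarrow> real \<Rightarrow> real set" where
  "level K a = {t \<in> I. \<exists>x\<in>K. x \<in> argmax1 t \<and> a \<le> \<psi> t x}"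

lemma level_closed:
  assumes K: "closedin mtopology K"
  shows "closed (level K a)"
  unfolding closed_sequential_limits
proof (intro allI impI)
  fix s t assume a: "(\<forall>n. s n \<in> level K a) \<and> s \<longlonglongrightarrow> t"
  have sI: "s n \<in> I" for n using a by (auto simp: level_def)
  have t: "t \<in> I" using closed_I a sI unfolding closed_sequential_limits by blast
  have "\<forall>n. \<exists>x. x \<in> K \<and> x \<in> argmax1 (s n) \<and> a \<le> \<psi> (s n) x" using a by (auto simp: level_def)
  then obtain \<sigma> where \<sigma>: "\<And>n. \<sigma> n \<in> K" "\<And>n. \<sigma> n \<in> argmax1 (s n)" "\<And>n. a \<le> \<psi> (s n) (\<sigma> n)" by metis
  obtain x r where xr: "x \<in> K" "strict_mono r" "limitin mtopology (\<lambda>n. \<sigma> (r n)) x sequentially"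
    by (rule convergent_subsequence[where \<sigma> = \<sigma>, OF K \<sigma>(1)]) (rule that)
  have lim: "(\<lambda>n. s (r n)) \<longlonglongrightarrow> t" using LIMSEQ_subseq_LIMSEQ[of s t r] a xr(2) by (simp add: o_def)
  have "x \<in> argmax1 t" by (rule argmax1_limit[OF sI lim t \<sigma>(2) xr(3)])
  moreover have "a \<le> \<psi> t x"
  proof (rule LIMSEQ_le_const[OF cont_\<psi>[OF sI lim t _ xr(3)]])
    show "\<sigma> (r n) \<in> M" for n using \<sigma>(1) closedin_subset[OF K] by auto
  qed (use \<sigma>(3) in auto)
  ultimately show "t \<in> level K a" using t xr(1) by (auto simp: level_def)
qed

text \<open>The right side says that restricting the first-stage maximisers to \<open>K\<close> does
  not lower the best second value; as \<open>K\<close> is compact, that value is then attained in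
  \<open>K\<close>.\<close>

lemma argmax2_meets_iff:
  assumes K: "closedin mtopology K" and t: "t \<in> I"
  shows "argmax2 t \<inter> K \<noteq> {} \<longleftrightarrow> (\<forall>q::rat. t \<in> level M (of_rat q) \<longrightarrow> t \<in> level K (of_rat q))"
proof
  assume "argmax2 t \<inter> K \<noteq> {}"
  then obtain x where "x \<in> argmax2 t" "x \<in> K" by blast
  then show "\<forall>q::rat. t \<in> level M (of_rat q) \<longrightarrow> t \<in> level K (of_rat q)"
    by (fastforce simp: level_def argmax2_def)
next
  assume q: "\<forall>q::rat. t \<in> level M (of_rat q) \<longrightarrow> t \<in> level K (of_rat q)"
  obtain z where z: "z \<in> argmax2 t" using argmax2_nonempty[OF t] by blast
  have low: "\<exists>x\<in>K. x \<in> argmax1 t \<and> of_rat q \<le> \<psi> t x" if "of_rat q < \<psi> t z" for q :: rat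
  proof -
    have "t \<in> level M (of_rat q)" using z t that by (auto simp: level_def argmax2_def argmax1_def intro!: bexI[of _ z])
    then show ?thesis using q by (auto simp: level_def)
  qed
  have cl: "closedin mtopology (K \<inter> argmax1 t)" by (intro closedin_Int K argmax1_closed t)
  \<comment> \<open>Any rational level below the optimum shows that \<open>K\<close> contains a
    first-stage maximiser at all.\<close>
  obtain q0 :: rat where "of_rat q0 < \<psi> t z" using of_rat_dense[of "\<psi> t z - 1" "\<psi> t z"] by auto
  then have ne: "K \<inter> argmax1 t \<noteq> {}" using low by blast
  obtain x where x: "x \<in> K \<inter> argmax1 t" "\<And>y. y \<in> K \<inter> argmax1 t \<Longrightarrow> \<psi> t y \<le> \<psi> t x"
    using attains_max[OF cl ne, of "\<psi> t"] cont_at(2)[OF t] by blast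
  have "\<psi> t z \<le> \<psi> t x"
  proof (rule ccontr)
    assume "\<not> \<psi> t z \<le> \<psi> t x"
    then obtain q where "\<psi> t x < of_rat q" "of_rat q < \<psi> t z" using of_rat_dense[of "\<psi> t x" "\<psi> t z"] by auto
    then show False using low[of q] x(2) by fastforce
  qed
  then have "x \<in> argmax2 t" using x(1) z by (auto simp: argmax2_def intro: order_trans)
  then show "argmax2 t \<inter> K \<noteq> {}" using x(1) by blast
qed

text \<open>\<open>K n\<close> consists of the points at distance at least
  \<open>1 / (n + 1)\<close> from the complement. Measurability for open sets thus reduces to closed
  ones.\<close>

lemma open_eq_Union_closed:
  assumes U: "openin mtopology U"
  obtains K :: "nat \<Rightarrow> 'a set" where "\<And>n. closedin mtopology (K n)" "U = (\<Union>n. K n)"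
proof
  let ?K = "\<lambda>n. {x \<in> M. \<forall>y\<in>M - U. 1 / real (Suc n) \<le> d x y}"
  show "closedin mtopology (?K n)" for n
    unfolding metric_closedin_iff_sequentially_closed
  proof (intro conjI allI impI)
    fix \<sigma> x assume a: "range \<sigma> \<subseteq> ?K n \<and> limitin mtopology \<sigma> x sequentially"
    then have x: "x \<in> M" using limitin_mspace by blast
    have "1 / real (Suc n) \<le> d x y" if y: "y \<in> M - U" for y
    proof (rule field_le_epsilon)
      fix e :: real assume "0 < e"
      then obtain m where m: "\<sigma> m \<in> M" "d (\<sigma> m) x < e" using a unfolding limit_metric_sequentially by blast
      have "1 / real (Suc n) \<le> d (\<sigma> m) y" using a y by auto
      also have "\<dots> \<le> d (\<sigma> m) x + d x y" using m x y by (intro triangle) auto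
      finally show "1 / real (Suc n) \<le> d x y + e" using m by linarith
    qed
    then show "x \<in> ?K n" using x by simp
  qed auto
  show "U = (\<Union>n. ?K n)"
  proof (intro equalityI subsetI)
    fix x assume x: "x \<in> U"
    then have xM: "x \<in> M" using U by (auto simp: openin_mtopology)
    obtain r where r: "r > 0" "mball x r \<subseteq> U" using x U openin_mtopology by blast
    obtain n where n: "inverse (real (Suc n)) < r" using reals_Archimedean[OF r(1)] by blast
    have "1 / real (Suc n) \<le> d x y" if y: "y \<in> M - U" for y
    proof (rule ccontr)
      assume "\<not> 1 / real (Suc n) \<le> d x y"
      then have "y \<in> mball x r" using n xM y by (simp add: inverse_eq_divide)
      then show False using r(2) y by blast
    qed
    then show "x \<in> (\<Union>n. ?K n)" using xM by blast
  next
    fix x assume "x \<in> (\<Union>n. ?K n)"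
    then obtain n where n: "x \<in> M" "\<forall>y\<in>M - U. 1 / real (Suc n) \<le> d x y" by blast
    show "x \<in> U"
    proof (rule ccontr)
      assume "x \<notin> U"
      then have "1 / real (Suc n) \<le> d x x" using n by blast
      then show False using n(1) by simp
    qed
  qed
qed

theorem argmax2_weakly_measurable: "weakly_measurable (restrict_space borel I) mtopology argmax2"
  unfolding weakly_measurable_def
proof (intro conjI ballI allI impI)
  have sp: "space (restrict_space borel I) = I" by (simp add: space_restrict_space)
  show "argmax2 t \<noteq> {}" "closedin mtopology (argmax2 t)" if "t \<in> space (restrict_space borel I)" for t
    using that argmax2_nonempty argmax2_closed by (auto simp: sp)
  have I: "I \<in> sets borel" using closed_I by simp
  have lev: "level K a \<in> sets (restrict_space borel I)" if "closedin mtopology K" for K a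
    using level_closed[OF that, of a] I by (auto simp: sets_restrict_space_iff level_def)
  have meet: "{t \<in> I. argmax2 t \<inter> K \<noteq> {}} \<in> sets (restrict_space borel I)" if K: "closedin mtopology K" for K
  proof -
    \<comment> \<open>Each implication between levels becomes a union with a complement, and
      rational levels keep the intersection countable.\<close>
    have "{t \<in> I. argmax2 t \<inter> K \<noteq> {}} = (\<Inter>q::rat. level K (of_rat q) \<union> (space (restrict_space borel I) - level M (of_rat q)))"
    proof (intro equalityI subsetI)
      fix t assume "t \<in> {t \<in> I. argmax2 t \<inter> K \<noteq> {}}"
      then show "t \<in> (\<Inter>q::rat. level K (of_rat q) \<union> (space (restrict_space borel I) - level M (of_rat q)))"
        using argmax2_meets_iff[OF K, of t] unfolding sp by blast
    next
      fix t assume a: "t \<in> (\<Inter>q::rat. level K (of_rat q) \<union> (space (restrict_space borel I) - level M (of_rat q)))"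
      then have "t \<in> I" unfolding sp level_def by blast
      with a show "t \<in> {t \<in> I. argmax2 t \<inter> K \<noteq> {}}" using argmax2_meets_iff[OF K, of t] by blast
    qed
    also have "\<dots> \<in> sets (restrict_space borel I)"
      using lev[OF K] lev[of M] closedin_topspace[of mtopology] by (intro sets.countable_INT' image_subsetI sets.Un sets.compl_sets) auto
    finally show ?thesis .
  qed
  fix U assume "openin mtopology U"
  then obtain K :: "nat \<Rightarrow> 'a set" where K: "\<And>n. closedin mtopology (K n)" "U = (\<Union>n. K n)"
    using open_eq_Union_closed by blast
  have "{t \<in> space (restrict_space borel I). argmax2 t \<inter> U \<noteq> {}} = (\<Union>n. {t \<in> I. argmax2 t \<inter> K n \<noteq> {}})"
    using K(2) by (auto simp: sp)
  also have "\<dots> \<in> sets (restrict_space borel I)" using meet[OF K(1)] by auto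
  finally show "{t \<in> space (restrict_space borel I). argmax2 t \<inter> U \<noteq> {}} \<in> sets (restrict_space borel I)" .
qed

lemma argmax2_compact: "t \<in> I \<Longrightarrow> compactin mtopology (argmax2 t)"
  by (rule closedin_compact_space[OF compact argmax2_closed])

end

subsection \<open>Iterated maximising measures\<close>

context lip_expectation
begin

lemma Ehat_attained_iff:
  assumes X: "X \<in> LG T E 1 T" and P: "P \<in> \<P>"
  shows "(integral\<^sup>L P X) = Ehat T E X \<longleftrightarrow> (\<forall>Q\<in>\<P>. (integral\<^sup>L Q X) \<le> (integral\<^sup>L P X))"
proof
  assume "\<forall>Q\<in>\<P>. (integral\<^sup>L Q X) \<le> (integral\<^sup>L P X)"
  then have "Ehat T E X \<le> (integral\<^sup>L P X)" unfolding Ehat_eq_SUP[OF X] using P by (intro cSUP_least) auto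
  then show "(integral\<^sup>L P X) = Ehat T E X" using Ehat_upper[OF X P] by simp
qed (use Ehat_upper[OF X] in auto)

text \<open>The integrals of \<open>Z\<close> are bounded above by \<open>Ehat\<close>, so the real
  supremum is a true least upper bound, and reaching it is the same as being a maximiser.\<close>

lemma max_measures2_iff:
  assumes X: "X \<in> LG T E 1 T" and Z: "Z \<in> LG T E 1 T"
  shows "max_measures2 T E X Z = {R \<in> max_measures T E X. \<forall>Q\<in>max_measures T E X. (integral\<^sup>L Q Z) \<le> (integral\<^sup>L R Z)}"
proof -
  have bdd: "bdd_above ((\<lambda>P. \<integral>\<omega>. Z \<omega> \<partial>P) ` max_measures T E X)"
    using Ehat_upper[OF Z] by (intro bdd_aboveI2[where M = "Ehat T E Z"]) (auto simp: max_measures_def rep_measures_eq)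
  show ?thesis
    unfolding max_measures2_def Ehat_on_max_def
  proof (intro Collect_cong conj_cong refl iffI ballI)
    fix R Q assume "(integral\<^sup>L R Z) = (SUP P\<in>max_measures T E X. \<integral>\<omega>. Z \<omega> \<partial>P)" "Q \<in> max_measures T E X"
    then show "(integral\<^sup>L Q Z) \<le> (integral\<^sup>L R Z)" using cSUP_upper[OF _ bdd] by simp
  next
    fix R assume R: "R \<in> max_measures T E X" "\<forall>Q\<in>max_measures T E X. (integral\<^sup>L Q Z) \<le> (integral\<^sup>L R Z)"
    then show "(integral\<^sup>L R Z) = (SUP P\<in>max_measures T E X. \<integral>\<omega>. Z \<omega> \<partial>P)"
      by (intro antisym cSUP_upper[OF R(1) bdd] cSUP_least) auto
  qed
qed

text \<open>The change of time is controlled uniformly over the measures, so it may be carried out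
  under the moving measure \<open>\<sigma> n\<close>; what remains is convergence of measures at the
  fixed time \<open>t\<close>.\<close>

lemma integral_jointly_continuous:
  fixes \<xi> :: "real \<Rightarrow> (real \<Rightarrow> real) \<Rightarrow> real"
  assumes X: "\<xi> t \<in> LG T E 1 T"
    and incr: "\<And>n P. P \<in> \<P> \<Longrightarrow> \<bar>(integral\<^sup>L P (\<xi> (s n))) - (integral\<^sup>L P (\<xi> t))\<bar> \<le> c * sqrt \<bar>s n - t\<bar>"
    and s: "s \<longlonglongrightarrow> t" and \<sigma>: "\<And>n. \<sigma> n \<in> \<P>"
    and lim: "limitin (Metric_space.mtopology (\<P>) (BL_dist T)) \<sigma> P sequentially"
  shows "(\<lambda>n. \<integral>\<omega>. \<xi> (s n) \<omega> \<partial>\<sigma> n) \<longlonglongrightarrow> (integral\<^sup>L P (\<xi> t))"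
proof -
  have sub: "\<P> \<subseteq> path_probs T" by (auto simp: Lip_dominated_def)
  interpret B: Metric_space "\<P>" "BL_dist T" by (rule BL_dist_Metric_space[OF sub])
  have P: "P \<in> \<P>" by (rule B.limitin_mspace[OF lim])
  have 1: "(\<lambda>n. \<integral>\<omega>. \<xi> t \<omega> \<partial>\<sigma> n) \<longlonglongrightarrow> (integral\<^sup>L P (\<xi> t))"
  proof (rule LIMSEQ_I)
    fix r :: real assume "0 < r"
    then obtain \<delta> where \<delta>: "0 < \<delta>" "\<And>P Q. P \<in> \<P> \<Longrightarrow> Q \<in> \<P> \<Longrightarrow>
      BL_dist T P Q < \<delta> \<Longrightarrow> \<bar>(integral\<^sup>L P (\<xi> t)) - (integral\<^sup>L Q (\<xi> t))\<bar> < r"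
      using LG1_uniformly_continuous[OF X] by blast
    obtain N where "\<And>n. n \<ge> N \<Longrightarrow> BL_dist T (\<sigma> n) P < \<delta>"
      using lim \<delta>(1) unfolding B.limit_metric_sequentially by blast
    then show "\<exists>no. \<forall>n\<ge>no. norm ((integral\<^sup>L (\<sigma> n) (\<xi> t)) - (integral\<^sup>L P (\<xi> t))) < r"
      using \<delta>(2)[OF \<sigma> P] by (intro exI[of _ N]) auto
  qed
  have 2: "(\<lambda>n. (integral\<^sup>L (\<sigma> n) (\<xi> (s n))) - (integral\<^sup>L (\<sigma> n) (\<xi> t))) \<longlonglongrightarrow> 0"
  proof (rule Lim_null_comparison)
    show "\<forall>\<^sub>F n in sequentially. norm ((integral\<^sup>L (\<sigma> n) (\<xi> (s n))) - (integral\<^sup>L (\<sigma> n) (\<xi> t))) \<le> c * sqrt \<bar>s n - t\<bar>"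
      using incr[OF \<sigma>] by (intro always_eventually) auto
    have "(\<lambda>n. c * sqrt \<bar>s n - t\<bar>) \<longlonglongrightarrow> c * sqrt \<bar>t - t\<bar>" by (intro tendsto_intros s)
    then show "(\<lambda>n. c * sqrt \<bar>s n - t\<bar>) \<longlonglongrightarrow> 0" by simp
  qed
  show ?thesis using tendsto_add[OF 2 1] by simp
qed

end

theorem theorem6p8:
  fixes T \<sigma>lo \<sigma>hi C :: real
    and H :: "('w \<Rightarrow> real) set" and E' :: "('w \<Rightarrow> real) \<Rightarrow> real" and \<zeta> :: "nat \<Rightarrow> 'w \<Rightarrow> real"
    and E :: "((real \<Rightarrow> real) \<Rightarrow> real) \<Rightarrow> real"
    and \<xi> \<eta> :: "real \<Rightarrow> (real \<Rightarrow> real) \<Rightarrow> real"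
  assumes "0 < T" and "0 < \<sigma>lo\<^sup>2" and "\<sigma>lo\<^sup>2 \<le> \<sigma>hi\<^sup>2"
    and "G_expectation \<sigma>lo \<sigma>hi T H E' \<zeta> E"
    and "\<xi> \<in> MG2 T E" and "\<eta> \<in> MG2 T E"
    and "\<And>t. t \<in> {0..T} \<Longrightarrow> \<xi> t \<in> LG T E 2 T"
    and "\<And>t. t \<in> {0..T} \<Longrightarrow> \<eta> t \<in> LG T E 2 T"
    and "0 \<le> C"
    and "\<And>t s. t \<in> {0..T} \<Longrightarrow> s \<in> {0..T} \<Longrightarrow>
           Ehat T E (\<lambda>\<omega>. \<bar>\<xi> t \<omega> - \<xi> s \<omega>\<bar>\<^sup>2 + \<bar>\<eta> t \<omega> - \<eta> s \<omega>\<bar>\<^sup>2) \<le> C * \<bar>t - s\<bar>"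
  shows "weakly_measurable (restrict_space borel {0..T}) (rep_topology T E)
           (\<lambda>t. max_measures2 T E (\<xi> t) (\<eta> t))
       \<and> (\<forall>t\<in>{0..T}. max_measures2 T E (\<xi> t) (\<eta> t) \<noteq> {}
             \<and> compactin (rep_topology T E) (max_measures2 T E (\<xi> t) (\<eta> t)))"
proof -
  obtain M where "lip_expectation T M E"
    using G_expectation_imp_lip_expectation[OF assms(1,4)] by blast
  then interpret lip_expectation T M E .
  let ?PP = "Lip_dominated T E"
  have sub: "?PP \<subseteq> path_probs T" by (auto simp: Lip_dominated_def)
  interpret B: Metric_space ?PP "BL_dist T" by (rule BL_dist_Metric_space[OF sub])
  have \<xi>1: "\<xi> t \<in> LG T E 1 T" and \<eta>1: "\<eta> t \<in> LG T E 1 T" if "t \<in> {0..T}" for t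
    using assms(7,8)[OF that] LG2_subset_LG1 by auto
  have incr: "\<bar>(integral\<^sup>L P (\<xi> s)) - (integral\<^sup>L P (\<xi> t))\<bar> \<le> (1 + C) * sqrt \<bar>s - t\<bar> \<and>
      \<bar>(integral\<^sup>L P (\<eta> s)) - (integral\<^sup>L P (\<eta> t))\<bar> \<le> (1 + C) * sqrt \<bar>s - t\<bar>"
    if "s \<in> {0..T}" "t \<in> {0..T}" "P \<in> ?PP" for s t P
  proof (cases "s = t")
    case False
    \<comment> \<open>With \<open>d = sqrt \<bar>s - t\<bar>\<close> the regularity hypothesis takes
      the form \<open>C * d\<^sup>2\<close>; equal times are set apart because \<open>d\<close> must
      be positive.\<close>
    then have "Ehat T E (\<lambda>\<omega>. \<bar>\<xi> s \<omega> - \<xi> t \<omega>\<bar>\<^sup>2 + \<bar>\<eta> s \<omega> - \<eta> t \<omega>\<bar>\<^sup>2) \<le> C * (sqrt \<bar>s - t\<bar>)\<^sup>2" "0 < sqrt \<bar>s - t\<bar>"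
      using assms(10)[OF that(1,2)] by auto
    with LG2_integral_diff_le[OF assms(7)[OF that(1)] assms(7)[OF that(2)] assms(8)[OF that(1)] assms(8)[OF that(2)] _ _ that(3)]
    show ?thesis by blast
  qed simp
  interpret F: compact_metric_family ?PP "BL_dist T" "{0..T}" "\<lambda>t P. \<integral>\<omega>. \<xi> t \<omega> \<partial>P" "\<lambda>t P. \<integral>\<omega>. \<eta> t \<omega> \<partial>P"
  proof
    show "compact_space B.mtopology" using Lip_dominated_compact by (simp add: compact_space_def)
    show "?PP \<noteq> {}" using Lip_expectation_attained[OF Lip_const[OF T_nonneg, of 0]] by blast
    fix s :: "nat \<Rightarrow> real" and t \<sigma> P assume a: "\<And>n. s n \<in> {0..T}" "s \<longlonglongrightarrow> t" "t \<in> {0..T}" "\<And>n. \<sigma> n \<in> ?PP"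
      "limitin B.mtopology \<sigma> P sequentially"
    show "(\<lambda>n. \<integral>\<omega>. \<xi> (s n) \<omega> \<partial>\<sigma> n) \<longlonglongrightarrow> (integral\<^sup>L P (\<xi> t))"
      by (rule integral_jointly_continuous[where \<xi> = \<xi> and t = t and s = s and \<sigma> = \<sigma> and P = P and c = "1 + C"])
        (use \<xi>1[OF a(3)] incr[OF a(1,3)] a in blast)+
    show "(\<lambda>n. \<integral>\<omega>. \<eta> (s n) \<omega> \<partial>\<sigma> n) \<longlonglongrightarrow> (integral\<^sup>L P (\<eta> t))"
      by (rule integral_jointly_continuous[where \<xi> = \<eta> and t = t and s = s and \<sigma> = \<sigma> and P = P and c = "1 + C"])
        (use \<eta>1[OF a(3)] incr[OF a(1,3)] a in blast)+
  qed auto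
  have max1: "max_measures T E (\<xi> t) = F.argmax1 t" if "t \<in> {0..T}" for t
    using Ehat_attained_iff[OF \<xi>1[OF that]] by (auto simp: max_measures_def rep_measures_eq F.argmax1_def)
  have max2: "max_measures2 T E (\<xi> t) (\<eta> t) = F.argmax2 t" if "t \<in> {0..T}" for t
    unfolding max_measures2_iff[OF \<xi>1[OF that] \<eta>1[OF that]] max1[OF that] F.argmax2_def ..
  have top: "rep_topology T E = B.mtopology" by (simp add: rep_topology_def rep_measures_eq)
  have "weakly_measurable (restrict_space borel {0..T}) B.mtopology (\<lambda>t. max_measures2 T E (\<xi> t) (\<eta> t))"
    using F.argmax2_weakly_measurable max2
    by (simp add: weakly_measurable_def space_restrict_space cong: conj_cong)
  then show ?thesis using F.argmax2_nonempty F.argmax2_compact max2 top by simp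
qed

end
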